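(* Let $n \geq 2$, let $\mathbb{F}_n$ be the free group of rank $n$, let $A, B \leq \mathbb{F}_n$ be subgroups (each of them possibly equal to $\mathbb{F}_n$), let $\phi : A \to B$ be an isomorphism, and let $\Gamma = (\mathbb{F}_n,A,B,t)$ be the HNN extension of $\mathbb{F}_n$ relative to $A$, $B$ and $\phi$. Then $\mathrm{girth}(\Gamma) = \infty$.
   Context: HNN extension: for a group $G$, subgroups $A, B \leq G$ and an isomorphism $\phi : A \to B$, the HNN extension of $G$ relative to $A$, $B$ and $\phi$ with stable letter $t$ is $(G,A,B,t) = \langle G, t \mid t^{-1} a t = \phi(a) \text{ for } a \in A\rangle$. Girth: for a finitely generated group $\Gamma$ and a finite generating set $S$ of $\Gamma$, $\mathrm{girth}(\Gamma, S)$ is the length of the shortest non-trivial relation of $\Gamma$ with respect to $S$, i.e. the minimal length of a non-empty freely reduced word in the alphabet $S^{\pm 1}$ which represents the identity of $\Gamma$ (and $\infty$ if there is no such word). Then $\mathrm{girth}(\Gamma) = \sup\{\mathrm{girth}(\Gamma, S) : S \subset \Gamma,\ \langle S\rangle = \Gamma,\ |S| < \infty\}$. *)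

theory Defs
  imports "HOL-Algebra.Generated_Groups" "HOL-Library.Extended_Nat"
begin

section \<open>Words and free groups\<close>

text \<open>The letter \<open>(x, True)\<close> stands for the generator \<open>x\<close> and \<open>(x, False)\<close> for its formal
  inverse.\<close>

type_synonym 'x word = "('x \<times> bool) list"

definition inv_letter :: "'x \<times> bool \<Rightarrow> 'x \<times> bool"
  where "inv_letter l = (fst l, \<not> snd l)"

definition freely_reduced :: "'x word \<Rightarrow> bool"
  where "freely_reduced w \<longleftrightarrow> successively (\<lambda>a b. b \<noteq> inv_letter a) w"

definition words_over :: "'x set \<Rightarrow> 'x word set"
  where "words_over X = {w. fst ` set w \<subseteq> X}"

fun cancel_cons :: "'x \<times> bool \<Rightarrow> 'x word \<Rightarrow> 'x word" where
  "cancel_cons l [] = [l]"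
| "cancel_cons l (m # w) = (if m = inv_letter l then w else l # m # w)"

definition free_reduction :: "'x word \<Rightarrow> 'x word"
  where "free_reduction w = foldr cancel_cons w []"

definition free_group :: "'x set \<Rightarrow> 'x word monoid"
  where "free_group X = \<lparr>carrier = {w \<in> words_over X. freely_reduced w},
                         mult = (\<lambda>u v. free_reduction (u @ v)),
                         one = []\<rparr>"

lemma inv_letter_inv_letter [simp]: "inv_letter (inv_letter l) = l"
  by (simp add: inv_letter_def)

lemma fst_inv_letter [simp]: "fst (inv_letter l) = fst l"
  by (simp add: inv_letter_def)

lemma inv_letter_neq [simp]: "inv_letter l \<noteq> l"
  by (simp add: inv_letter_def prod_eq_iff)

lemma freely_reduced_Nil [simp]: "freely_reduced []"
  by (simp add: freely_reduced_def)

lemma freely_reduced_single [simp]: "freely_reduced [l]"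
  by (simp add: freely_reduced_def)

lemma freely_reduced_Cons_Cons [simp]:
  "freely_reduced (l # m # w) \<longleftrightarrow> m \<noteq> inv_letter l \<and> freely_reduced (m # w)"
  by (simp add: freely_reduced_def)

lemma freely_reduced_ConsD: "freely_reduced (l # w) \<Longrightarrow> freely_reduced w"
  by (cases w) auto

lemma freely_reduced_cancel_cons: "freely_reduced w \<Longrightarrow> freely_reduced (cancel_cons l w)"
  by (cases w) (auto dest: freely_reduced_ConsD)

lemma freely_reduced_foldr: "freely_reduced v \<Longrightarrow> freely_reduced (foldr cancel_cons u v)"
  by (induction u) (auto intro: freely_reduced_cancel_cons)

lemma freely_reduced_free_reduction [simp]: "freely_reduced (free_reduction w)"
  by (simp add: free_reduction_def freely_reduced_foldr)

lemma free_reduction_id: "freely_reduced w \<Longrightarrow> free_reduction w = w"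
proof (induction w)
  case (Cons l w)
  then show ?case
    by (cases w) (auto simp: free_reduction_def dest: freely_reduced_ConsD)
qed (simp add: free_reduction_def)

lemma cancel_cons_inverse: "freely_reduced w \<Longrightarrow> cancel_cons l (cancel_cons (inv_letter l) w) = w"
proof (cases w)
  case (Cons m v)
  then show "freely_reduced w \<Longrightarrow> ?thesis" by (cases v) auto
qed simp

lemma foldr_cancel_cons_free_reduction:
  assumes "freely_reduced v"
  shows "foldr cancel_cons (free_reduction u) v = foldr cancel_cons u v"
proof -
  have step: "foldr cancel_cons (cancel_cons l w) v = cancel_cons l (foldr cancel_cons w v)" for l w
    using cancel_cons_inverse[OF freely_reduced_foldr[OF assms], of l]
    by (cases w) (auto simp: assms)
  show ?thesis
    by (induction u) (auto simp: free_reduction_def step)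
qed

lemma free_reduction_append_left: "free_reduction (free_reduction u @ v) = free_reduction (u @ v)"
proof -
  have "free_reduction (u' @ v) = foldr cancel_cons u' (free_reduction v)" for u'
    by (simp add: free_reduction_def)
  then show ?thesis
    by (simp add: foldr_cancel_cons_free_reduction)
qed

lemma free_reduction_append_right: "free_reduction (u @ free_reduction v) = free_reduction (u @ v)"
  using free_reduction_id[OF freely_reduced_free_reduction, of v] by (simp add: free_reduction_def)

lemma words_over_Nil [simp]: "[] \<in> words_over X"
  by (simp add: words_over_def)

lemma words_over_append [simp]: "u @ v \<in> words_over X \<longleftrightarrow> u \<in> words_over X \<and> v \<in> words_over X"
  by (auto simp: words_over_def)

lemma free_reduction_words_over: "w \<in> words_over X \<Longrightarrow> free_reduction w \<in> words_over X"
proof (induction w)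
  case (Cons l w)
  then have "free_reduction w \<in> words_over X" "fst l \<in> X"
    by (auto simp: words_over_def)
  then show ?case
    by (cases "free_reduction w") (auto simp: free_reduction_def words_over_def)
qed (simp add: free_reduction_def)

lemma free_reduction_inverse: "free_reduction (map inv_letter (rev w) @ w) = []"
proof (induction w)
  case (Cons l w)
  have "foldr cancel_cons [inv_letter l, l] (free_reduction w) = free_reduction w"
    using cancel_cons_inverse[OF freely_reduced_free_reduction, of "inv_letter l"] by simp
  then have "free_reduction (map inv_letter (rev (l # w)) @ l # w)
      = free_reduction (map inv_letter (rev w) @ w)"
    by (simp add: free_reduction_def)
  with Cons show ?case by simp
qed (simp add: free_reduction_def)

theorem group_free_group: "group (free_group X)"
proof (rule groupI)
  fix w assume "w \<in> carrier (free_group X)"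
  then have w: "w \<in> words_over X" by (simp add: free_group_def)
  let ?v = "free_reduction (map inv_letter (rev w))"
  have "map inv_letter (rev w) \<in> words_over X"
    using w by (force simp: words_over_def)
  then have "?v \<in> carrier (free_group X)"
    by (simp add: free_group_def free_reduction_words_over)
  moreover have "?v \<otimes>\<^bsub>free_group X\<^esub> w = \<one>\<^bsub>free_group X\<^esub>"
    by (simp add: free_group_def free_reduction_append_left free_reduction_inverse)
  ultimately show "\<exists>v\<in>carrier (free_group X). v \<otimes>\<^bsub>free_group X\<^esub> w = \<one>\<^bsub>free_group X\<^esub>" by blast
qed (simp_all add: free_group_def free_reduction_words_over free_reduction_append_left
      free_reduction_append_right free_reduction_id)


section \<open>Presentations\<close>

definition normal_closure :: "('a, 'b) monoid_scheme \<Rightarrow> 'a set \<Rightarrow> 'a set"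
  where "normal_closure G R =
    generate G {g \<otimes>\<^bsub>G\<^esub> r \<otimes>\<^bsub>G\<^esub> inv\<^bsub>G\<^esub> g | g r. g \<in> carrier G \<and> r \<in> R}"

definition presented_group :: "'x set \<Rightarrow> 'x word set \<Rightarrow> 'x word set monoid"
  where "presented_group X R =
    free_group X Mod normal_closure (free_group X) (free_reduction ` R)"

lemma (in group) normal_normal_closure:
  assumes R: "R \<subseteq> carrier G"
  shows "normal_closure G R \<lhd> G"
  unfolding normal_closure_def
proof (rule normal_generateI)
  fix h g assume "h \<in> {g \<otimes> r \<otimes> inv g | g r. g \<in> carrier G \<and> r \<in> R}" and g: "g \<in> carrier G"
  then obtain k r where h: "h = k \<otimes> r \<otimes> inv k" "k \<in> carrier G" "r \<in> R" by blast
  with R g have "g \<otimes> h \<otimes> inv g = (g \<otimes> k) \<otimes> r \<otimes> inv (g \<otimes> k)"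
    by (auto simp: m_assoc inv_mult_group)
  then show "g \<otimes> h \<otimes> inv g \<in> {g \<otimes> r \<otimes> inv g | g r. g \<in> carrier G \<and> r \<in> R}"
    using g h by blast
qed (use R in auto)

theorem group_presented_group:
  assumes "R \<subseteq> words_over X"
  shows "group (presented_group X R)"
proof -
  interpret F: group "free_group X" by (rule group_free_group)
  have "free_reduction ` R \<subseteq> carrier (free_group X)"
    using assms by (auto simp: free_group_def free_reduction_words_over)
  then show ?thesis
    unfolding presented_group_def by (intro normal.factorgroup_is_group F.normal_normal_closure)
qed


section \<open>HNN extensions\<close>

text \<open>The generator \<open>Some g\<close> is the group element \<open>g\<close> and \<open>None\<close> is the stable letter.  The
  first family of relators is the multiplication table of \<open>G\<close>, so that it presents \<open>G\<close>
  itself; the second one expresses \<open>t\<^sup>-\<^sup>1 a t = \<phi>(a)\<close>.\<close>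

definition hnn_relators :: "('a, 'b) monoid_scheme \<Rightarrow> 'a set \<Rightarrow> ('a \<Rightarrow> 'a) \<Rightarrow> 'a option word set"
  where "hnn_relators G A \<phi> =
    {[(Some g, True), (Some h, True), (Some (g \<otimes>\<^bsub>G\<^esub> h), False)] | g h.
        g \<in> carrier G \<and> h \<in> carrier G} \<union>
    {[(None, False), (Some a, True), (None, True), (Some (\<phi> a), False)] | a. a \<in> A}"

text \<open>The second associated subgroup \<open>B\<close> is not an argument: it is the image \<open>\<phi> ` A\<close>.\<close>

definition hnn_extension :: "('a, 'b) monoid_scheme \<Rightarrow> 'a set \<Rightarrow> ('a \<Rightarrow> 'a) \<Rightarrow> 'a option word set monoid"
  where "hnn_extension G A \<phi> =
    presented_group (insert None (Some ` carrier G)) (hnn_relators G A \<phi>)"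

lemma group_hnn_extension:
  assumes "group G" "A \<subseteq> carrier G" "\<phi> ` A \<subseteq> carrier G"
  shows "group (hnn_extension G A \<phi>)"
proof -
  interpret group G by fact
  show ?thesis
    unfolding hnn_extension_def
    by (rule group_presented_group) (use assms in \<open>auto 0 3 simp: hnn_relators_def words_over_def subset_eq\<close>)
qed


section \<open>Girth\<close>

definition letter_value :: "('a, 'b) monoid_scheme \<Rightarrow> 'a \<times> bool \<Rightarrow> 'a"
  where "letter_value G l = (if snd l then fst l else inv\<^bsub>G\<^esub> (fst l))"

definition word_value :: "('a, 'b) monoid_scheme \<Rightarrow> 'a word \<Rightarrow> 'a"
  where "word_value G w = foldr (\<lambda>l x. letter_value G l \<otimes>\<^bsub>G\<^esub> x) w \<one>\<^bsub>G\<^esub>"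

text \<open>Words are reduced formally, in the free group on \<open>S\<close>: if \<open>S\<close> contains both \<open>s\<close> and
  \<open>s\<^sup>-\<^sup>1\<close>, these are independent generators.  The infimum of the empty set of
  extended naturals is \<open>\<infinity>\<close>.\<close>

definition girth_wrt :: "('a, 'b) monoid_scheme \<Rightarrow> 'a set \<Rightarrow> enat"
  where "girth_wrt G S = Inf {enat (length w) | w.
    w \<in> words_over S \<and> freely_reduced w \<and> w \<noteq> [] \<and> word_value G w = \<one>\<^bsub>G\<^esub>}"

definition girth :: "('a, 'b) monoid_scheme \<Rightarrow> enat"
  where "girth G = Sup {girth_wrt G S | S.
    S \<subseteq> carrier G \<and> generate G S = carrier G \<and> finite S}"

end

theory Submission
  imports Defs "HOL-Library.Countable_Set" "HOL-Algebra.Elementary_Groups"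
begin

text \<open>Write \<open>F\<close> for the free group.  In each case arbitrarily long words have to be kept non-trivial
  by a suitable choice of generators.

  If \<open>A\<close> and \<open>B\<close> are proper, take \<open>a \<notin> A\<close> and \<open>b \<notin> B\<close>.  By Britton's lemma \<open>t\<close> and \<open>s = a t b\<close>
  generate a free group, and reduced words in them involve no pinch.  Replacing each \<open>x\<^sub>i\<close> by
  \<open>(t\<^sup>-\<^sup>1 s\<^sup>M)\<^sup>-\<^sup>1 x\<^sub>i (t s\<^sup>K)\<close> with very different, large exponents makes all short words Britton reduced,
  because every \<open>x\<^sub>i\<close> sits between two letters \<open>t\<close> (or two letters \<open>t\<^sup>-\<^sup>1\<close>).

  If \<open>A = F\<close> (the case \<open>B = F\<close> is the same with \<open>t\<^sup>-\<^sup>1\<close> in place of \<open>t\<close>), take the generators \<open>x\<^sub>i\<close> and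
  \<open>y\<^sub>1\<^sup>m y\<^sub>2\<^sup>m t\<close>.  Up to a power of \<open>t\<close>, conjugation by a power of \<open>t\<close> turns a word in them into a product
  in \<open>F\<close> of \<open>m\<close>-th powers of the elements \<open>\<phi>\<^sup>k(y\<^sub>i)\<close> and of fixed elements.  For \<open>y\<^sub>1\<close>, \<open>y\<^sub>2\<close> chosen outside
  finitely many commensurability classes, consecutive powers in this product have no common axis
  in the Cayley tree of \<open>F\<close>, so the product is non-trivial for large \<open>m\<close>.\<close>

section \<open>Values of words\<close>

text \<open>The two cases draw non-triviality from different sources. In the proper case the
  \<open>x_i\<close> may lie in A or B, so conjugating \<open>x_i\<close> by a word that starts with
  a stable letter would place it between opposite stable letters and might create a pinch; this is
  why the factors on its two sides are not inverse to each other. If A is all of F, every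
  \<open>t^-1 g t\<close> is a pinch, and what remains is that F embeds and that non-zero powers of
  \<open>t\<close> lie outside F; words then have to be compared inside F. A single power
  \<open>y^m t\<close> would not suffice there: if \<phi> is the identity, the consecutive powers in
  its square share an axis. Two incommensurable elements avoid this.

  Britton's lemma comes from an action of \<Gamma> on infinitely many copies of F, where the
  permutation for \<open>t\<close> can be prescribed at finitely many independent points.\<close>

definition subst_value :: "('a, 'b) monoid_scheme \<Rightarrow> ('x \<Rightarrow> 'a) \<Rightarrow> 'x word \<Rightarrow> 'a"
  where "subst_value G f w = word_value G (map (map_prod f id) w)"

lemma subst_value_Nil [simp]: "subst_value G f [] = \<one>\<^bsub>G\<^esub>"
  by (simp add: subst_value_def word_value_def)

lemma subst_value_Cons [simp]:
  "subst_value G f (l # w) =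
    (if snd l then f (fst l) else inv\<^bsub>G\<^esub> f (fst l)) \<otimes>\<^bsub>G\<^esub> subst_value G f w"
  by (cases l) (simp add: subst_value_def word_value_def letter_value_def)

lemma words_over_Cons [simp]: "l # w \<in> words_over X \<longleftrightarrow> fst l \<in> X \<and> w \<in> words_over X"
  by (auto simp: words_over_def)

lemma subst_value_map: "subst_value G f (map (map_prod g id) w) = subst_value G (\<lambda>x. f (g x)) w"
  by (simp add: subst_value_def comp_def map_prod_def case_prod_unfold)

context group
begin

lemma subst_value_closed [simp]:
  "f \<in> X \<rightarrow> carrier G \<Longrightarrow> w \<in> words_over X \<Longrightarrow> subst_value G f w \<in> carrier G"
  by (induction w) (auto simp: Pi_def)

lemma subst_value_append:
  "f \<in> X \<rightarrow> carrier G \<Longrightarrow> u \<in> words_over X \<Longrightarrow> v \<in> words_over X \<Longrightarrow>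
    subst_value G f (u @ v) = subst_value G f u \<otimes> subst_value G f v"
proof (induction u)
  case (Cons l u)
  then have "subst_value G f u \<in> carrier G" "subst_value G f v \<in> carrier G" "f (fst l) \<in> carrier G"
    by auto
  with Cons show ?case by (simp add: m_assoc)
qed simp

lemma subst_value_cancel_cons:
  assumes f: "f \<in> X \<rightarrow> carrier G" and "l # w \<in> words_over X"
  shows "subst_value G f (cancel_cons l w) = subst_value G f (l # w)"
proof (cases w)
  case (Cons m v)
  have v: "subst_value G f v \<in> carrier G" "f (fst l) \<in> carrier G"
    using assms Cons by auto
  show ?thesis
    using v by (cases l) (auto simp: Cons inv_letter_def simp flip: m_assoc)
qed simp

lemma subst_value_free_reduction:
  assumes f: "f \<in> X \<rightarrow> carrier G"
  shows "w \<in> words_over X \<Longrightarrow> subst_value G f (free_reduction w) = subst_value G f w"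
proof (induction w)
  case (Cons l w)
  then have "l # free_reduction w \<in> words_over X"
    by (simp add: free_reduction_words_over)
  with Cons show ?case
    using subst_value_cancel_cons[OF f, of l "free_reduction w"] by (simp add: free_reduction_def)
qed (simp add: free_reduction_def)

lemma subst_value_hom_free_group:
  assumes f: "f \<in> X \<rightarrow> carrier G"
  shows "subst_value G f \<in> hom (free_group X) G"
  using assms
  by (intro homI)
    (auto simp: free_group_def subst_value_append[OF f] subst_value_free_reduction[OF f])

lemma subst_value_in_generate:
  "f ` X \<subseteq> H \<Longrightarrow> w \<in> words_over X \<Longrightarrow> subst_value G f w \<in> generate G H"
proof (induction w)
  case (Cons l w)
  then show ?case
    by (auto intro!: generate.eng intro: generate.incl generate.inv)
qed (simp add: generate.one)

lemma pow_commute: "x \<in> carrier G \<Longrightarrow> x \<otimes> x [^] (k :: nat) = x [^] k \<otimes> x"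
  by (metis nat_pow_Suc nat_pow_Suc2)

lemma subst_value_powers:
  "f x \<in> carrier G \<Longrightarrow>
    subst_value G f (replicate k (x, s)) = (if s then f x else inv f x) [^] k"
proof (induction k)
  case (Suc k)
  then show ?case
    using pow_commute[of "f x" k] pow_commute[of "inv f x" k] by simp
qed simp

end

lemma hom_subst_value:
  assumes "group G" "group H" and h: "h \<in> hom G H" and f: "f \<in> X \<rightarrow> carrier G"
  shows "w \<in> words_over X \<Longrightarrow> h (subst_value G f w) = subst_value H (\<lambda>x. h (f x)) w"
proof (induction w)
  interpret group_hom G H h
    using assms by (simp add: group_hom_def group_hom_axioms_def)
  case Nil
  then show ?case by simp
next
  interpret group_hom G H h
    using assms by (simp add: group_hom_def group_hom_axioms_def)
  case (Cons l w)
  then have "subst_value G f w \<in> carrier G" "f (fst l) \<in> carrier G"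
    using f by auto
  with Cons show ?case by auto
qed

lemma girth_eq_infinityI:
  fixes G :: "('a, 'b) monoid_scheme"
  assumes "\<And>N. \<exists>(I :: 'i set) f. finite I \<and> f \<in> I \<rightarrow> carrier G \<and> generate G (f ` I) = carrier G \<and>
    (\<forall>w\<in>words_over I. freely_reduced w \<longrightarrow> w \<noteq> [] \<longrightarrow> length w \<le> N \<longrightarrow> subst_value G f w \<noteq> \<one>\<^bsub>G\<^esub>)"
  shows "girth G = \<infinity>"
proof -
  have "enat N \<le> girth G" for N
  proof -
    from assms[of N] obtain I :: "'i set" and f
      where I: "finite I" "f \<in> I \<rightarrow> carrier G" "generate G (f ` I) = carrier G"
      and rel: "\<And>w. w \<in> words_over I \<Longrightarrow> freely_reduced w \<Longrightarrow> w \<noteq> [] \<Longrightarrow> length w \<le> N \<Longrightarrow>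
        subst_value G f w \<noteq> \<one>\<^bsub>G\<^esub>" by metis
    have "enat N \<le> girth_wrt G (f ` I)"
      unfolding girth_wrt_def
    proof (rule Inf_greatest)
      fix k assume "k \<in> {enat (length w) | w. w \<in> words_over (f ` I) \<and> freely_reduced w \<and> w \<noteq> []
        \<and> word_value G w = \<one>\<^bsub>G\<^esub>}"
      then obtain w where k: "k = enat (length w)" and w: "w \<in> words_over (f ` I)"
        "freely_reduced w" "w \<noteq> []" "word_value G w = \<one>\<^bsub>G\<^esub>" by blast
      let ?g = "inv_into I f"
      let ?w = "map (map_prod ?g id) w"
      have fg: "map (map_prod f id) ?w = w"
        using w(1) by (auto simp: words_over_def comp_def map_prod_def prod.case_eq_if f_inv_into_f
            subset_eq intro!: map_idI)
      have "?w \<in> words_over I"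
        using w(1) by (auto simp: words_over_def subset_eq intro: inv_into_into)
      moreover have "freely_reduced ?w"
      proof -
        have "freely_reduced (map (map_prod f id) ?w)"
          using w(2) fg by simp
        then show ?thesis
          unfolding freely_reduced_def successively_map
          by (rule successively_mono) (auto simp: inv_letter_def)
      qed
      moreover have "subst_value G f ?w = \<one>\<^bsub>G\<^esub>"
        unfolding subst_value_def fg by (rule w)
      ultimately have "\<not> length ?w \<le> N"
        using rel w(3) by blast
      then show "enat N \<le> k" by (simp add: k)
    qed
    also have "\<dots> \<le> girth G"
      unfolding girth_def by (rule Sup_upper) (use I in auto)
    finally show ?thesis .
  qed
  then show ?thesis
    by (metis enat.exhaust not_less_eq_eq order_refl enat_ord_simps(1))
qed

section \<open>Presentations\<close>

lemma letter_in_free_group: "x \<in> X \<Longrightarrow> [(x, s)] \<in> carrier (free_group X)"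
  by (simp add: free_group_def)

lemma free_group_letter_inverse:
  assumes "x \<in> X"
  shows "[(x, False)] = inv\<^bsub>free_group X\<^esub> [(x, True)]"
proof -
  interpret group "free_group X" by (rule group_free_group)
  show ?thesis
    by (rule inv_equality[symmetric])
      (use assms in \<open>auto simp: free_group_def free_reduction_def inv_letter_def\<close>)
qed

lemma subst_value_letters:
  "w \<in> carrier (free_group X) \<Longrightarrow> subst_value (free_group X) (\<lambda>x. [(x, True)]) w = w"
proof (induction w)
  case Nil
  then show ?case by (simp add: free_group_def)
next
  case (Cons l w)
  then have w: "w \<in> carrier (free_group X)" "fst l \<in> X" "freely_reduced (l # w)"
    by (auto simp: free_group_def dest: freely_reduced_ConsD)
  have "subst_value (free_group X) (\<lambda>x. [(x, True)]) (l # w) = [l] \<otimes>\<^bsub>free_group X\<^esub> w"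
    using w Cons.IH free_group_letter_inverse[of "fst l" X] by (cases l; cases "snd l") auto
  also have "\<dots> = l # w"
    using w by (simp add: free_group_def free_reduction_id)
  finally show ?case .
qed

lemma generate_letters:
  "generate (free_group X) ((\<lambda>x. [(x, True)]) ` X) = carrier (free_group X)"
proof -
  interpret group "free_group X" by (rule group_free_group)
  have "w \<in> generate (free_group X) ((\<lambda>x. [(x, True)]) ` X)" if "w \<in> carrier (free_group X)" for w
    using subst_value_in_generate[of "\<lambda>x. [(x, True)]" X "(\<lambda>x. [(x, True)]) ` X" w] that
    by (simp add: subst_value_letters) (simp add: free_group_def)
  then show ?thesis
    by (auto dest: generate_in_carrier[rotated] simp: letter_in_free_group)
qed

lemma (in group) normal_closure_subset_kernel:
  assumes "group_hom G H h" "R \<subseteq> carrier G" "\<And>r. r \<in> R \<Longrightarrow> h r = \<one>\<^bsub>H\<^esub>"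
  shows "normal_closure G R \<subseteq> kernel G H h"
proof -
  interpret h: group_hom G H h by fact
  have "subgroup (kernel G H h) G"
    by (rule h.subgroup_kernel)
  then have "generate G {g \<otimes> r \<otimes> inv g |g r. g \<in> carrier G \<and> r \<in> R} \<subseteq> kernel G H h"
    by (rule generate_subgroup_incl[rotated]) (use h.H.is_group assms in \<open>auto simp: kernel_def\<close>)
  then show ?thesis
    by (simp add: normal_closure_def)
qed

lemma (in group) incl_normal_closure:
  assumes "R \<subseteq> carrier G"
  shows "R \<subseteq> normal_closure G R"
proof
  fix r assume r: "r \<in> R"
  then have "r = \<one> \<otimes> r \<otimes> inv \<one>" using assms by auto
  with r show "r \<in> normal_closure G R"
    unfolding normal_closure_def by (intro generate.incl) blast
qed

section \<open>Presented groups and their universal property\<close>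

locale presentation =
  fixes X :: "'x set" and R :: "'x word set"
  assumes relators: "R \<subseteq> words_over X"
begin

abbreviation "Q \<equiv> presented_group X R"

abbreviation "K \<equiv> normal_closure (free_group X) (free_reduction ` R)"

definition cls :: "'x word \<Rightarrow> 'x word set"
  where "cls w = K #>\<^bsub>free_group X\<^esub> w"

definition gen :: "'x \<Rightarrow> 'x word set"
  where "gen x = cls [(x, True)]"

sublocale Fr: group "free_group X"
  by (rule group_free_group)

lemma reduced_relators: "free_reduction ` R \<subseteq> carrier (free_group X)"
  using relators by (auto simp: free_group_def free_reduction_words_over)

sublocale K: normal K "free_group X"
  by (rule Fr.normal_normal_closure[OF reduced_relators])

sublocale P: group Q
  using relators by (rule group_presented_group)

lemma cls_hom: "cls \<in> hom (free_group X) Q"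
  unfolding cls_def[abs_def] presented_group_def by (rule K.r_coset_hom_Mod)

lemma carrier_presented: "carrier Q = cls ` carrier (free_group X)"
  by (auto simp: presented_group_def FactGroup_def RCOSETS_def cls_def)

lemma gen_closed [simp]: "x \<in> X \<Longrightarrow> gen x \<in> carrier Q"
  unfolding gen_def carrier_presented by (simp add: letter_in_free_group)

lemma subst_value_gen:
  assumes "w \<in> carrier (free_group X)"
  shows "subst_value Q gen w = cls w"
proof -
  have "w \<in> words_over X" using assms by (simp add: free_group_def)
  then have "cls (subst_value (free_group X) (\<lambda>x. [(x, True)]) w) = subst_value Q gen w"
    unfolding gen_def
    by (intro hom_subst_value[OF Fr.is_group P.is_group cls_hom]) (auto simp: letter_in_free_group)
  then show ?thesis
    using assms by (simp add: subst_value_letters)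
qed

lemma relator_value:
  assumes "r \<in> R"
  shows "subst_value Q gen r = \<one>\<^bsub>Q\<^esub>"
proof -
  have "free_reduction r \<in> K"
    using Fr.incl_normal_closure[OF reduced_relators] assms by blast
  then have "cls (free_reduction r) = K"
    unfolding cls_def by (rule Fr.coset_join2[OF _ K.is_subgroup, rotated])
      (use K.subset \<open>free_reduction r \<in> K\<close> in auto)
  moreover have "cls (free_reduction r) = subst_value Q gen (free_reduction r)"
    using assms reduced_relators by (intro subst_value_gen[symmetric]) auto
  moreover have "\<dots> = subst_value Q gen r"
    using assms relators by (intro P.subst_value_free_reduction[of _ X]) auto
  moreover have "\<one>\<^bsub>Q\<^esub> = K"
    by (simp only: presented_group_def one_FactGroup)
  ultimately show ?thesis by (simp only:)
qed

lemma generate_gen: "generate Q (gen ` X) = carrier Q"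
proof
  show "generate Q (gen ` X) \<subseteq> carrier Q"
    by (rule P.generate_incl) auto
  show "carrier Q \<subseteq> generate Q (gen ` X)"
    unfolding carrier_presented
  proof clarify
    fix w assume w: "w \<in> carrier (free_group X)"
    then have "subst_value Q gen w \<in> generate Q (gen ` X)"
      by (intro P.subst_value_in_generate[of _ X]) (auto simp: free_group_def)
    with w show "cls w \<in> generate Q (gen ` X)" by (simp add: subst_value_gen)
  qed
qed

text \<open>Von Dyck's theorem. Evaluation on the free group kills the reduced relators, since free
  reduction does not change values, so it factors through the quotient by their normal
  closure.\<close>

lemma universal:
  assumes "group H" and f: "f \<in> X \<rightarrow> carrier H"
    and rel: "\<And>r. r \<in> R \<Longrightarrow> subst_value H f r = \<one>\<^bsub>H\<^esub>"
  obtains h where "h \<in> hom Q H" "\<And>x. x \<in> X \<Longrightarrow> h (gen x) = f x"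
proof -
  interpret H: group H by fact
  let ?e = "subst_value H f"
  interpret e: group_hom "free_group X" H ?e
    using H.subst_value_hom_free_group[OF f] by unfold_locales
  have K_ker: "K \<subseteq> kernel (free_group X) H ?e"
  proof (rule Fr.normal_closure_subset_kernel[OF e.group_hom_axioms reduced_relators])
    fix r assume "r \<in> free_reduction ` R"
    then obtain r' where "r' \<in> R" "r = free_reduction r'" by blast
    then show "?e r = \<one>\<^bsub>H\<^esub>"
      using relators rel H.subst_value_free_reduction[OF f, of r'] by auto
  qed
  obtain h where "h \<in> hom (free_group X Mod K) H"
    "\<And>w. w \<in> carrier (free_group X) \<Longrightarrow> h (K #>\<^bsub>free_group X\<^esub> w) = ?e w"
    using e.FactGroup_universal_kernel[OF K.normal_axioms K_ker, of thesis] by blast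
  then have "h \<in> hom Q H" "\<And>w. w \<in> carrier (free_group X) \<Longrightarrow> h (cls w) = ?e w"
    by (simp_all add: presented_group_def cls_def)
  then show thesis
    using f by (intro that[of h]) (auto simp: gen_def letter_in_free_group Pi_def)
qed

end

section \<open>Extending equivariant partial injections\<close>

definition perm_group :: "('x \<Rightarrow> 'x) monoid"
  where "perm_group = \<lparr>carrier = {f. bij f}, mult = (\<circ>), one = id\<rparr>"

lemma perm_group_simps [simp]:
  "carrier perm_group = {f. bij f}" "f \<otimes>\<^bsub>perm_group\<^esub> g = f \<circ> g" "\<one>\<^bsub>perm_group\<^esub> = id"
  by (simp_all add: perm_group_def)

lemma group_perm_group: "group perm_group"
proof (rule groupI)
  fix f :: "'a \<Rightarrow> 'a" assume "f \<in> carrier perm_group"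
  then have "inv_into UNIV f \<in> carrier perm_group" "inv_into UNIV f \<otimes>\<^bsub>perm_group\<^esub> f = \<one>\<^bsub>perm_group\<^esub>"
    by (auto simp: bij_imp_bij_inv bij_is_inj)
  then show "\<exists>g\<in>carrier perm_group. g \<otimes>\<^bsub>perm_group\<^esub> f = \<one>\<^bsub>perm_group\<^esub>" by blast
qed (auto intro: bij_comp)

lemma perm_group_inv: "bij f \<Longrightarrow> inv\<^bsub>perm_group\<^esub> f = inv_into UNIV f"
  using group.inv_equality[OF group_perm_group, of "inv_into UNIV f" f]
  by (simp add: bij_imp_bij_inv bij_is_inj)

text \<open>Removing the finite prescribed part leaves two countably infinite sets, and their
  enumerations match them up.\<close>

lemma bij_betw_extension:
  assumes "countable P" "countable Q" "infinite P" "infinite Q" "finite J"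
    and x: "inj_on x J" "x ` J \<subseteq> P" and y: "inj_on y J" "y ` J \<subseteq> Q"
  obtains \<sigma> where "bij_betw \<sigma> P Q" "\<And>j. j \<in> J \<Longrightarrow> \<sigma> (x j) = y j"
proof -
  have "countable (P - x ` J)" "infinite (P - x ` J)" "countable (Q - y ` J)" "infinite (Q - y ` J)"
    using assms by (auto simp: Diff_infinite_finite)
  then have "bij_betw (from_nat_into (Q - y ` J) \<circ> to_nat_on (P - x ` J)) (P - x ` J) (Q - y ` J)"
    by (intro bij_betw_trans[OF to_nat_on_infinite bij_betw_from_nat_into])
  then obtain f where f: "bij_betw f (P - x ` J) (Q - y ` J)" by blast
  let ?\<sigma> = "\<lambda>p. if p \<in> x ` J then y (inv_into J x p) else f p"
  have "bij_betw (y \<circ> inv_into J x) (x ` J) (y ` J)"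
    by (rule bij_betw_trans[OF bij_betw_inv_into]) (use x y in \<open>auto simp: bij_betw_def\<close>)
  then have "bij_betw ?\<sigma> (x ` J) (y ` J)"
    by (rule bij_betw_cong[THEN iffD1, rotated]) auto
  moreover have "bij_betw ?\<sigma> (P - x ` J) (Q - y ` J)"
    using f by (rule bij_betw_cong[THEN iffD1, rotated]) auto
  ultimately have "bij_betw ?\<sigma> (x ` J \<union> (P - x ` J)) (y ` J \<union> (Q - y ` J))"
    by (rule bij_betw_combine) auto
  moreover have "x ` J \<union> (P - x ` J) = P" "y ` J \<union> (Q - y ` J) = Q"
    using x y by auto
  ultimately show thesis
    using x by (intro that[of ?\<sigma>]) auto
qed

context group
begin

text \<open>Points whose first component is outside \<open>carrier G\<close> are fixed, so that
  \<open>act g\<close> is a permutation of the whole type, as \<open>perm_group\<close>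
  demands.\<close>

definition act :: "'a \<Rightarrow> 'a \<times> nat \<Rightarrow> 'a \<times> nat"
  where "act g p = (if fst p \<in> carrier G then (g \<otimes> fst p, snd p) else p)"

text \<open>Infinitely many copies of the regular action: every subgroup has infinitely many free orbits
  on it, so a finite partial equivariant injection always extends to a permutation.\<close>

definition points :: "('a \<times> nat) set"
  where "points = carrier G \<times> UNIV"

lemma act_act: "g \<in> carrier G \<Longrightarrow> h \<in> carrier G \<Longrightarrow> act g (act h p) = act (g \<otimes> h) p"
  by (auto simp: act_def m_assoc)

lemma act_one: "act \<one> p = p"
  by (auto simp: act_def)

lemma snd_act [simp]: "snd (act g p) = snd p"
  by (simp add: act_def)

lemma act_points: "g \<in> carrier G \<Longrightarrow> p \<in> points \<Longrightarrow> act g p \<in> points"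
  by (auto simp: act_def points_def)

lemma act_inv: "g \<in> carrier G \<Longrightarrow> act (inv g) (act g p) = p" "g \<in> carrier G \<Longrightarrow> act g (act (inv g) p) = p"
  by (simp_all add: act_act act_one)

lemma bij_act: "g \<in> carrier G \<Longrightarrow> bij (act g)"
  by (rule bijI', metis act_inv(1)) (metis act_inv(2))

lemma act_hom: "act \<in> hom G perm_group"
  by (rule homI) (auto simp: bij_act act_act)

text \<open>\<open>D\<close> meets every \<open>K\<close>-orbit at most once; one chosen point from
  each orbit that misses \<open>D\<close> completes it to a transversal. Left translation is free,
  so the decomposition of a point is unique. An orbit stays on one level \<open>snd\<close>, and
  there are infinitely many levels, so the transversal is infinite.\<close>

lemma transversal_exists:
  assumes K: "subgroup K G" and D: "D \<subseteq> points"
    and indep: "\<And>x y k. x \<in> D \<Longrightarrow> y \<in> D \<Longrightarrow> k \<in> K \<Longrightarrow> y = act k x \<Longrightarrow> x = y"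
  obtains T where "D \<subseteq> T" "T \<subseteq> points" "bij_betw (\<lambda>(k, r). act k r) (K \<times> T) points" "infinite T"
proof -
  interpret K: subgroup K G by fact
  define orb where "orb x = (\<lambda>k. act k x) ` K" for x
  have self: "x \<in> orb x" for x
    unfolding orb_def using act_one[of x] K.one_closed by (metis image_eqI)
  have sym: "x \<in> orb y" if "y \<in> orb x" for x y
  proof -
    from that obtain k where k: "k \<in> K" "y = act k x" by (auto simp: orb_def)
    then have "x = act (inv k) y" by (simp add: act_inv)
    then show ?thesis using k by (auto simp: orb_def)
  qed
  have trans: "z \<in> orb x" if "y \<in> orb x" "z \<in> orb y" for x y z
  proof -
    from that obtain k l where k: "k \<in> K" "y = act k x" "l \<in> K" "z = act l y" by (auto simp: orb_def)
    then have "z = act (l \<otimes> k) x" by (simp add: act_act)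
    then show ?thesis using k by (auto simp: orb_def)
  qed
  have orb_eq: "orb y = orb x" if "y \<in> orb x" for x y
    using that sym trans by blast
  have orb_points: "y \<in> points" if "y \<in> orb x" "x \<in> points" for x y
    using that by (auto simp: orb_def intro: act_points)
  define c where "c x = (SOME y. y \<in> orb x)" for x
  have c: "c x \<in> orb x" for x
    unfolding c_def by (rule someI, rule self)
  have c_eq: "c y = c x" if "y \<in> orb x" for x y
    unfolding c_def orb_eq[OF that] ..
  define T where "T = D \<union> c ` {x \<in> points. orb x \<inter> D = {}}"
  have T: "T \<subseteq> points"
    using D orb_points[OF c] by (auto simp: T_def simp del: split_paired_All)
  have indep': "x = y" if "x \<in> D" "y \<in> D" "y \<in> orb x" for x y
    using that indep[of x y] by (auto simp: orb_def simp del: split_paired_All)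
  have not_D: "c r = r \<and> orb r \<inter> D = {}" if "r \<in> T" "r \<notin> D" for r
  proof -
    from that obtain p where p: "r = c p" "orb p \<inter> D = {}" by (auto simp: T_def)
    then have "r \<in> orb p" using c by simp
    then show ?thesis using p c_eq orb_eq by simp
  qed
  have T_indep: "x = y" if "x \<in> T" "y \<in> T" "y \<in> orb x" for x y
  proof (cases "x \<in> D")
    case True
    then have "y \<in> D" using not_D[of y] sym[of y x] that by blast
    with True that indep' show ?thesis by blast
  next
    case False
    then have "y \<notin> D" using not_D[of x] that by blast
    then show ?thesis using False not_D[of x] not_D[of y] c_eq[of y x] that by simp
  qed
  have ex: "\<exists>r\<in>T. x \<in> orb r" if "x \<in> points" for x
  proof (cases "orb x \<inter> D = {}")
    case True
    with that have "c x \<in> T" by (auto simp: T_def)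
    with c sym show ?thesis by blast
  next
    case False
    then obtain d where "d \<in> orb x" "d \<in> D" by blast
    then show ?thesis using sym[of d x] by (intro bexI[of _ d]) (simp_all add: T_def)
  qed
  have "bij_betw (\<lambda>(k, r). act k r) (K \<times> T) points"
  proof (rule bij_betwI')
    fix p q assume pq: "p \<in> K \<times> T" "q \<in> K \<times> T"
    obtain k r l s where [simp]: "p = (k, r)" "q = (l, s)" by (metis surj_pair)
    show "((case p of (k, r) \<Rightarrow> act k r) = (case q of (k, r) \<Rightarrow> act k r)) = (p = q)"
    proof
      assume "(case p of (k, r) \<Rightarrow> act k r) = (case q of (k, r) \<Rightarrow> act k r)"
      then have eq: "act k r = act l s" by simp
      have "act k r \<in> orb r" "act l s \<in> orb s"
        using pq by (auto simp: orb_def)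
      then have "s \<in> orb r" unfolding eq using sym[of _ s] trans[of _ r s] by blast
      then have "r = s" using T_indep pq by auto
      moreover have "fst r \<in> carrier G" "k \<in> carrier G" "l \<in> carrier G"
        using T pq K.mem_carrier by (auto simp: points_def)
      ultimately show "p = q" using eq by (simp add: act_def)
    qed simp
  next
    fix p assume "p \<in> K \<times> T"
    then show "(case p of (k, r) \<Rightarrow> act k r) \<in> points"
      using T by (auto intro!: act_points)
  next
    fix x assume "x \<in> points"
    from ex[OF this] show "\<exists>p\<in>K \<times> T. x = (case p of (k, r) \<Rightarrow> act k r)"
      by (auto simp: orb_def)
  qed
  moreover have "infinite T"
  proof
    assume "finite T"
    moreover have "i \<in> snd ` T" for i
    proof -
      obtain r where "r \<in> T" "(\<one>, i) \<in> orb r"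
        using ex[of "(\<one>, i)"] by (auto simp: points_def)
      then have "snd r = i" by (auto simp: orb_def dest: arg_cong[of _ _ snd])
      with \<open>r \<in> T\<close> show ?thesis by blast
    qed
    ultimately show False
      by (metis UNIV_eq_I finite_imageI infinite_UNIV_nat)
  qed
  ultimately show thesis
    using that T by (auto simp: T_def)
qed

lemma hom_image_subgroup:
  assumes "subgroup A G" "\<phi> \<in> hom (G\<lparr>carrier := A\<rparr>) G"
  shows "subgroup (\<phi> ` A) G"
proof -
  interpret h: group_hom "G\<lparr>carrier := A\<rparr>" G \<phi>
    using assms subgroup.subgroup_is_group[OF _ is_group] is_group
    by (simp add: group_hom_def group_hom_axioms_def)
  show ?thesis
    using h.img_is_subgroup by simp
qed

text \<open>\<open>points\<close> is a free \<open>A\<close>-set in two ways: with \<open>a\<close>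
  acting as \<phi> \<open>a\<close> over a transversal \<open>T\<close> of the image, and as itself
  over a transversal \<open>U\<close> of \<open>A\<close>. A bijection from \<open>T\<close> to
  \<open>U\<close> that takes \<open>x j\<close> to \<open>y j\<close> extends to an equivariant
  \<tau>. Its equation is the relation \<open>a t = t \<phi>(a)\<close>, so \<tau> can serve as the
  image of the stable letter.\<close>

lemma stable_permutation_exists:
  assumes A: "subgroup A G" and \<phi>: "\<phi> \<in> hom (G\<lparr>carrier := A\<rparr>) G" "inj_on \<phi> A"
    and "countable (carrier G)" "finite J" and inj: "inj_on x J" "inj_on y J"
    and x: "\<And>i. i \<in> J \<Longrightarrow> x i \<in> points" and y: "\<And>i. i \<in> J \<Longrightarrow> y i \<in> points"
    and indep_x: "\<And>i j k. i \<in> J \<Longrightarrow> j \<in> J \<Longrightarrow> k \<in> \<phi> ` A \<Longrightarrow> x j = act k (x i) \<Longrightarrow> i = j"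
    and indep_y: "\<And>i j k. i \<in> J \<Longrightarrow> j \<in> J \<Longrightarrow> k \<in> A \<Longrightarrow> y j = act k (y i) \<Longrightarrow> i = j"
  obtains \<tau> where "bij \<tau>" "\<And>a p. a \<in> A \<Longrightarrow> \<tau> (act (\<phi> a) p) = act a (\<tau> p)"
    "\<And>j. j \<in> J \<Longrightarrow> \<tau> (x j) = y j"
proof -
  interpret A: subgroup A G by fact
  have \<phi>_mult: "\<phi> (a \<otimes> b) = \<phi> a \<otimes> \<phi> b" and \<phi>_closed: "\<phi> a \<in> carrier G"
    if "a \<in> A" "b \<in> A" for a b
    using \<phi>(1) that by (auto simp: hom_def)
  interpret h: group_hom "G\<lparr>carrier := A\<rparr>" G \<phi>
    using \<phi>(1) A.subgroup_is_group[OF is_group] is_group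
    by (simp add: group_hom_def group_hom_axioms_def)
  have B: "subgroup (\<phi> ` A) G"
    using A \<phi>(1) by (rule hom_image_subgroup)
  obtain T where T: "x ` J \<subseteq> T" "T \<subseteq> points" "bij_betw (\<lambda>(k, r). act k r) (\<phi> ` A \<times> T) points" "infinite T"
  proof (rule transversal_exists[OF B, of "x ` J"])
    show "x ` J \<subseteq> points" using x by blast
    show "p = q" if "p \<in> x ` J" "q \<in> x ` J" "k \<in> \<phi> ` A" "q = act k p" for p q k
    proof -
      from that(1,2) obtain i j where ij: "i \<in> J" "j \<in> J" and pq: "p = x i" "q = x j" by auto
      have "i = j"
        by (rule indep_x[OF ij that(3)]) (use that(4) pq in simp)
      with pq show ?thesis by simp
    qed
  qed (rule that)
  obtain U where U: "y ` J \<subseteq> U" "U \<subseteq> points" "bij_betw (\<lambda>(k, r). act k r) (A \<times> U) points" "infinite U"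
  proof (rule transversal_exists[OF A, of "y ` J"])
    show "y ` J \<subseteq> points" using y by blast
    show "p = q" if "p \<in> y ` J" "q \<in> y ` J" "k \<in> A" "q = act k p" for p q k
    proof -
      from that(1,2) obtain i j where ij: "i \<in> J" "j \<in> J" and pq: "p = y i" "q = y j" by auto
      have "i = j"
        by (rule indep_y[OF ij that(3)]) (use that(4) pq in simp)
      with pq show ?thesis by simp
    qed
  qed (rule that)
  have "countable points"
    unfolding points_def using \<open>countable (carrier G)\<close> by simp
  then have "countable T" "countable U"
    using T U countable_subset by blast+
  then obtain \<sigma> where \<sigma>: "bij_betw \<sigma> T U" "\<And>j. j \<in> J \<Longrightarrow> \<sigma> (x j) = y j"
    using bij_betw_extension[of T U J x y] T U inj \<open>finite J\<close> by metis
  define \<beta> where "\<beta> = (\<lambda>(k, r). act k r) \<circ> map_prod \<phi> id"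
  define \<alpha> where "\<alpha> = (\<lambda>(k, r). act k r) \<circ> map_prod id \<sigma>"
  have "bij_betw \<beta> (A \<times> T) points"
    unfolding \<beta>_def using \<phi>(2)
    by (intro bij_betw_trans[OF _ T(3)] bij_betw_map_prod) (auto simp: bij_betw_def)
  then have \<beta>: "bij_betw \<beta> (A \<times> T) points" .
  have \<alpha>: "bij_betw \<alpha> (A \<times> T) points"
    unfolding \<alpha>_def
    by (intro bij_betw_trans[OF _ U(3)] bij_betw_map_prod \<sigma>) auto
  define \<tau> where "\<tau> p = (if p \<in> points then \<alpha> (inv_into (A \<times> T) \<beta> p) else p)" for p
  have \<tau>_eq: "\<tau> (act (\<phi> a) r) = act a (\<sigma> r)" if "a \<in> A" "r \<in> T" for a r
  proof -
    have "inv_into (A \<times> T) \<beta> (act (\<phi> a) r) = (a, r)"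
      using inv_into_f_f[OF bij_betw_imp_inj_on[OF \<beta>], of "(a, r)"] that by (simp add: \<beta>_def)
    moreover have "act (\<phi> a) r \<in> points"
      using that T \<phi>_closed by (auto intro!: act_points)
    ultimately show ?thesis by (simp add: \<tau>_def \<alpha>_def)
  qed
  show thesis
  proof
    have "bij_betw \<tau> (points \<union> - points) (points \<union> - points)"
    proof (rule bij_betw_combine)
      have "bij_betw (\<alpha> \<circ> inv_into (A \<times> T) \<beta>) points points"
        by (rule bij_betw_trans[OF bij_betw_inv_into[OF \<beta>] \<alpha>])
      then show "bij_betw \<tau> points points"
        by (rule bij_betw_cong[THEN iffD1, rotated]) (simp add: \<tau>_def)
      have "bij_betw id (- points) (- points)" by simp
      then show "bij_betw \<tau> (- points) (- points)"
        by (rule bij_betw_cong[THEN iffD1, rotated]) (simp add: \<tau>_def)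
    qed simp
    then show "bij \<tau>" by simp
    show "\<tau> (act (\<phi> a) p) = act a (\<tau> p)" if a: "a \<in> A" for a p
    proof (cases "p \<in> points")
      case True
      then obtain z where z: "z \<in> A \<times> T" "p = \<beta> z"
        using \<beta> unfolding bij_betw_def by blast
      obtain b r where "z = (b, r)" by (cases z)
      with z have b: "b \<in> A" "r \<in> T" "p = act (\<phi> b) r"
        by (simp_all add: \<beta>_def)
      then have "act (\<phi> a) p = act (\<phi> (a \<otimes> b)) r"
        using a \<phi>_closed \<phi>_mult by (simp add: act_act)
      then have "\<tau> (act (\<phi> a) p) = act (a \<otimes> b) (\<sigma> r)"
        using \<tau>_eq[of "a \<otimes> b" r] a b by simp
      also have "\<dots> = act a (\<tau> p)"
        using a b \<tau>_eq by (simp add: act_act)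
      finally show ?thesis .
    next
      case False
      then have "fst p \<notin> carrier G" by (cases p) (auto simp: points_def)
      with False show ?thesis by (simp add: \<tau>_def act_def)
    qed
    show "\<tau> (x j) = y j" if "j \<in> J" for j
      using \<tau>_eq[of \<one> "x j"] that \<sigma> T h.hom_one by (auto simp: act_one)
  qed
qed

end

section \<open>Britton's lemma\<close>

locale hnn = F: group F for F :: "('a, 'b) monoid_scheme" +
  fixes A :: "'a set" and \<phi> :: "'a \<Rightarrow> 'a"
  assumes A: "subgroup A F"
    and \<phi>_hom: "\<phi> \<in> hom (F\<lparr>carrier := A\<rparr>) F"
    and \<phi>_inj: "inj_on \<phi> A"
begin

lemma A_closed [simp]: "a \<in> A \<Longrightarrow> a \<in> carrier F"
  by (rule subgroup.mem_carrier[OF A])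

lemma \<phi>_closed [simp]: "a \<in> A \<Longrightarrow> \<phi> a \<in> carrier F"
  using \<phi>_hom by (auto simp: hom_def)

sublocale presentation "insert None (Some ` carrier F)" "hnn_relators F A \<phi>"
  by unfold_locales (auto simp: hnn_relators_def)

abbreviation "\<Gamma> \<equiv> hnn_extension F A \<phi>"

sublocale E: group \<Gamma>
  unfolding hnn_extension_def by (rule P.is_group)

definition \<iota> :: "'a \<Rightarrow> 'a option word set" where "\<iota> g = gen (Some g)"

definition t :: "'a option word set" where "t = gen None"

lemma \<iota>_closed [simp]: "g \<in> carrier F \<Longrightarrow> \<iota> g \<in> carrier \<Gamma>"
  unfolding hnn_extension_def \<iota>_def by (rule gen_closed) simp

lemma t_closed [simp]: "t \<in> carrier \<Gamma>"
  unfolding hnn_extension_def t_def by (rule gen_closed) simp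

lemma hnn_relator_value: "r \<in> hnn_relators F A \<phi> \<Longrightarrow> subst_value \<Gamma> gen r = \<one>\<^bsub>\<Gamma>\<^esub>"
  unfolding hnn_extension_def by (rule relator_value)

lemma \<iota>_mult:
  assumes "g \<in> carrier F" "h \<in> carrier F"
  shows "\<iota> (g \<otimes>\<^bsub>F\<^esub> h) = \<iota> g \<otimes>\<^bsub>\<Gamma>\<^esub> \<iota> h"
proof -
  have "[(Some g, True), (Some h, True), (Some (g \<otimes>\<^bsub>F\<^esub> h), False)] \<in> hnn_relators F A \<phi>"
    using assms by (auto simp: hnn_relators_def)
  from hnn_relator_value[OF this]
  have "(\<iota> g \<otimes>\<^bsub>\<Gamma>\<^esub> \<iota> h) \<otimes>\<^bsub>\<Gamma>\<^esub> inv\<^bsub>\<Gamma>\<^esub> \<iota> (g \<otimes>\<^bsub>F\<^esub> h) = \<one>\<^bsub>\<Gamma>\<^esub>"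
    using assms \<iota>_closed[of g] \<iota>_closed[of h] \<iota>_closed[of "g \<otimes>\<^bsub>F\<^esub> h"]
    unfolding \<iota>_def by (simp add: E.m_assoc)
  then show ?thesis
    using E.inv_equality[of "\<iota> g \<otimes>\<^bsub>\<Gamma>\<^esub> \<iota> h" "inv\<^bsub>\<Gamma>\<^esub> \<iota> (g \<otimes>\<^bsub>F\<^esub> h)"] assms by simp
qed

lemma \<iota>_hom: "\<iota> \<in> hom F \<Gamma>"
  by (rule homI) (simp_all add: \<iota>_mult)

sublocale \<iota>: group_hom F \<Gamma> \<iota>
  using \<iota>_hom by unfold_locales

lemma \<iota>_t:
  assumes "a \<in> A"
  shows "\<iota> a \<otimes>\<^bsub>\<Gamma>\<^esub> t = t \<otimes>\<^bsub>\<Gamma>\<^esub> \<iota> (\<phi> a)"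
proof -
  have "[(None, False), (Some a, True), (None, True), (Some (\<phi> a), False)] \<in> hnn_relators F A \<phi>"
    using assms by (auto simp: hnn_relators_def)
  from hnn_relator_value[OF this]
  have "(inv\<^bsub>\<Gamma>\<^esub> t \<otimes>\<^bsub>\<Gamma>\<^esub> (\<iota> a \<otimes>\<^bsub>\<Gamma>\<^esub> t)) \<otimes>\<^bsub>\<Gamma>\<^esub> inv\<^bsub>\<Gamma>\<^esub> \<iota> (\<phi> a) = \<one>\<^bsub>\<Gamma>\<^esub>"
    using assms \<iota>_closed[of a] \<iota>_closed[of "\<phi> a"] t_closed
    unfolding \<iota>_def t_def by (simp add: E.m_assoc)
  then have "inv\<^bsub>\<Gamma>\<^esub> t \<otimes>\<^bsub>\<Gamma>\<^esub> (\<iota> a \<otimes>\<^bsub>\<Gamma>\<^esub> t) = \<iota> (\<phi> a)"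
    using E.inv_equality[of "inv\<^bsub>\<Gamma>\<^esub> t \<otimes>\<^bsub>\<Gamma>\<^esub> (\<iota> a \<otimes>\<^bsub>\<Gamma>\<^esub> t)" "inv\<^bsub>\<Gamma>\<^esub> \<iota> (\<phi> a)"] assms by simp
  then show ?thesis
    using assms by (simp add: E.inv_solve_left')
qed

lemma generate_hnn: "generate \<Gamma> (insert t (\<iota> ` carrier F)) = carrier \<Gamma>"
proof -
  have "gen ` insert None (Some ` carrier F) = insert t (\<iota> ` carrier F)"
    by (auto simp: \<iota>_def t_def)
  with generate_gen show ?thesis
    by (simp add: hnn_extension_def)
qed

lemma hnn_universal:
  assumes H: "group H" and \<psi>: "\<psi> \<in> hom F H" and \<tau>: "\<tau> \<in> carrier H"
    and rel: "\<And>a. a \<in> A \<Longrightarrow> \<psi> a \<otimes>\<^bsub>H\<^esub> \<tau> = \<tau> \<otimes>\<^bsub>H\<^esub> \<psi> (\<phi> a)"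
  obtains h where "h \<in> hom \<Gamma> H" "\<And>g. g \<in> carrier F \<Longrightarrow> h (\<iota> g) = \<psi> g" "h t = \<tau>"
proof -
  interpret H: group H by fact
  interpret \<psi>: group_hom F H \<psi>
    using \<psi> by unfold_locales
  let ?f = "\<lambda>x. case x of None \<Rightarrow> \<tau> | Some g \<Rightarrow> \<psi> g"
  obtain h where "h \<in> hom Q H" and h: "\<And>x. x \<in> insert None (Some ` carrier F) \<Longrightarrow> h (gen x) = ?f x"
  proof (rule universal[OF H, of ?f])
    show "?f \<in> insert None (Some ` carrier F) \<rightarrow> carrier H"
      using \<tau> by auto
    fix r assume "r \<in> hnn_relators F A \<phi>"
    then consider g h where "g \<in> carrier F" "h \<in> carrier F"
        "r = [(Some g, True), (Some h, True), (Some (g \<otimes>\<^bsub>F\<^esub> h), False)]"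
      | a where "a \<in> A" "r = [(None, False), (Some a, True), (None, True), (Some (\<phi> a), False)]"
      by (auto simp: hnn_relators_def)
    then show "subst_value H ?f r = \<one>\<^bsub>H\<^esub>"
    proof cases
      case 1
      then show ?thesis by (simp flip: H.m_assoc)
    next
      case 2
      then have "inv\<^bsub>H\<^esub> \<tau> \<otimes>\<^bsub>H\<^esub> (\<psi> a \<otimes>\<^bsub>H\<^esub> \<tau> \<otimes>\<^bsub>H\<^esub> inv\<^bsub>H\<^esub> \<psi> (\<phi> a)) = \<one>\<^bsub>H\<^esub>"
        using \<tau> by (simp add: rel H.m_assoc)
      with 2 \<tau> show ?thesis by (simp add: H.m_assoc)
    qed
  qed blast
  show thesis
  proof
    show "h \<in> hom \<Gamma> H"
      using \<open>h \<in> hom Q H\<close> by (simp add: hnn_extension_def)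
    show "h (\<iota> g) = \<psi> g" if "g \<in> carrier F" for g
      using h[of "Some g"] that by (simp add: \<iota>_def)
    show "h t = \<tau>"
      using h[of None] by (simp add: t_def)
  qed
qed

definition tpow :: "bool \<Rightarrow> 'a option word set"
  where "tpow e = (if e then t else inv\<^bsub>\<Gamma>\<^esub> t)"

lemma tpow_closed [simp]: "tpow e \<in> carrier \<Gamma>"
  by (simp add: tpow_def)

fun britton_value :: "(bool \<times> 'a) list \<Rightarrow> 'a option word set" where
  "britton_value [] = \<one>\<^bsub>\<Gamma>\<^esub>"
| "britton_value ((e, g) # L) = tpow e \<otimes>\<^bsub>\<Gamma>\<^esub> (\<iota> g \<otimes>\<^bsub>\<Gamma>\<^esub> britton_value L)"

text \<open>The subword \<open>t\<^sup>d g t\<^sup>e\<close>, with \<open>True\<close> and \<open>False\<close> standing for the exponents \<open>1\<close> and \<open>- 1\<close>,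
  is not a pinch.\<close>

definition no_pinch :: "bool \<Rightarrow> 'a \<Rightarrow> bool \<Rightarrow> bool"
  where "no_pinch d g e \<longleftrightarrow> d = e \<or> d \<and> g \<notin> \<phi> ` A \<or> \<not> d \<and> g \<notin> A"

text \<open>Reading \<open>t\<close> as a permutation that moves the \<open>j\<close>-th partial product along the levels, the value of
  \<open>L\<close> sends a point of level \<open>length L\<close> to level \<open>0\<close>, which no element of \<open>F\<close> does.\<close>

lemma britton_list:
  assumes "countable (carrier F)" and L: "L \<noteq> []" "snd ` set L \<subseteq> carrier F"
    and red: "successively (\<lambda>(d, g) (e, _). no_pinch d g e) L"
  shows "britton_value L \<notin> \<iota> ` carrier F"
proof
  assume "britton_value L \<in> \<iota> ` carrier F"
  then obtain f where f: "f \<in> carrier F" "britton_value L = \<iota> f" by blast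
  let ?n = "length L"
  \<comment> \<open>The word is read from the right: the group element at position \<open>j\<close>
    moves \<open>Q (Suc j)\<close> to \<open>P j\<close>, and the stable letter at position
    \<open>j\<close> has to move \<open>P j\<close> on to \<open>Q j\<close>.\<close>
  define P where "P j = (snd (L ! j), Suc j)" for j
  define Q where "Q j = (\<one>\<^bsub>F\<^esub>, j)" for j :: nat
  \<comment> \<open>\<tau> will send \<open>z True j\<close> to \<open>z False j\<close>. For
    exponent 1 this is \<open>P j\<close> to \<open>Q j\<close>; for exponent -1 it is the reverse,
    since the inverse of \<tau> acts there.\<close>
  define z where "z b j = (if fst (L ! j) = b then P j else Q j)" for b j
  have g: "snd (L ! j) \<in> carrier F" if "j < ?n" for j
    using L(2) that by auto
  have step: "no_pinch (fst (L ! j)) (snd (L ! j)) (fst (L ! Suc j))" if "Suc j < ?n" for j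
    using red that by (auto simp: successively_conv_nth case_prod_beta)
  have B: "subgroup (\<phi> ` A) F"
    using A \<phi>_hom by (rule F.hom_image_subgroup)
  \<comment> \<open>Two prescribed points in one orbit have the same level. With equal exponents
    this gives \<open>i = j\<close>; with different ones the letters are adjacent and the group
    element between them lies in \<open>K\<close>, which is a pinch.\<close>
  have indep: "i = j"
    if K: "subgroup K F" and b: "\<And>j. Suc j < ?n \<Longrightarrow> fst (L ! j) = b \<Longrightarrow> fst (L ! Suc j) \<noteq> b \<Longrightarrow> snd (L ! j) \<notin> K"
      and ij: "i \<in> {..<?n}" "j \<in> {..<?n}" "k \<in> K" and eq: "z b j = F.act k (z b i)" for b K i j k
  proof -
    have k: "k \<in> carrier F" using subgroup.mem_carrier[OF K ij(3)] .
    have lev: "snd (z b j) = snd (z b i)" using eq by simp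
    consider "(fst (L ! i) = b) = (fst (L ! j) = b)" | "fst (L ! i) = b" "fst (L ! j) \<noteq> b"
      | "fst (L ! i) \<noteq> b" "fst (L ! j) = b" by blast
    then show ?thesis
    proof cases
      case 1
      with lev show ?thesis by (auto simp: z_def P_def Q_def split: if_splits)
    next
      case 2
      with lev have j: "j = Suc i" by (simp add: z_def P_def Q_def)
      have "k \<otimes>\<^bsub>F\<^esub> snd (L ! i) = \<one>\<^bsub>F\<^esub>"
        using eq 2 g[of i] ij by (simp add: z_def P_def Q_def F.act_def)
      then have "snd (L ! i) = inv\<^bsub>F\<^esub> k"
        using k g[of i] ij by (metis F.inv_equality F.inv_inv lessThan_iff)
      then have "snd (L ! i) \<in> K"
        using K ij subgroup.m_inv_closed by metis
      with b[of i] 2 ij j show ?thesis by simp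
    next
      case 3
      with lev have i: "i = Suc j" by (simp add: z_def P_def Q_def)
      have "snd (L ! j) = k"
        using eq 3 k by (simp add: z_def P_def Q_def F.act_def)
      with b[of j] 3 ij i show ?thesis by simp
    qed
  qed
  have indep_True: "i = j" if "i \<in> {..<?n}" "j \<in> {..<?n}" "k \<in> \<phi> ` A" "z True j = F.act k (z True i)" for i j k
    by (rule indep[OF B _ that], drule step) (auto simp: no_pinch_def)
  have indep_False: "i = j" if "i \<in> {..<?n}" "j \<in> {..<?n}" "k \<in> A" "z False j = F.act k (z False i)" for i j k
    by (rule indep[OF A _ that], drule step) (auto simp: no_pinch_def)
  have inj_True: "inj_on (z True) {..<?n}"
    by (rule inj_onI, rule indep_True[where k = "\<one>\<^bsub>F\<^esub>"])
      (use subgroup.one_closed[OF B] in \<open>auto simp: F.act_one\<close>)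
  have inj_False: "inj_on (z False) {..<?n}"
    by (rule inj_onI, rule indep_False[where k = "\<one>\<^bsub>F\<^esub>"])
      (use subgroup.one_closed[OF A] in \<open>auto simp: F.act_one\<close>)
  have points: "z b j \<in> F.points" if "j \<in> {..<?n}" for b j
    using g that by (simp add: z_def P_def Q_def F.points_def)
  obtain \<tau> where \<tau>: "bij \<tau>" "\<And>a p. a \<in> A \<Longrightarrow> \<tau> (F.act (\<phi> a) p) = F.act a (\<tau> p)"
    "\<And>j. j \<in> {..<?n} \<Longrightarrow> \<tau> (z True j) = z False j"
  proof (rule F.stable_permutation_exists[OF A \<phi>_hom \<phi>_inj \<open>countable (carrier F)\<close> finite_lessThan
        inj_True inj_False])
    show "z True i \<in> F.points" if "i \<in> {..<?n}" for i by (rule points[OF that])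
    show "z False i \<in> F.points" if "i \<in> {..<?n}" for i by (rule points[OF that])
    show "i = j" if "i \<in> {..<?n}" "j \<in> {..<?n}" "k \<in> \<phi> ` A" "z True j = F.act k (z True i)" for i j k
      by (rule indep_True[OF that])
    show "i = j" if "i \<in> {..<?n}" "j \<in> {..<?n}" "k \<in> A" "z False j = F.act k (z False i)" for i j k
      by (rule indep_False[OF that])
  qed (rule that)
  obtain \<Theta> where "\<Theta> \<in> hom \<Gamma> perm_group" and \<Theta>\<iota>: "\<And>g. g \<in> carrier F \<Longrightarrow> \<Theta> (\<iota> g) = F.act g"
    and \<Theta>t: "\<Theta> t = \<tau>"
  proof (rule hnn_universal[OF group_perm_group F.act_hom, of \<tau>])
    show "F.act a \<otimes>\<^bsub>perm_group\<^esub> \<tau> = \<tau> \<otimes>\<^bsub>perm_group\<^esub> F.act (\<phi> a)" if "a \<in> A" for a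
      using \<tau>(2)[OF that] by auto
  qed (use \<tau> in auto)
  interpret \<Theta>: group_hom \<Gamma> perm_group \<Theta>
    using \<open>\<Theta> \<in> hom \<Gamma> perm_group\<close> group_perm_group
    by (simp add: group_hom_def group_hom_axioms_def E.is_group)
  have move: "\<Theta> (tpow (fst (L ! j))) (P j) = Q j" if "j < ?n" for j
  proof (cases "fst (L ! j)")
    case True
    then show ?thesis
      using \<tau>(3)[of j] that by (simp add: z_def tpow_def \<Theta>t)
  next
    case False
    then have "\<tau> (Q j) = P j"
      using \<tau>(3)[of j] that by (simp add: z_def)
    then show ?thesis
      using False \<tau>(1) by (simp add: tpow_def \<Theta>t perm_group_inv inv_f_eq bij_is_inj)
  qed
  have closed: "britton_value M \<in> carrier \<Gamma>" if "snd ` set M \<subseteq> carrier F" for M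
    using that by (induction M rule: britton_value.induct) auto
  have path: "\<Theta> (britton_value (drop j L)) (Q ?n) = Q j" if "j \<le> ?n" for j
    using that
  proof (induction j rule: inc_induct)
    case (step j)
    have eq: "drop j L = (fst (L ! j), snd (L ! j)) # drop (Suc j) L"
      using step by (simp add: Cons_nth_drop_Suc)
    have "snd ` set (drop (Suc j) L) \<subseteq> carrier F"
      using L(2) set_drop_subset[of "Suc j" L] by blast
    then have "\<Theta> (britton_value (drop j L)) (Q ?n)
        = \<Theta> (tpow (fst (L ! j))) (F.act (snd (L ! j)) (\<Theta> (britton_value (drop (Suc j) L)) (Q ?n)))"
      unfolding eq using step(2) g[of j] closed by (simp add: \<Theta>\<iota> del: prod.collapse)
    also have "F.act (snd (L ! j)) (\<Theta> (britton_value (drop (Suc j) L)) (Q ?n)) = P j"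
      using step g[of j] by (simp add: Q_def P_def F.act_def)
    finally show ?case
      using move step by simp
  qed simp
  have "Q 0 = F.act f (Q ?n)"
    using path[of 0] f by (simp add: \<Theta>\<iota>)
  then have "0 = ?n"
    by (auto simp: Q_def dest: arg_cong[of _ _ snd])
  with L(1) show False by simp
qed

text \<open>With nothing prescribed (\<open>J\<close> empty) there is still an action of \<Gamma> in
  which \<open>\<iota> g\<close> is translation by \<open>g\<close>, and translations determine
  \<open>g\<close>.\<close>

lemma \<iota>_inj:
  assumes "countable (carrier F)"
  shows "inj_on \<iota> (carrier F)"
proof -
  obtain \<tau> where \<tau>: "bij \<tau>" "\<And>a p. a \<in> A \<Longrightarrow> \<tau> (F.act (\<phi> a) p) = F.act a (\<tau> p)"
    by (rule F.stable_permutation_exists[OF A \<phi>_hom \<phi>_inj assms, of "{}"]) auto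
  obtain \<Theta> where \<Theta>: "\<And>g. g \<in> carrier F \<Longrightarrow> \<Theta> (\<iota> g) = F.act g"
  proof (rule hnn_universal[OF group_perm_group F.act_hom, of \<tau>])
    show "F.act a \<otimes>\<^bsub>perm_group\<^esub> \<tau> = \<tau> \<otimes>\<^bsub>perm_group\<^esub> F.act (\<phi> a)" if "a \<in> A" for a
      using \<tau>(2)[OF that] by auto
  qed (use \<tau> in auto)
  show ?thesis
  proof (rule inj_onI)
    fix g h assume gh: "g \<in> carrier F" "h \<in> carrier F" "\<iota> g = \<iota> h"
    then have "F.act g (\<one>\<^bsub>F\<^esub>, 0) = F.act h (\<one>\<^bsub>F\<^esub>, 0)"
      using \<Theta> by metis
    with gh show "g = h" by (simp add: F.act_def)
  qed
qed

text \<open>A constant sign leaves no room for a pinch. This is the only consequence of Britton's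
  lemma that the ascending case takes.\<close>

lemma t_power_notin:
  assumes "countable (carrier F)" "t [^]\<^bsub>\<Gamma>\<^esub> k \<in> \<iota> ` carrier F"
  shows "k = (0 :: nat)"
proof (rule ccontr)
  assume "k \<noteq> 0"
  let ?L = "replicate k (True, \<one>\<^bsub>F\<^esub>)"
  have "britton_value ?L = t [^]\<^bsub>\<Gamma>\<^esub> k"
    by (induction k) (simp_all add: tpow_def E.pow_commute)
  moreover have "britton_value ?L \<notin> \<iota> ` carrier F"
    by (rule britton_list[OF assms(1)])
      (use \<open>k \<noteq> 0\<close> in \<open>auto simp: no_pinch_def successively_conv_nth\<close>)
  ultimately show False using assms(2) by simp
qed

text \<open>\<open>britton e e' \<gamma>\<close>: \<open>\<gamma>\<close> has a reduced expression that starts with \<open>t\<^sup>e\<close> and ends with \<open>t\<close> to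
  the power \<open>e'\<close>.\<close>

inductive britton :: "bool \<Rightarrow> bool \<Rightarrow> 'a option word set \<Rightarrow> bool" where
  base: "britton e e (tpow e)"
| step: "britton e e' \<gamma> \<Longrightarrow> g \<in> carrier F \<Longrightarrow> no_pinch d g e \<Longrightarrow>
    britton d e' (tpow d \<otimes>\<^bsub>\<Gamma>\<^esub> (\<iota> g \<otimes>\<^bsub>\<Gamma>\<^esub> \<gamma>))"

lemma britton_closed: "britton e e' \<gamma> \<Longrightarrow> \<gamma> \<in> carrier \<Gamma>"
  by (induction rule: britton.induct) auto

text \<open>Between two equal stable letters any group element is allowed, so no condition on
  \<open>g\<close> beyond membership arises. This is what makes the generators of the proper case
  work whatever the \<open>x i\<close> are.\<close>

lemma britton_join:
  "britton e d \<gamma> \<Longrightarrow> britton d e' \<delta> \<Longrightarrow> g \<in> carrier F \<Longrightarrow>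
    britton e e' (\<gamma> \<otimes>\<^bsub>\<Gamma>\<^esub> (\<iota> g \<otimes>\<^bsub>\<Gamma>\<^esub> \<delta>))"
proof (induction rule: britton.induct)
  case (base e)
  then show ?case by (intro britton.step) (auto simp: no_pinch_def)
next
  case (step e d \<gamma> h c)
  then have "britton c e' (tpow c \<otimes>\<^bsub>\<Gamma>\<^esub> (\<iota> h \<otimes>\<^bsub>\<Gamma>\<^esub> (\<gamma> \<otimes>\<^bsub>\<Gamma>\<^esub> (\<iota> g \<otimes>\<^bsub>\<Gamma>\<^esub> \<delta>))))"
    by (intro britton.step) auto
  with step britton_closed[of e d \<gamma>] britton_closed[of d e' \<delta>] show ?case
    by (simp add: E.m_assoc)
qed

lemma britton_notin:
  assumes "countable (carrier F)" "britton e e' \<gamma>"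
  shows "\<gamma> \<notin> \<iota> ` carrier F"
proof -
  from assms(2) have "\<exists>L. L \<noteq> [] \<and> fst (hd L) = e \<and> snd ` set L \<subseteq> carrier F \<and>
    successively (\<lambda>(d, g) (e, _). no_pinch d g e) L \<and> \<gamma> = britton_value L"
  proof (induction rule: britton.induct)
    case (base e)
    show ?case by (rule exI[of _ "[(e, \<one>\<^bsub>F\<^esub>)]"]) simp
  next
    case (step e e' \<gamma> g d)
    then obtain L where "L \<noteq> []" "fst (hd L) = e" "snd ` set L \<subseteq> carrier F"
      "successively (\<lambda>(d, g) (e, _). no_pinch d g e) L" "\<gamma> = britton_value L" by blast
    with step show ?case
      by (intro exI[of _ "(d, g) # L"]) (auto simp: successively_Cons case_prod_beta)
  qed
  with britton_list[OF assms(1)] show ?thesis by blast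
qed

end

section \<open>Proper associated subgroups\<close>

lemma freely_reduced_append:
  "freely_reduced (u @ v) \<longleftrightarrow> freely_reduced u \<and> freely_reduced v \<and>
    (u \<noteq> [] \<longrightarrow> v \<noteq> [] \<longrightarrow> hd v \<noteq> inv_letter (last u))"
  by (auto simp: freely_reduced_def successively_append_iff)

lemma freely_reduced_Cons:
  "freely_reduced (l # v) \<longleftrightarrow> freely_reduced v \<and> (v \<noteq> [] \<longrightarrow> hd v \<noteq> inv_letter l)"
  by (cases v) auto

lemma freely_reduced_map:
  "inj f \<Longrightarrow> freely_reduced (map (map_prod f id) w) \<longleftrightarrow> freely_reduced w"
  by (auto simp: freely_reduced_def successively_map inv_letter_def inj_eq prod_eq_iff)

text \<open>In both cases the generators are indexed by a disjoint sum, and words are read from one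
  \<open>Inr\<close> letter to the next; the cut is at the first such letter.\<close>

lemma sum_word_cases:
  fixes w :: "('x + 'y) word"
  obtains v where "w = map (map_prod Inl id) v"
  | v \<tau> w' where "w = map (map_prod Inl id) v @ map_prod Inr id \<tau> # w'"
proof -
  have "(\<exists>v. w = map (map_prod Inl id) v) \<or>
    (\<exists>v \<tau> w'. w = map (map_prod Inl id) v @ map_prod Inr id \<tau> # w')"
  proof (induction w)
    case (Cons l w)
    show ?case
    proof (cases "fst l")
      case (Inl c)
      then obtain s where l: "l = map_prod Inl id (c, s)" by (cases l) simp
      from Cons.IH show ?thesis
      proof (elim disjE exE)
        fix v assume "w = map (map_prod Inl id) v"
        with l show ?thesis by (intro disjI1 exI[of _ "(c, s) # v"]) (simp add: id_def)
      next
        fix v \<tau> w' assume "w = map (map_prod Inl id) v @ map_prod Inr id \<tau> # w'"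
        with l show ?thesis
          by (intro disjI2 exI[of _ "(c, s) # v"] exI[of _ \<tau>] exI[of _ w']) (simp add: id_def)
      qed
    next
      case (Inr c)
      then obtain s where l: "l = map_prod Inr id (c, s)" by (cases l) simp
      then show ?thesis
        by (intro disjI2 exI[of _ "[]"] exI[of _ "(c, s)"] exI[of _ w]) (simp add: id_def)
    qed
  qed simp
  with that show thesis by blast
qed

text \<open>The reduced word of the \<open>k\<close>-th power of the letter \<open>True\<close>,
  which will stand for \<open>s = a t b\<close>, while \<open>False\<close> will stand for
  \<open>t\<close>.\<close>

definition syllable :: "int \<Rightarrow> bool word"
  where "syllable k = replicate (nat \<bar>k\<bar>) (True, k > 0)"

lemma syllable_eq_Nil [simp]: "syllable k = [] \<longleftrightarrow> k = 0"
  by (auto simp: syllable_def)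

lemma freely_reduced_syllable [simp]: "freely_reduced (syllable k)"
  by (auto simp: syllable_def freely_reduced_def successively_conv_nth inv_letter_def)

lemma hd_syllable: "k \<noteq> 0 \<Longrightarrow> hd (syllable k) = (True, k > 0)"
  and last_syllable: "k \<noteq> 0 \<Longrightarrow> last (syllable k) = (True, k > 0)"
  by (auto simp: syllable_def)

lemma eq_syllable:
  "freely_reduced u \<Longrightarrow> \<forall>l\<in>set u. fst l \<Longrightarrow> \<exists>k. u = syllable k \<and> \<bar>k\<bar> = int (length u)"
proof (induction u)
  case Nil
  then show ?case by (intro exI[of _ 0]) (simp add: syllable_def)
next
  case (Cons l u)
  then obtain k where k: "u = syllable k" "\<bar>k\<bar> = int (length u)"
    by (auto dest: freely_reduced_ConsD)
  show ?case
  proof (cases "k = 0")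
    case True
    with Cons.prems k show ?thesis
      by (cases l; intro exI[of _ "if snd l then 1 else - 1"]) (auto simp: syllable_def)
  next
    case False
    then have "hd u = (True, k > 0)" "u \<noteq> []"
      using k hd_syllable[of k] by simp_all
    with Cons.prems have l: "l = (True, k > 0)"
      by (cases l) (auto simp: freely_reduced_Cons inv_letter_def)
    let ?k = "k + (if k > 0 then 1 else - 1)"
    have "nat \<bar>?k\<bar> = Suc (nat \<bar>k\<bar>)" "(?k > 0) = (k > 0)"
      using False by auto
    then have "l # u = syllable ?k"
      unfolding k(1) l by (simp add: syllable_def)
    moreover have "\<bar>?k\<bar> = int (length (l # u))"
      using k(2) False by auto
    ultimately show ?thesis by blast
  qed
qed

text \<open>The maximal initial and final powers of \<open>True\<close> are cut off. What remains
  begins and ends with the other generator, so multiplying by further powers of \<open>True\<close>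
  on either side changes only the exponents \<open>k\<close> and \<open>m\<close>.\<close>

lemma syllable_split:
  assumes v: "freely_reduced v" and "\<not> (\<forall>l\<in>set v. fst l)"
  obtains k m v' where "v = syllable k @ v' @ syllable m" "v' \<noteq> []"
    "\<not> fst (hd v')" "\<not> fst (last v')" "\<bar>k\<bar> \<le> int (length v)" "\<bar>m\<bar> \<le> int (length v)"
proof -
  define v1 where "v1 = dropWhile fst v"
  define v' where "v' = rev (dropWhile fst (rev v1))"
  have v_eq: "v = takeWhile fst v @ v1"
    by (simp add: v1_def)
  have "rev v1 = takeWhile fst (rev v1) @ rev v'"
    by (simp add: v'_def)
  then have v1_eq: "v1 = v' @ rev (takeWhile fst (rev v1))"
    by (metis rev_append rev_rev_ident)
  have v1: "v1 \<noteq> []" "\<not> fst (hd v1)"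
    using assms(2) hd_dropWhile[of fst v] by (auto simp: v1_def)
  then have nAll: "\<not> (\<forall>l\<in>set (rev v1). fst l)"
    by (metis hd_in_set set_rev)
  then have v': "v' \<noteq> []" "\<not> fst (last v')"
    using hd_dropWhile[of fst "rev v1"] by (auto simp: v'_def last_rev)
  have red: "freely_reduced (takeWhile fst v)" "freely_reduced (rev (takeWhile fst (rev v1)))"
    using v v_eq v1_eq by (metis freely_reduced_append)+
  have all: "\<forall>l\<in>set (takeWhile fst v). fst l" "\<forall>l\<in>set (rev (takeWhile fst (rev v1))). fst l"
    by (auto dest: set_takeWhileD)
  obtain k where k: "takeWhile fst v = syllable k" "\<bar>k\<bar> = int (length (takeWhile fst v))"
    using eq_syllable[OF red(1) all(1)] by (elim exE conjE)
  obtain m where m: "rev (takeWhile fst (rev v1)) = syllable m" "\<bar>m\<bar> = int (length (rev (takeWhile fst (rev v1))))"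
    using eq_syllable[OF red(2) all(2)] by (elim exE conjE)
  have "v = syllable k @ v' @ syllable m"
    using v_eq v1_eq unfolding k(1) m(1) by simp
  moreover have "hd v' = hd v1"
    using v' v1_eq by (metis hd_append2)
  moreover have "length (takeWhile fst v) \<le> length v"
    by (rule length_takeWhile_le)
  moreover have "length (rev (takeWhile fst (rev v1))) \<le> length v"
    using length_takeWhile_le[of fst "rev v1"] length_dropWhile_le[of fst v] by (simp add: v1_def)
  ultimately show thesis
    using that v' v1 k m by simp
qed

section \<open>The free subgroup on t and s = a t b, and generators without short relations\<close>

locale hnn_proper = hnn F A \<phi> for F :: "('a, 'b) monoid_scheme" and A \<phi> +
  fixes a b :: 'a and x :: "nat \<Rightarrow> 'a" and r N :: nat
  assumes a: "a \<in> carrier F" "a \<notin> A" and b: "b \<in> carrier F" "b \<notin> \<phi> ` A"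
    and x: "x \<in> {..<r} \<rightarrow> carrier F"
begin

text \<open>Every letter in \<open>t\<close> and \<open>s\<close> has the form \<open>lft\<close>,
  stable letter, \<open>rgt\<close>: \<open>s\<close> is \<open>a t b\<close>, its inverse is
  \<open>b^-1 t^-1 a^-1\<close>, and for \<open>t\<close> both factors are trivial. Defining
  \<open>rgt\<close> through the inverse letter reflects this symmetry.\<close>

definition lft :: "bool \<times> bool \<Rightarrow> 'a"
  where "lft l = (if fst l then (if snd l then a else inv\<^bsub>F\<^esub> b) else \<one>\<^bsub>F\<^esub>)"

definition rgt :: "bool \<times> bool \<Rightarrow> 'a"
  where "rgt l = inv\<^bsub>F\<^esub> lft (inv_letter l)"

definition h :: "bool \<Rightarrow> 'a option word set"
  where "h c = (if c then \<iota> a \<otimes>\<^bsub>\<Gamma>\<^esub> t \<otimes>\<^bsub>\<Gamma>\<^esub> \<iota> b else t)"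

abbreviation "hval \<equiv> subst_value \<Gamma> h"

lemma lft_closed [simp]: "lft l \<in> carrier F"
  using a b by (simp add: lft_def)

lemma rgt_closed [simp]: "rgt l \<in> carrier F"
  by (simp add: rgt_def)

lemma x_closed [simp]: "i < r \<Longrightarrow> x i \<in> carrier F"
  using x by auto

lemma h_closed [simp]: "h c \<in> carrier \<Gamma>"
  using a b by (simp add: h_def)

lemma words_over_UNIV [simp]: "w \<in> words_over UNIV"
  by (simp add: words_over_def)

lemma hval_closed [simp]: "hval v \<in> carrier \<Gamma>"
  by (rule E.subst_value_closed[of _ UNIV]) auto

lemma hval_append: "hval (u @ v) = hval u \<otimes>\<^bsub>\<Gamma>\<^esub> hval v"
  by (rule E.subst_value_append[of _ UNIV]) auto

lemma h_letter: "(if snd l then h (fst l) else inv\<^bsub>\<Gamma>\<^esub> h (fst l)) =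
    \<iota> (lft l) \<otimes>\<^bsub>\<Gamma>\<^esub> (tpow (snd l) \<otimes>\<^bsub>\<Gamma>\<^esub> \<iota> (rgt l))"
  using a b by (simp add: h_def rgt_def lft_def inv_letter_def tpow_def E.m_assoc E.inv_mult_group)

text \<open>Only a change of sign matters, and then the two letters are different generators. The
  element between them is \<open>b\<close> or its inverse in \<open>t ... t^-1\<close>, and
  \<open>a\<close> or its inverse in \<open>t^-1 ... t\<close>.\<close>

lemma no_pinch_letters:
  assumes "m \<noteq> inv_letter l"
  shows "no_pinch (snd l) (rgt l \<otimes>\<^bsub>F\<^esub> lft m) (snd m)"
proof -
  have B: "subgroup (\<phi> ` A) F"
    using A \<phi>_hom by (rule F.hom_image_subgroup)
  interpret A: subgroup A F by (rule A)
  have "inv\<^bsub>F\<^esub> a \<notin> A" "inv\<^bsub>F\<^esub> b \<notin> \<phi> ` A"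
    using a b A subgroup.m_inv_closed[OF A] subgroup.m_inv_closed[OF B] by (metis F.inv_inv)+
  with assms a b show ?thesis
    by (cases l; cases m) (auto simp: no_pinch_def rgt_def lft_def inv_letter_def)
qed

text \<open>The last letter is a power of \<open>t\<close>, whose right factor is trivial, so the
  expression ends in a stable letter as \<open>britton\<close> demands. The left factor of the first
  letter stays outside.\<close>

lemma britton_hval_aux:
  "v \<noteq> [] \<Longrightarrow> freely_reduced v \<Longrightarrow> \<not> fst (last v) \<Longrightarrow>
    \<exists>\<gamma>. britton (snd (hd v)) (snd (last v)) \<gamma> \<and> hval v = \<iota> (lft (hd v)) \<otimes>\<^bsub>\<Gamma>\<^esub> \<gamma>"
proof (induction v rule: list_nonempty_induct)
  case (single l)
  have "rgt l = \<one>\<^bsub>F\<^esub>"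
    using single by (simp add: rgt_def lft_def)
  then have "hval [l] = \<iota> (lft l) \<otimes>\<^bsub>\<Gamma>\<^esub> tpow (snd l)"
    using h_letter[of l] by simp
  then show ?case
    using britton.base[of "snd l"] by auto
next
  case (cons l v)
  then obtain \<gamma> where \<gamma>: "britton (snd (hd v)) (snd (last v)) \<gamma>" "hval v = \<iota> (lft (hd v)) \<otimes>\<^bsub>\<Gamma>\<^esub> \<gamma>"
    by (auto simp: freely_reduced_Cons)
  let ?g = "rgt l \<otimes>\<^bsub>F\<^esub> lft (hd v)"
  have "britton (snd l) (snd (last v)) (tpow (snd l) \<otimes>\<^bsub>\<Gamma>\<^esub> (\<iota> ?g \<otimes>\<^bsub>\<Gamma>\<^esub> \<gamma>))"
    using cons by (intro britton.step[OF \<gamma>(1)] no_pinch_letters) (auto simp: freely_reduced_Cons)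
  moreover have "hval (l # v) = \<iota> (lft l) \<otimes>\<^bsub>\<Gamma>\<^esub> (tpow (snd l) \<otimes>\<^bsub>\<Gamma>\<^esub> (\<iota> ?g \<otimes>\<^bsub>\<Gamma>\<^esub> \<gamma>))"
    using britton_closed[OF \<gamma>(1)] \<gamma>(2) by (simp only: subst_value_Cons h_letter) (simp add: E.m_assoc)
  ultimately show ?case using cons by auto
qed

lemma britton_hval:
  assumes "freely_reduced ((False, e) # v @ [(False, e')])"
  shows "britton e e' (tpow e \<otimes>\<^bsub>\<Gamma>\<^esub> (hval v \<otimes>\<^bsub>\<Gamma>\<^esub> tpow e'))"
proof -
  from britton_hval_aux[OF _ assms] obtain \<gamma> where
    "britton e e' \<gamma>" "hval ((False, e) # v @ [(False, e')]) = \<gamma>"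
    using britton_closed by (auto simp: lft_def simp del: subst_value_Cons)
  moreover have "hval ((False, e) # v @ [(False, e')]) = tpow e \<otimes>\<^bsub>\<Gamma>\<^esub> (hval v \<otimes>\<^bsub>\<Gamma>\<^esub> tpow e')"
    by (simp add: hval_append tpow_def h_def)
  ultimately show ?thesis by simp
qed

lemma hval_syllable: "hval (syllable k) = h True [^]\<^bsub>\<Gamma>\<^esub> k"
proof (cases "k > 0")
  case True
  then obtain n where "k = int n" by (metis pos_int_cases)
  then show ?thesis
    using True by (simp add: syllable_def E.subst_value_powers int_pow_int)
next
  case False
  then obtain n where "k = - int n" by (metis not_less nonpos_int_cases)
  then show ?thesis
    by (auto simp: syllable_def E.subst_value_powers int_pow_int E.int_pow_neg E.nat_pow_inv)
qed

text \<open>If \<open>v\<close> is a power of \<open>s\<close>, the total exponent is non-zero: for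
  \<open>M = M'\<close> because \<open>v\<close> is non-empty, otherwise because the gap exceeds the
  length of \<open>v\<close>. If not, the outer exponents of \<open>v\<close> are at most
  \<open>N\<close> in absolute value and cannot use up \<open>M\<close> or \<open>M'\<close>. Either
  way the result begins and ends with \<open>s\<close> or its inverse, so \<open>t\<close> can be
  put on both sides without cancellation.\<close>

lemma hval_syllable_absorb:
  fixes M M' :: nat
  assumes v: "freely_reduced v" "length v \<le> N" and M: "M > N" "M' > N"
    and ne: "M = M' \<Longrightarrow> v \<noteq> []" "M \<noteq> M' \<Longrightarrow> \<bar>int M - int M'\<bar> > int N"
  obtains v' where "freely_reduced v'" "v' \<noteq> []" "fst (hd v')" "fst (last v')"
    "hval v' = h True [^]\<^bsub>\<Gamma>\<^esub> M \<otimes>\<^bsub>\<Gamma>\<^esub> (hval v \<otimes>\<^bsub>\<Gamma>\<^esub> inv\<^bsub>\<Gamma>\<^esub> (h True [^]\<^bsub>\<Gamma>\<^esub> M'))"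
proof -
  have M_int: "h True [^]\<^bsub>\<Gamma>\<^esub> M = h True [^]\<^bsub>\<Gamma>\<^esub> (int M)"
    "inv\<^bsub>\<Gamma>\<^esub> (h True [^]\<^bsub>\<Gamma>\<^esub> M') = h True [^]\<^bsub>\<Gamma>\<^esub> (- int M')"
    by (simp_all add: int_pow_int E.int_pow_neg)
  show thesis
  proof (cases "\<forall>l\<in>set v. fst l")
    case True
    with eq_syllable v obtain k where k: "v = syllable k" "\<bar>k\<bar> = int (length v)" by blast
    let ?k = "int M + (k - int M')"
    have "?k \<noteq> 0" using k v ne by (cases "M = M'") auto
    moreover have "hval (syllable ?k) =
      h True [^]\<^bsub>\<Gamma>\<^esub> (int M) \<otimes>\<^bsub>\<Gamma>\<^esub> (hval v \<otimes>\<^bsub>\<Gamma>\<^esub> h True [^]\<^bsub>\<Gamma>\<^esub> (- int M'))"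
      by (simp add: hval_syllable k E.int_pow_mult diff_conv_add_uminus del: add_uminus_conv_diff)
    ultimately show thesis
      by (intro that[of "syllable ?k"]) (simp_all add: M_int hd_syllable last_syllable)
  next
    case False
    obtain k m v' where v': "v = syllable k @ v' @ syllable m" "v' \<noteq> []"
      "\<not> fst (hd v')" "\<not> fst (last v')" "\<bar>k\<bar> \<le> int (length v)" "\<bar>m\<bar> \<le> int (length v)"
      by (rule syllable_split[OF v(1) False])
    let ?k = "int M + k" and ?m = "m + - int M'"
    let ?v = "syllable ?k @ v' @ syllable ?m"
    have nz: "?k \<noteq> 0" "?m \<noteq> 0" using v' v M by auto
    have "freely_reduced v'"
      using v(1) v'(1) by (simp add: freely_reduced_append)
    then have "freely_reduced ?v"
      using v' nz hd_syllable[of ?k] hd_syllable[of ?m] last_syllable[of ?k] last_syllable[of ?m]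
      by (auto simp: freely_reduced_append inv_letter_def prod_eq_iff)
    moreover have "hval ?v = h True [^]\<^bsub>\<Gamma>\<^esub> (int M) \<otimes>\<^bsub>\<Gamma>\<^esub> (hval v \<otimes>\<^bsub>\<Gamma>\<^esub> h True [^]\<^bsub>\<Gamma>\<^esub> (- int M'))"
      unfolding v'(1)
      by (simp add: hval_append hval_syllable E.int_pow_mult E.m_assoc del: add_uminus_conv_diff)
    moreover have "fst (hd ?v)" "fst (last ?v)"
      using nz v' hd_syllable[of ?k] hd_syllable[of ?m] last_syllable[of ?k] last_syllable[of ?m] by (auto)
    ultimately show thesis
      using v'(2) by (intro that[of ?v]) (simp_all add: M_int)
  qed
qed

text \<open>A letter \<rho> is a pair of an index and a sign, and the multiplier is positive and
  injective in \<rho>. Multiples of \<open>N + 1\<close> thus exceed \<open>N\<close> and lie more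
  than \<open>N\<close> apart, too far for a word of length \<open>N\<close> to bridge.\<close>

definition M :: "nat \<times> bool \<Rightarrow> nat"
  where "M \<rho> = (2 * fst \<rho> + of_bool (snd \<rho>) + 1) * (N + 1)"

text \<open>\<open>R\<close> is what follows the element \<open>x i\<close> or its inverse in a new
  generator or its inverse, and \<open>L\<close> is what precedes it. Because \<open>L\<close> is
  obtained from \<open>R\<close> at the inverse letter, inverting \<open>L x R\<close> for one sign
  gives the same form for the other sign.\<close>

definition R :: "nat \<times> bool \<Rightarrow> 'a option word set"
  where "R \<rho> = tpow (snd \<rho>) \<otimes>\<^bsub>\<Gamma>\<^esub> h True [^]\<^bsub>\<Gamma>\<^esub> M \<rho>"

definition L :: "nat \<times> bool \<Rightarrow> 'a option word set"
  where "L \<sigma> = inv\<^bsub>\<Gamma>\<^esub> R (inv_letter \<sigma>)"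

lemma R_closed [simp]: "R \<rho> \<in> carrier \<Gamma>"
  by (simp add: R_def)

lemma L_closed [simp]: "L \<sigma> \<in> carrier \<Gamma>"
  by (simp add: L_def)

lemma L_eq: "L \<sigma> = inv\<^bsub>\<Gamma>\<^esub> (h True [^]\<^bsub>\<Gamma>\<^esub> M (inv_letter \<sigma>)) \<otimes>\<^bsub>\<Gamma>\<^esub> tpow (snd \<sigma>)"
  by (simp add: L_def R_def E.inv_mult_group inv_letter_def tpow_def)

lemma M_gap:
  assumes "\<rho> \<noteq> \<sigma>"
  shows "\<bar>int (M \<rho>) - int (M \<sigma>)\<bar> > int N"
proof -
  let ?d = "\<lambda>\<rho>::nat \<times> bool. int (2 * fst \<rho> + of_bool (snd \<rho>) + 1)"
  have "?d \<rho> \<noteq> ?d \<sigma>"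
    using assms by (cases "snd \<rho>"; cases "snd \<sigma>"; auto simp: prod_eq_iff; presburger)
  then have "1 * int (N + 1) \<le> \<bar>?d \<rho> - ?d \<sigma>\<bar> * int (N + 1)"
    by (intro mult_right_mono) auto
  also have "\<dots> = \<bar>int (M \<rho>) - int (M \<sigma>)\<bar>"
  proof -
    have "int (M \<rho>) - int (M \<sigma>) = (?d \<rho> - ?d \<sigma>) * int (N + 1)"
      unfolding M_def of_nat_mult by (rule left_diff_distrib[symmetric])
    then show ?thesis by (simp only: abs_mult abs_of_nat)
  qed
  finally show ?thesis by simp
qed

text \<open>The expression is a stable letter, then \<open>s\<close> to the power
  \<open>M \<rho>\<close>, then \<open>v\<close>, then an inverse power of \<open>s\<close>, then a
  stable letter. The two exponents agree only for mutually inverse letters, and there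
  \<open>v\<close> is non-empty.\<close>

lemma britton_short:
  assumes v: "freely_reduced v" "length v \<le> N" and ne: "v = [] \<Longrightarrow> \<sigma> \<noteq> inv_letter \<rho>"
  shows "britton (snd \<rho>) (snd \<sigma>) (R \<rho> \<otimes>\<^bsub>\<Gamma>\<^esub> (hval v \<otimes>\<^bsub>\<Gamma>\<^esub> L \<sigma>))"
proof -
  have N: "M \<rho> > N" for \<rho>
    by (simp add: M_def)
  have eq: "\<rho> = inv_letter \<sigma>" if "M \<rho> = M (inv_letter \<sigma>)"
    using M_gap[of \<rho> "inv_letter \<sigma>"] that by auto
  obtain v' where v': "freely_reduced v'" "v' \<noteq> []" "fst (hd v')" "fst (last v')"
    "hval v' = h True [^]\<^bsub>\<Gamma>\<^esub> M \<rho> \<otimes>\<^bsub>\<Gamma>\<^esub> (hval v \<otimes>\<^bsub>\<Gamma>\<^esub> inv\<^bsub>\<Gamma>\<^esub> (h True [^]\<^bsub>\<Gamma>\<^esub> M (inv_letter \<sigma>)))"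
    by (rule hval_syllable_absorb[OF v N N, of \<rho> "inv_letter \<sigma>"])
      (use ne eq M_gap[of \<rho> "inv_letter \<sigma>"] in auto)
  have "freely_reduced ((False, snd \<rho>) # v' @ [(False, snd \<sigma>)])"
    using v' by (auto simp: freely_reduced_append freely_reduced_Cons inv_letter_def prod_eq_iff)
  from britton_hval[OF this] show ?thesis
    by (simp add: v'(5) R_def L_eq E.m_assoc)
qed

text \<open>\<open>t\<close> and \<open>s\<close> stay among the generators, so that
  \<open>L\<close> and \<open>R\<close> can be undone and the \<open>x i\<close> recovered.\<close>

definition gens :: "bool + nat \<Rightarrow> 'a option word set"
  where "gens = case_sum h (\<lambda>i. L (i, True) \<otimes>\<^bsub>\<Gamma>\<^esub> (\<iota> (x i) \<otimes>\<^bsub>\<Gamma>\<^esub> R (i, True)))"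

abbreviation "I \<equiv> (UNIV :: bool set) <+> {..<r}"

lemma gens_closed: "gens \<in> I \<rightarrow> carrier \<Gamma>"
  by (auto simp: gens_def)

lemma gens_Inl: "subst_value \<Gamma> gens (map (map_prod Inl id) v) = hval v"
  by (simp add: subst_value_map gens_def)

lemma gens_Inr:
  assumes "fst \<tau> < r" "w \<in> words_over I"
  shows "subst_value \<Gamma> gens (map_prod Inr id \<tau> # w) =
    L \<tau> \<otimes>\<^bsub>\<Gamma>\<^esub> (\<iota> (if snd \<tau> then x (fst \<tau>) else inv\<^bsub>F\<^esub> x (fst \<tau>)) \<otimes>\<^bsub>\<Gamma>\<^esub> (R \<tau> \<otimes>\<^bsub>\<Gamma>\<^esub> subst_value \<Gamma> gens w))"
proof -
  have "x (fst \<tau>) \<in> carrier F" "subst_value \<Gamma> gens w \<in> carrier \<Gamma>"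
    using x assms E.subst_value_closed[OF gens_closed] by auto
  then show ?thesis
    by (cases \<tau>) (auto simp: gens_def L_def inv_letter_def E.m_assoc E.inv_mult_group)
qed

text \<open>The stretch up to the next letter \<tau> from the \<open>x i\<close> ends in a stable
  letter of sign \<open>snd \<tau>\<close>, and the rest begins with one of the same sign, so the
  two are joined across \<open>x i\<close>. The outer letters \<rho> and \<sigma> give the first and
  last stretch the same shape as the inner ones.\<close>

lemma britton_gens:
  assumes "freely_reduced (map_prod Inr id \<rho> # w @ [map_prod Inr id \<sigma>])"
    and "length w \<le> N" "w \<in> words_over I"
  shows "britton (snd \<rho>) (snd \<sigma>) (R \<rho> \<otimes>\<^bsub>\<Gamma>\<^esub> (subst_value \<Gamma> gens w \<otimes>\<^bsub>\<Gamma>\<^esub> L \<sigma>))"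
  using assms
proof (induction "length w" arbitrary: w \<rho> rule: less_induct)
  case less
  show ?case
  proof (cases w rule: sum_word_cases)
    case (1 v)
    have "freely_reduced v"
      using less.prems(1) unfolding 1 by (simp add: freely_reduced_Cons freely_reduced_append freely_reduced_map)
    moreover have "\<sigma> \<noteq> inv_letter \<rho>" if "v = []"
      using less.prems(1) that unfolding 1 by (auto simp: inv_letter_def)
    ultimately show ?thesis
      using britton_short[of v \<sigma> \<rho>] less.prems(2) by (simp add: 1 gens_Inl)
  next
    case (2 v \<tau> w')
    have red: "freely_reduced (map_prod Inr id \<rho> # map (map_prod Inl id) v @ [map_prod Inr id \<tau>])"
      "freely_reduced (map_prod Inr id \<tau> # w' @ [map_prod Inr id \<sigma>])"
      using less.prems(1) unfolding 2 by (auto simp: freely_reduced_Cons freely_reduced_append hd_append split: if_splits)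
    have len: "length v \<le> N" "length w' < length w" "length w' \<le> N"
      using less.prems(2) by (auto simp: 2)
    have w': "w' \<in> words_over I" "fst \<tau> < r"
      using less.prems(3) by (auto simp: 2)
    have "freely_reduced v"
      using red(1) by (simp add: freely_reduced_Cons freely_reduced_append freely_reduced_map)
    moreover have "\<tau> \<noteq> inv_letter \<rho>" if "v = []"
      using red(1) that by (auto simp: inv_letter_def)
    ultimately have "britton (snd \<rho>) (snd \<tau>) (R \<rho> \<otimes>\<^bsub>\<Gamma>\<^esub> (hval v \<otimes>\<^bsub>\<Gamma>\<^esub> L \<tau>))"
      using britton_short[of v \<tau> \<rho>] len by simp
    moreover have "britton (snd \<tau>) (snd \<sigma>) (R \<tau> \<otimes>\<^bsub>\<Gamma>\<^esub> (subst_value \<Gamma> gens w' \<otimes>\<^bsub>\<Gamma>\<^esub> L \<sigma>))"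
      using less.hyps len red w' by blast
    moreover have xc: "(if snd \<tau> then x (fst \<tau>) else inv\<^bsub>F\<^esub> x (fst \<tau>)) \<in> carrier F" (is "?x \<in> _")
      using x w' by auto
    ultimately have "britton (snd \<rho>) (snd \<sigma>) ((R \<rho> \<otimes>\<^bsub>\<Gamma>\<^esub> (hval v \<otimes>\<^bsub>\<Gamma>\<^esub> L \<tau>)) \<otimes>\<^bsub>\<Gamma>\<^esub>
      (\<iota> ?x \<otimes>\<^bsub>\<Gamma>\<^esub> (R \<tau> \<otimes>\<^bsub>\<Gamma>\<^esub> (subst_value \<Gamma> gens w' \<otimes>\<^bsub>\<Gamma>\<^esub> L \<sigma>))))"
      by (rule britton_join)
    moreover have "subst_value \<Gamma> gens w = hval v \<otimes>\<^bsub>\<Gamma>\<^esub> (L \<tau> \<otimes>\<^bsub>\<Gamma>\<^esub> (\<iota> ?x \<otimes>\<^bsub>\<Gamma>\<^esub> (R \<tau> \<otimes>\<^bsub>\<Gamma>\<^esub> subst_value \<Gamma> gens w')))"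
    proof -
      have "subst_value \<Gamma> gens w = subst_value \<Gamma> gens (map (map_prod Inl id) v)
          \<otimes>\<^bsub>\<Gamma>\<^esub> subst_value \<Gamma> gens (map_prod Inr id \<tau> # w')"
        unfolding 2 using less.prems(3)
        by (intro E.subst_value_append[OF gens_closed]) (simp_all add: 2)
      then show ?thesis
        by (simp only: gens_Inl gens_Inr[OF w'(2,1)])
    qed
    ultimately show ?thesis
      using xc E.subst_value_closed[OF gens_closed w'(1)] by (simp add: E.m_assoc)
  qed
qed

lemma gens_no_short_relation:
  assumes "countable (carrier F)" and w: "w \<in> words_over I" "freely_reduced w" "w \<noteq> []" "length w \<le> N"
  shows "subst_value \<Gamma> gens w \<noteq> \<one>\<^bsub>\<Gamma>\<^esub>"
proof
  assume eq: "subst_value \<Gamma> gens w = \<one>\<^bsub>\<Gamma>\<^esub>"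
  let ?f = "map_prod Inr id :: nat \<times> bool \<Rightarrow> (bool + nat) \<times> bool"
  \<comment> \<open>A letter for conjugating \<open>w\<close> without cancellation. Infinitely many
    are available, because only \<open>w\<close> has to be a word over \<open>I\<close>. Conjugating
    the trivial value gives \<open>R \<rho>\<close> times its inverse, yet the result would be
    Britton reduced.\<close>
  have "\<exists>\<rho>. ?f \<rho> \<noteq> inv_letter (hd w) \<and> ?f \<rho> \<noteq> last w"
  proof (rule ccontr)
    assume "\<not> ?thesis"
    then have "?f \<rho> \<in> {inv_letter (hd w), last w}" for \<rho> by blast
    then have "range ?f \<subseteq> {inv_letter (hd w), last w}" by (rule image_subsetI)
    then have "finite (range ?f)" by (rule finite_subset) simp
    then have "finite (UNIV :: (nat \<times> bool) set)"
      by (rule finite_imageD) (auto intro: prod.inj_map)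
    then show False by (simp add: finite_prod)
  qed
  then obtain \<rho> where \<rho>: "?f \<rho> \<noteq> inv_letter (hd w)" "?f \<rho> \<noteq> last w" by blast
  have f_inv: "?f (inv_letter \<rho>) = inv_letter (?f \<rho>)"
    by (simp add: inv_letter_def prod_eq_iff)
  have "freely_reduced (?f \<rho> # w @ [?f (inv_letter \<rho>)])"
    using w \<rho> unfolding f_inv
    by (auto simp: freely_reduced_Cons freely_reduced_append inv_letter_def prod_eq_iff)
  from britton_gens[OF this w(4,1)]
  have "britton (snd \<rho>) (snd (inv_letter \<rho>)) (\<iota> \<one>\<^bsub>F\<^esub>)"
    by (simp add: eq L_def)
  from britton_notin[OF assms(1) this] show False by blast
qed

lemma generate_gens:
  assumes "generate F (x ` {..<r}) = carrier F"
  shows "generate \<Gamma> (gens ` I) = carrier \<Gamma>"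
proof
  let ?H = "generate \<Gamma> (gens ` I)"
  show "?H \<subseteq> carrier \<Gamma>"
    by (rule E.generate_incl) (use gens_closed in blast)
  have H: "subgroup ?H \<Gamma>"
    by (rule E.generate_is_subgroup) (use gens_closed in blast)
  interpret H: subgroup ?H \<Gamma> by (rule H)
  have hH: "h c \<in> ?H" for c
    by (rule generate.incl) (force simp: gens_def)
  have tH: "t \<in> ?H"
    using hH[of False] by (simp add: h_def)
  have powH: "h True [^]\<^bsub>\<Gamma>\<^esub> k \<in> ?H" for k :: nat
    by (induction k) (auto simp: hH)
  have RH: "R \<rho> \<in> ?H" for \<rho>
    using tH powH by (auto simp: R_def tpow_def)
  have "\<iota> (x i) \<in> ?H" if i: "i < r" for i
  proof -
    have "gens (Inr i) \<in> ?H"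
      using i by (intro generate.incl imageI) auto
    then have "R (inv_letter (i, True)) \<otimes>\<^bsub>\<Gamma>\<^esub> gens (Inr i) \<otimes>\<^bsub>\<Gamma>\<^esub> inv\<^bsub>\<Gamma>\<^esub> R (i, True) \<in> ?H"
      using RH by simp
    moreover have "x i \<in> carrier F" using x i by auto
    ultimately show ?thesis
      by (simp add: gens_def L_def E.m_assoc flip: E.m_assoc[of "R _" "inv\<^bsub>\<Gamma>\<^esub> R _"])
  qed
  then have "\<iota> ` x ` {..<r} \<subseteq> ?H" by auto
  then have "generate \<Gamma> (\<iota> ` x ` {..<r}) \<subseteq> ?H"
    by (rule E.generate_subgroup_incl[OF _ H])
  moreover have "generate \<Gamma> (\<iota> ` x ` {..<r}) = \<iota> ` carrier F"
    using \<iota>.generate_img[of "x ` {..<r}"] x assms by (auto simp: image_subset_iff)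
  ultimately have "insert t (\<iota> ` carrier F) \<subseteq> ?H"
    using tH by simp
  then show "carrier \<Gamma> \<subseteq> ?H"
    unfolding generate_hnn[symmetric] by (rule E.generate_subgroup_incl[OF _ H])
qed

end

theorem (in hnn) girth_infinite_of_proper:
  assumes "countable (carrier F)" and proper: "A \<noteq> carrier F" "\<phi> ` A \<noteq> carrier F"
    and gen_x: "x \<in> {..<r} \<rightarrow> carrier F" "generate F (x ` {..<r::nat}) = carrier F"
  shows "girth \<Gamma> = \<infinity>"
proof (rule girth_eq_infinityI)
  fix N
  have "A \<subseteq> carrier F" "\<phi> ` A \<subseteq> carrier F" by auto
  with proper obtain a b where "a \<in> carrier F" "a \<notin> A" "b \<in> carrier F" "b \<notin> \<phi> ` A"
    by (meson set_eq_subset subsetI)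
  then interpret hnn_proper F A \<phi> a b x r N
    using gen_x(1) by unfold_locales
  show "\<exists>(I :: (bool + nat) set) f. finite I \<and> f \<in> I \<rightarrow> carrier \<Gamma> \<and> generate \<Gamma> (f ` I) = carrier \<Gamma> \<and>
    (\<forall>w\<in>words_over I. freely_reduced w \<longrightarrow> w \<noteq> [] \<longrightarrow> length w \<le> N \<longrightarrow> subst_value \<Gamma> f w \<noteq> \<one>\<^bsub>\<Gamma>\<^esub>)"
    using gens_closed generate_gens[OF gen_x(2)] gens_no_short_relation[OF assms(1)]
    by (intro exI[of _ I] exI[of _ gens]) auto
qed

section \<open>Groups with a tree-like length function\<close>

text \<open>The expression in \<open>hyperbolic\<close> is twice the Gromov product: the assumption says that the group
  is \<open>0\<close>-hyperbolic, as for the action of a free group on its Cayley tree.\<close>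

locale length_group = group G for G :: "('a, 'b) monoid_scheme" (structure) +
  fixes len :: "'a \<Rightarrow> nat"
  assumes len_one [simp]: "len \<one> = 0"
    and len_inv [simp]: "x \<in> carrier G \<Longrightarrow> len (inv x) = len x"
    and hyperbolic: "x \<in> carrier G \<Longrightarrow> y \<in> carrier G \<Longrightarrow> z \<in> carrier G \<Longrightarrow>
      min (int (len x) + int (len y) - int (len (inv x \<otimes> y)))
          (int (len y) + int (len z) - int (len (inv y \<otimes> z)))
        \<le> int (len x) + int (len z) - int (len (inv x \<otimes> z))"
    and len_square: "x \<in> carrier G \<Longrightarrow> x \<noteq> \<one> \<Longrightarrow> len x < len (x \<otimes> x)"
    and finite_ball: "finite {x \<in> carrier G. len x \<le> k}"
begin

section \<open>Gromov products and lengths of powers\<close>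

definition gp :: "'a \<Rightarrow> 'a \<Rightarrow> int"
  where "gp x y = int (len x) + int (len y) - int (len (inv x \<otimes> y))"

lemma gp_ultrametric:
  "x \<in> carrier G \<Longrightarrow> y \<in> carrier G \<Longrightarrow> z \<in> carrier G \<Longrightarrow> min (gp x y) (gp y z) \<le> gp x z"
  unfolding gp_def by (rule hyperbolic)

lemma gp_commute: "x \<in> carrier G \<Longrightarrow> y \<in> carrier G \<Longrightarrow> gp x y = gp y x"
  using len_inv[of "inv x \<otimes> y"] by (simp add: gp_def inv_mult_group del: len_inv)

lemma gp_nonneg: "x \<in> carrier G \<Longrightarrow> y \<in> carrier G \<Longrightarrow> 0 \<le> gp x y"
  using gp_ultrametric[of x \<one> y] by (simp add: gp_def)

lemma len_mult_le: "x \<in> carrier G \<Longrightarrow> y \<in> carrier G \<Longrightarrow> len (x \<otimes> y) \<le> len x + len y"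
  using gp_nonneg[of "inv x" y] by (simp add: gp_def)

lemma len_mult_ge:
  assumes "x \<in> carrier G" "y \<in> carrier G"
  shows "len x \<le> len (x \<otimes> y) + len y" "len y \<le> len (x \<otimes> y) + len x"
proof -
  show "len x \<le> len (x \<otimes> y) + len y"
    using len_mult_le[of "x \<otimes> y" "inv y"] assms by (simp add: m_assoc)
  show "len y \<le> len (x \<otimes> y) + len x"
    using len_mult_le[of "inv x" "x \<otimes> y"] assms by (simp flip: m_assoc)
qed

lemma gp_le: "x \<in> carrier G \<Longrightarrow> y \<in> carrier G \<Longrightarrow> gp x y \<le> 2 * int (len x)"
  using len_mult_ge(2)[of "inv x" y] by (simp add: gp_def)

lemma gp_mult_le:
  assumes "x \<in> carrier G" "y \<in> carrier G" "c \<in> carrier G"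
  shows "gp (x \<otimes> c) y \<le> gp x y + 2 * int (len c)"
proof -
  have "len (x \<otimes> c) \<le> len x + len c"
    using assms by (intro len_mult_le)
  moreover have "len (inv x \<otimes> y) \<le> len (inv (x \<otimes> c) \<otimes> y) + len c"
    using len_mult_ge(2)[of "inv c" "inv x \<otimes> y"] assms by (simp add: inv_mult_group m_assoc)
  ultimately show ?thesis by (simp add: gp_def)
qed

lemma power_split: "x \<in> carrier G \<Longrightarrow> i \<le> (m :: nat) \<Longrightarrow> inv (x [^] i) \<otimes> x [^] m = x [^] (m - i)"
  by (metis inv_solve_left le_add_diff_inverse nat_pow_closed nat_pow_mult)

text \<open>\<open>len y < len (y \<otimes> y)\<close> makes \<open>y\<close> act like a hyperbolic tree automorphism: the cancellation
  \<open>gp (inv y) (y [^] m)\<close> does not depend on \<open>m \<ge> 1\<close>.\<close>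

lemma len_power:
  assumes y: "y \<in> carrier G" "y \<noteq> \<one>"
  obtains c q where "q \<ge> 1" "\<And>m. m \<ge> 1 \<Longrightarrow> len (y [^] (m :: nat)) = c + m * q"
proof -
  define q where "q = len (y \<otimes> y) - len y"
  have q: "len (y \<otimes> y) = len y + q" "q \<ge> 1"
    using len_square[OF y] by (auto simp: q_def)
  have qy: "q \<le> len y"
    using q len_mult_le[of y y] y by simp
  have gp_inv: "gp (inv y) y = int (len y) - int q"
    using y q by (simp add: gp_def)
  have grow: "len (y [^] Suc m) = len (y [^] m) + q" if "m \<ge> 1" for m :: nat
    using that
  proof (induction m rule: dec_induct)
    case base
    then show ?case using q y by simp
  next
    case (step m)
    have "inv y \<otimes> y [^] Suc m = y [^] m"
      using power_split[of y 1 "Suc m"] y by simp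
    then have "gp y (y [^] Suc m) = int (len y) + int q"
      using step by (simp add: gp_def)
    \<comment> \<open>In an ultrametric triangle the smallest value occurs twice. Since
      \<open>y [^] Suc m\<close> follows \<open>y\<close> further than \<open>inv y\<close> does,
      \<open>inv y\<close> has the same product with \<open>y [^] Suc m\<close> as with
      \<open>y\<close>.\<close>
    moreover have "min (gp (inv y) (y [^] Suc m)) (gp (y [^] Suc m) y) \<le> gp (inv y) y"
      by (rule gp_ultrametric) (use y in auto)
    moreover have "min (gp (inv y) y) (gp y (y [^] Suc m)) \<le> gp (inv y) (y [^] Suc m)"
      by (rule gp_ultrametric) (use y in auto)
    ultimately have "gp (inv y) (y [^] Suc m) = int (len y) - int q"
      using gp_inv q(2) gp_commute[of "y [^] Suc m" y] y by auto
    moreover have "y \<otimes> y [^] Suc m = y [^] Suc (Suc m)"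
      using y by (metis nat_pow_Suc2)
    ultimately show ?case
      using y by (simp add: gp_def del: nat_pow_Suc)
  qed
  have "len (y [^] m) = (len y - q) + m * q" if "m \<ge> 1" for m :: nat
    using that
  proof (induction m rule: dec_induct)
    case base
    then show ?case using y qy by simp
  next
    case (step m)
    then show ?case using grow[of m] by simp
  qed
  with q(2) show thesis by (rule that)
qed

lemma nat_power_ne_one:
  assumes "y \<in> carrier G" "y \<noteq> \<one>" "m \<ge> 1"
  shows "y [^] (m :: nat) \<noteq> \<one>"
proof -
  obtain c q where "q \<ge> 1" "\<And>m. m \<ge> 1 \<Longrightarrow> len (y [^] (m :: nat)) = c + m * q"
    by (rule len_power[OF assms(1,2)], rule that)
  with assms(3) have "len (y [^] m) \<noteq> 0" by simp
  then show ?thesis using len_one by metis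
qed

lemma int_power_cases:
  obtains "0 \<le> k" "x [^] (k :: int) = x [^] nat \<bar>k\<bar>" | "k < 0" "x [^] k = inv (x [^] nat \<bar>k\<bar>)"
proof (cases "k < 0")
  case True
  with that(2) show thesis by (metis abs_of_neg int_pow_def2)
next
  case False
  with that(1) show thesis by (metis abs_of_nonneg int_pow_def2 not_less)
qed

lemma len_int_power: "y \<in> carrier G \<Longrightarrow> len (y [^] (k :: int)) = len (y [^] nat \<bar>k\<bar>)"
  by (rule int_power_cases[of k y]) (metis len_inv nat_pow_closed)+

lemma int_power_ne_one:
  assumes "y \<in> carrier G" "y \<noteq> \<one>" "k \<noteq> 0"
  shows "y [^] (k :: int) \<noteq> \<one>"
proof -
  have "y [^] nat \<bar>k\<bar> \<noteq> \<one>"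
    by (rule nat_power_ne_one) (use assms in auto)
  then show ?thesis
    using assms(1) by (rule_tac int_power_cases[of k y]) (metis inv_eq_1_iff nat_pow_closed)+
qed

section \<open>Commensurability and divergence of powers\<close>

definition commensurable :: "'a \<Rightarrow> 'a \<Rightarrow> bool"
  where "commensurable x y \<longleftrightarrow> (\<exists>(i :: int) (j :: int). i \<noteq> 0 \<and> j \<noteq> 0 \<and> x [^] i = y [^] j)"

lemma commensurable_sym: "commensurable x y \<Longrightarrow> commensurable y x"
  unfolding commensurable_def by metis

lemma commensurable_trans:
  assumes "commensurable x y" "commensurable y z" "x \<in> carrier G" "y \<in> carrier G" "z \<in> carrier G"
  shows "commensurable x z"
proof -
  from assms(1,2) obtain i j k l :: int where *: "i \<noteq> 0" "j \<noteq> 0" "x [^] i = y [^] j"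
    "k \<noteq> 0" "l \<noteq> 0" "y [^] k = z [^] l"
    unfolding commensurable_def by blast
  have "x [^] (i * k) = (y [^] j) [^] k"
    using assms * by (simp add: int_pow_pow[symmetric])
  also have "\<dots> = (y [^] k) [^] j"
    using assms by (simp add: int_pow_pow mult.commute)
  also have "\<dots> = z [^] (l * j)"
    using assms * by (simp add: int_pow_pow)
  finally show ?thesis
    using * unfolding commensurable_def by (metis mult_eq_0_iff)
qed

lemma commensurable_inv_left:
  "x \<in> carrier G \<Longrightarrow> commensurable (inv x) y \<longleftrightarrow> commensurable x y"
proof -
  have "commensurable (inv x) y" if "commensurable x y" "x \<in> carrier G" for x
  proof -
    from that obtain i j :: int where "i \<noteq> 0" "j \<noteq> 0" "x [^] i = y [^] j"
      unfolding commensurable_def by blast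
    moreover have "inv x [^] (- i) = x [^] i"
      using that by (simp add: int_pow_inv int_pow_neg)
    ultimately show ?thesis
      unfolding commensurable_def by (metis neg_equal_0_iff_equal)
  qed
  from this[of x] this[of "inv x"] show "x \<in> carrier G \<Longrightarrow> ?thesis" by auto
qed

lemma commensurable_inv_right:
  "y \<in> carrier G \<Longrightarrow> commensurable x (inv y) \<longleftrightarrow> commensurable x y"
  using commensurable_inv_left commensurable_sym by blast

text \<open>If \<open>y\<^sup>m\<close> and \<open>z\<^sup>m\<close> run together for long, then the elements \<open>y\<^sup>-\<^sup>j\<^sup>k z\<^sup>j\<^sup>q\<close>, where \<open>q\<close> and \<open>k\<close> are
  the translation lengths of \<open>y\<close> and \<open>z\<close>, stay in a fixed ball, so two of them coincide.\<close>

lemma gp_powers_bounded: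
  assumes y: "y \<in> carrier G" "y \<noteq> \<one>" and z: "z \<in> carrier G" "z \<noteq> \<one>"
    and non: "\<not> commensurable y z"
  obtains C where "\<And>m. m \<ge> 1 \<Longrightarrow> gp (y [^] (m :: nat)) (z [^] m) \<le> C"
proof -
  obtain c q where q: "q \<ge> 1" and len_y: "\<And>m. m \<ge> 1 \<Longrightarrow> len (y [^] (m :: nat)) = c + m * q"
    by (rule len_power[OF y], rule that)
  obtain d k where k: "k \<ge> 1" and len_z: "\<And>m. m \<ge> 1 \<Longrightarrow> len (z [^] (m :: nat)) = d + m * k"
    by (rule len_power[OF z], rule that)
  define W where "W = {x \<in> carrier G. len x \<le> c + d}"
  \<comment> \<open>One more than the ball \<open>W\<close> can hold; \<open>J\<close> distinct
    elements \<open>f j\<close> in \<open>W\<close> will be the contradiction.\<close>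
  define J where "J = Suc (card W)"
  define f where "f j = inv (y [^] (j * k)) \<otimes> z [^] (j * q)" for j :: nat
  have gp_pow: "gp (x [^] i) (x [^] m) \<ge> 2 * int (i * p)"
    if x: "x \<in> carrier G" "\<And>m. m \<ge> 1 \<Longrightarrow> len (x [^] (m :: nat)) = e + m * p"
      and i: "1 \<le> i" "i < m" for x i m e p
  proof -
    have "gp (x [^] i) (x [^] m) = int (e + i * p) + int (e + m * p) - int (e + (m - i) * p)"
      using i x(2)[of i] x(2)[of m] x(2)[of "m - i"] power_split[of x i m] x(1) by (simp add: gp_def)
    moreover have "int ((m - i) * p + i * p) = int (m * p)"
      using i by (simp flip: add_mult_distrib)
    ultimately show ?thesis by simp
  qed
  have inj: "inj_on f {1..J}"
  proof (rule inj_onI)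
    fix i j assume ij: "f i = f j"
    have eq: "y [^] (int j * int k) \<otimes> y [^] (- (int i * int k)) = z [^] (int j * int q) \<otimes> z [^] (- (int i * int q))"
    proof -
      have "y [^] (j * k) \<otimes> (inv (y [^] (i * k)) \<otimes> z [^] (i * q)) = z [^] (j * q)"
        using ij y z unfolding f_def by (simp flip: m_assoc)
      then have "y [^] (j * k) \<otimes> inv (y [^] (i * k)) = z [^] (j * q) \<otimes> inv (z [^] (i * q))"
        using y z by (simp add: inv_solve_right m_assoc)
      then show ?thesis
        using y z by (simp add: int_pow_neg int_pow_int flip: of_nat_mult)
    qed
    have "y [^] ((int j - int i) * int k) = z [^] ((int j - int i) * int q)"
      using eq y z by (simp add: int_pow_mult[symmetric] left_diff_distrib)
    with non q k show "i = j"
      unfolding commensurable_def by (metis eq_iff_diff_eq_0 mult_eq_0_iff not_one_le_zero of_nat_eq_0_iff of_nat_eq_iff)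
  qed
  \<comment> \<open>The bound on \<open>m\<close> puts \<open>j k\<close> and \<open>j q\<close>
    below \<open>m\<close>. If the product of \<open>y^m\<close> and \<open>z^m\<close> were larger,
    then \<open>y^(jk)\<close> and \<open>z^(jq)\<close>, both translating by \<open>j k q\<close>,
    would agree up to that distance, leaving only the constants \<open>c\<close> and
    \<open>d\<close> for the length of \<open>f j\<close>.\<close>
  have large: "gp (y [^] m) (z [^] m) \<le> 2 * int (J * q * k)" if m: "m > J * (k + q)" for m :: nat
  proof (rule ccontr)
    assume "\<not> ?thesis"
    then have big: "gp (y [^] m) (z [^] m) > 2 * int (J * q * k)" by simp
    have "f j \<in> W" if j: "j \<in> {1..J}" for j
    proof -
      have jm: "j * k < m" "j * q < m"
        using m j mult_le_mono1[of j J "k + q"] by (auto simp: algebra_simps)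
      have j1: "1 \<le> j * k" "1 \<le> j * q"
        using j q k by auto
      have "gp (y [^] (j * k)) (y [^] m) \<ge> 2 * int (j * q * k)"
        using gp_pow[of y c q "j * k" m] y len_y j1 jm by (simp add: mult_ac)
      moreover have "gp (z [^] m) (z [^] (j * q)) \<ge> 2 * int (j * q * k)"
        using gp_pow[of z d k "j * q" m] gp_commute[of "z [^] m" "z [^] (j * q)"] z len_z j1 jm by (simp add: mult_ac)
      moreover have "int (j * q * k) \<le> int (J * q * k)"
        using j by (intro of_nat_mono mult_le_mono1) simp
      moreover have "min (gp (y [^] (j * k)) (y [^] m)) (gp (y [^] m) (z [^] m)) \<le> gp (y [^] (j * k)) (z [^] m)"
        using y z by (intro gp_ultrametric) auto
      moreover have "min (gp (y [^] (j * k)) (z [^] m)) (gp (z [^] m) (z [^] (j * q))) \<le> gp (y [^] (j * k)) (z [^] (j * q))"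
        using y z by (intro gp_ultrametric) auto
      ultimately have "gp (y [^] (j * k)) (z [^] (j * q)) \<ge> 2 * int (j * q * k)"
        using big by linarith
      then have "len (f j) \<le> c + d"
        using len_y[of "j * k"] len_z[of "j * q"] j1 by (simp add: gp_def f_def mult_ac)
      then show ?thesis
        using y z by (simp add: W_def f_def)
    qed
    then have "card {1..J} \<le> card W"
      using inj finite_ball by (intro card_inj_on_le[of f]) (auto simp: W_def)
    then show False by (simp add: J_def)
  qed
  \<comment> \<open>\<open>2 * D\<close> is the bound for large \<open>m\<close>; for the finitely
    many others twice the length of \<open>y^m\<close> is at most \<open>2 * E\<close>.\<close>
  define D E where "D = int (J * q * k)" and "E = int (c + J * (k + q) * q)"
  have DE: "D \<ge> 0" "E \<ge> 0"
    unfolding D_def E_def by (rule of_nat_0_le_iff)+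
  have "gp (y [^] m) (z [^] m) \<le> 2 * D + 2 * E" if "m \<ge> 1" for m :: nat
  proof (cases "m > J * (k + q)")
    case True
    then show ?thesis using large[of m] DE unfolding D_def[symmetric] by linarith
  next
    case False
    then have "m * q \<le> J * (k + q) * q" by (intro mult_le_mono1) simp
    then have "len (y [^] m) \<le> c + J * (k + q) * q"
      by (simp only: len_y[OF that] add_le_cancel_left)
    then have "int (len (y [^] m)) \<le> E" unfolding E_def by (rule of_nat_mono)
    moreover have "gp (y [^] m) (z [^] m) \<le> 2 * int (len (y [^] m))"
      using y z by (intro gp_le) auto
    ultimately show ?thesis using DE by linarith
  qed
  then show thesis by (rule that)
qed

text \<open>A local-to-global principle, by induction from the right: the product of the remaining
  factors follows its first factor beyond \<open>C\<close>, so by the ultrametric inequality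
  \<open>a\<close> cancels against the whole rest no more than against the next factor. The product
  therefore retains most of its first factor.\<close>

lemma long_product:
  assumes "as \<noteq> []" "C \<ge> 0" "set as \<subseteq> carrier G" "\<And>a. a \<in> set as \<Longrightarrow> int (len a) > C"
    and "successively (\<lambda>a b. gp (inv a) b \<le> C) as"
  shows "gp (foldr (\<otimes>) as \<one>) (hd as) \<ge> 2 * int (len (hd as)) - C \<and> foldr (\<otimes>) as \<one> \<in> carrier G"
  using assms
proof (induction as rule: list_nonempty_induct)
  case (single a)
  then show ?case by (auto simp: gp_def)
next
  case (cons a as)
  let ?g = "foldr (\<otimes>) as \<one>"
  have IH: "gp ?g (hd as) \<ge> 2 * int (len (hd as)) - C" and g: "?g \<in> carrier G"
    using cons by (auto simp: successively_Cons)
  have a: "a \<in> carrier G" and hd: "hd as \<in> carrier G" "int (len (hd as)) > C"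
    using cons by auto
  have "gp (inv a) (hd as) \<le> C"
    using cons by (simp add: successively_Cons)
  moreover have "min (gp (inv a) ?g) (gp ?g (hd as)) \<le> gp (inv a) (hd as)"
    using a g hd by (intro gp_ultrametric) auto
  ultimately have "gp (inv a) ?g \<le> C"
    using IH hd by linarith
  moreover have "inv (a \<otimes> ?g) \<otimes> a = inv ?g"
    using a g by (simp add: inv_mult_group m_assoc)
  ultimately show ?case
    using a g by (simp add: gp_def)
qed

text \<open>The exponent is kept outside the list, so that one list describes the product for every
  \<open>m\<close>.\<close>

definition power_product :: "('a \<times> 'a) list \<Rightarrow> nat \<Rightarrow> 'a"
  where "power_product L m = foldr (\<otimes>) (map (\<lambda>(Y, c). Y [^] m \<otimes> c) L) \<one>"

lemma power_product_Nil [simp]: "power_product [] m = \<one>"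
  by (simp add: power_product_def)

lemma power_product_Cons [simp]: "power_product ((Y, c) # L) m = Y [^] m \<otimes> c \<otimes> power_product L m"
  by (simp add: power_product_def)

lemma conj_nat_pow:
  assumes "y \<in> carrier G" "f \<in> carrier G"
  shows "(f \<otimes> y \<otimes> inv f) [^] (m :: nat) = f \<otimes> y [^] m \<otimes> inv f"
proof (induction m)
  case (Suc m)
  then show ?case using assms by (simp add: m_assoc) (simp flip: m_assoc)
qed (use assms in simp)

text \<open>The inverse of \<open>Y^m c\<close> is an \<open>m\<close>-th power of the inverse of
  \<open>c^-1 Y c\<close>, times \<open>c^-1\<close>. Up to the fixed factors \<open>c^-1\<close>
  and \<open>d\<close>, each costing at most twice its length, two powers of incommensurable
  elements are compared.\<close>

lemma junction_bounded:
  assumes Y: "Y \<in> carrier G" "Y \<noteq> \<one>" and Z: "Z \<in> carrier G" "Z \<noteq> \<one>"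
    and c: "c \<in> carrier G" and d: "d \<in> carrier G"
    and non: "\<not> commensurable (inv c \<otimes> Y \<otimes> c) Z"
  obtains C where "\<And>m. m \<ge> 1 \<Longrightarrow> gp (inv (Y [^] (m :: nat) \<otimes> c)) (Z [^] m \<otimes> d) \<le> C"
proof -
  let ?y = "inv (inv c \<otimes> Y \<otimes> c)"
  have y: "?y \<in> carrier G" using Y c by simp
  have "?y \<noteq> \<one>"
  proof
    assume "?y = \<one>"
    then have "inv c \<otimes> Y \<otimes> c = \<one>" using Y c by (simp add: inv_eq_1_iff)
    then have "c \<otimes> (inv c \<otimes> Y \<otimes> c) \<otimes> inv c = \<one>" using c by simp
    with Y c show False by (simp add: m_assoc) (simp flip: m_assoc)
  qed
  moreover have "\<not> commensurable ?y Z"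
    using non Y c by (simp add: commensurable_inv_left)
  ultimately obtain C where C: "\<And>m. m \<ge> 1 \<Longrightarrow> gp (?y [^] (m :: nat)) (Z [^] m) \<le> C"
    using gp_powers_bounded[OF y _ Z] by blast
  have "gp (inv (Y [^] m \<otimes> c)) (Z [^] m \<otimes> d) \<le> C + 2 * int (len c) + 2 * int (len d)" if "m \<ge> 1" for m :: nat
  proof -
    have "?y [^] m = inv c \<otimes> inv (Y [^] m) \<otimes> c"
      using conj_nat_pow[of "inv Y" "inv c" m] Y c by (simp add: nat_pow_inv inv_mult_group m_assoc)
    then have "inv (Y [^] m \<otimes> c) = ?y [^] m \<otimes> inv c"
      using Y c by (simp add: inv_mult_group m_assoc)
    then have "gp (inv (Y [^] m \<otimes> c)) (Z [^] m \<otimes> d) \<le> gp (?y [^] m) (Z [^] m \<otimes> d) + 2 * int (len c)"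
      using gp_mult_le[of "?y [^] m" "Z [^] m \<otimes> d" "inv c"] y c d Z by simp
    also have "gp (?y [^] m) (Z [^] m \<otimes> d) \<le> gp (?y [^] m) (Z [^] m) + 2 * int (len d)"
      using gp_mult_le[of "Z [^] m" "?y [^] m" d] gp_commute[of "?y [^] m"] y d Z by simp
    finally show ?thesis using C[OF that] by linarith
  qed
  then show thesis by (rule that)
qed

text \<open>The finitely many junctions have a common bound \<open>C\<close>, whereas the lengths of
  the factors grow linearly in \<open>m\<close>. Once every factor is longer than
  \<open>D + \<bar>C\<bar>\<close>, the part of the first factor that survives is already longer
  than \<open>D\<close>.\<close>

lemma big_powers:
  assumes "L \<noteq> []" and L: "\<And>Y c. (Y, c) \<in> set L \<Longrightarrow> Y \<in> carrier G \<and> Y \<noteq> \<one> \<and> c \<in> carrier G"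
    and "successively (\<lambda>(Y, c) (Z, _). \<not> commensurable (inv c \<otimes> Y \<otimes> c) Z) L"
  obtains M where "\<And>m. m \<ge> M \<Longrightarrow> len (power_product L m) > D"
proof -
  let ?as = "\<lambda>m. map (\<lambda>(Y, c). Y [^] (m :: nat) \<otimes> c) L"
  have "\<exists>C. \<forall>m\<ge>1. successively (\<lambda>a b. gp (inv a) b \<le> C) (?as m)"
    using L assms(3)
  proof (induction L rule: induct_list012)
    case (3 p p' L)
    obtain Y c Z d where p: "p = (Y, c)" "p' = (Z, d)" by (metis surj_pair)
    from 3 obtain C where C: "\<And>m. m \<ge> 1 \<Longrightarrow> successively (\<lambda>a b. gp (inv a) b \<le> C)
        (map (\<lambda>(Y, c). Y [^] (m :: nat) \<otimes> c) (p' # L))" by auto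
    obtain C' where C': "\<And>m. m \<ge> 1 \<Longrightarrow> gp (inv (Y [^] (m :: nat) \<otimes> c)) (Z [^] m \<otimes> d) \<le> C'"
      by (rule junction_bounded[of Y Z c d]) (use 3(3)[of Y c] 3(3)[of Z d] 3(4) p in auto)
    have "successively (\<lambda>a b. gp (inv a) b \<le> max C C') (map (\<lambda>(Y, c). Y [^] m \<otimes> c) (p # p' # L))"
      if "m \<ge> 1" for m :: nat
      using C'[OF that] successively_mono[OF C[OF that], of "\<lambda>a b. gp (inv a) b \<le> max C C'"]
      by (auto simp: p)
    then show ?case by blast
  qed auto
  then obtain C where C: "\<And>m. m \<ge> 1 \<Longrightarrow> successively (\<lambda>a b. gp (inv a) b \<le> C) (?as m)" by blast
  have long: "\<exists>M. \<forall>m\<ge>M. \<forall>a\<in>set (?as m). int (len a) > K" for K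
    using L
  proof (induction L)
    case (Cons p L)
    obtain Y c where p: "p = (Y, c)" by (metis surj_pair)
    from Cons obtain M where M: "\<And>m a. m \<ge> M \<Longrightarrow> a \<in> set (map (\<lambda>(Y, c). Y [^] (m :: nat) \<otimes> c) L) \<Longrightarrow> int (len a) > K"
      by (metis list.set_intros(2))
    have Y: "Y \<in> carrier G" "Y \<noteq> \<one>" "c \<in> carrier G"
      using Cons.prems[of Y c] by (auto simp: p)
    obtain e q where q: "q \<ge> 1" "\<And>m. m \<ge> 1 \<Longrightarrow> len (Y [^] (m :: nat)) = e + m * q"
      by (rule len_power[OF Y(1,2)], rule that)
    have "int (len (Y [^] m \<otimes> c)) > K" if "m \<ge> nat K + len c + 1" for m :: nat
    proof -
      have "m \<le> e + m * q" using q by (simp add: trans_le_add2)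
      then have "m \<le> len (Y [^] m)"
        using that q(2)[of m] by simp
      moreover have "len (Y [^] m) \<le> len (Y [^] m \<otimes> c) + len c"
        using Y by (intro len_mult_ge) auto
      ultimately show ?thesis
        using that by linarith
    qed
    with M show ?case
      by (intro exI[of _ "max M (nat K + len c + 1)"]) (auto simp: p)
  qed auto
  obtain M where M: "\<And>m a. m \<ge> M \<Longrightarrow> a \<in> set (?as m) \<Longrightarrow> int (len a) > int D + \<bar>C\<bar>"
    using long by blast
  have "len (power_product L m) > D" if m: "m \<ge> max 1 M" for m
  proof -
    have cl: "set (?as m) \<subseteq> carrier G"
      using L by fastforce
    have hd: "hd (?as m) \<in> set (?as m)"
      using assms(1) by (intro hd_in_set) simp
    have "gp (power_product L m) (hd (?as m)) \<ge> 2 * int (len (hd (?as m))) - \<bar>C\<bar> \<and> power_product L m \<in> carrier G"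
      unfolding power_product_def
    proof (rule long_product)
      show "int (len a) > \<bar>C\<bar>" if "a \<in> set (?as m)" for a
        using M[of m a] that m by simp
      show "successively (\<lambda>a b. gp (inv a) b \<le> \<bar>C\<bar>) (?as m)"
        by (rule successively_mono[OF C[of m]]) (use m in auto)
    qed (use assms(1) cl in auto)
    moreover have "int (len (hd (?as m))) > int D + \<bar>C\<bar>"
      by (rule M[OF _ hd]) (use m in simp)
    ultimately show ?thesis
      using gp_le[of "power_product L m" "hd (?as m)"] cl hd by auto
  qed
  then show thesis by (rule that)
qed

text \<open>Otherwise \<open>big_powers\<close> applies to the commutator of high powers of
  \<open>x\<close> and \<open>y\<close>, which is trivial.\<close>

lemma commute_imp_commensurable:
  assumes x: "x \<in> carrier G" "x \<noteq> \<one>" and y: "y \<in> carrier G" "y \<noteq> \<one>" and "x \<otimes> y = y \<otimes> x"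
  shows "commensurable x y"
proof (rule ccontr)
  assume non: "\<not> commensurable x y"
  let ?L = "[(x, \<one>), (y, \<one>), (inv x, \<one>), (inv y, \<one>)]"
  have "\<not> commensurable y x" using non commensurable_sym by blast
  obtain M where M: "\<And>m. m \<ge> M \<Longrightarrow> len (power_product ?L m) > 0"
  proof (rule big_powers[of ?L 0])
    show "Y \<in> carrier G \<and> Y \<noteq> \<one> \<and> c \<in> carrier G" if "(Y, c) \<in> set ?L" for Y c
      using that x y by auto
    show "successively (\<lambda>(Y, c) (Z, _). \<not> commensurable (inv c \<otimes> Y \<otimes> c) Z) ?L"
      using non \<open>\<not> commensurable y x\<close> x y
      by (simp add: commensurable_inv_left commensurable_inv_right)
  qed (simp, rule that)
  have "x [^] M \<otimes> y [^] M = y [^] M \<otimes> x [^] M"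
    using assms group_commutes_pow[of x y M] group_commutes_pow[of y "x [^] M" M] by simp
  then have "power_product ?L M = \<one>"
    using x y by (simp add: nat_pow_inv m_assoc) (simp flip: m_assoc add: inv_solve_right')
  with M[of M] show False by simp
qed

lemma conj_int_pow:
  assumes "y \<in> carrier G" "f \<in> carrier G"
  shows "(f \<otimes> y \<otimes> inv f) [^] (k :: int) = f \<otimes> y [^] k \<otimes> inv f"
proof (cases k rule: int_cases2)
  case (nonneg n)
  then show ?thesis using assms by (simp add: int_pow_int conj_nat_pow)
next
  case (nonpos n)
  then show ?thesis
    using assms by (simp add: int_pow_neg_int conj_nat_pow inv_mult_group) (simp add: m_assoc)
qed

text \<open>Conjugation preserves translation length. Raising the equation to the
  \<open>m\<close>-th power makes the lengths differ by at least \<open>m * q\<close>, while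
  conjugation changes them by at most \<open>2 * len f\<close>; this dictates the value of
  \<open>m\<close>.\<close>

lemma conj_power_exponents:
  assumes y: "y \<in> carrier G" "y \<noteq> \<one>" and f: "f \<in> carrier G"
    and eq: "y [^] i = f \<otimes> y [^] j \<otimes> inv f"
  shows "\<bar>i\<bar> \<le> \<bar>j :: int\<bar>"
proof (rule ccontr)
  assume "\<not> ?thesis"
  then have lt: "\<bar>j\<bar> < \<bar>i\<bar>" by simp
  obtain c q where q: "q \<ge> 1" and len_y: "\<And>m. m \<ge> 1 \<Longrightarrow> len (y [^] (m :: nat)) = c + m * q"
    by (rule len_power[OF y], rule that)
  define m where "m = Suc (2 * len f)"
  have "y [^] (i * int m) = f \<otimes> y [^] (j * int m) \<otimes> inv f"
    using y f eq conj_int_pow[of "y [^] j" f "int m"] by (simp add: int_pow_pow[symmetric])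
  then have "len (y [^] (i * int m)) \<le> len f + len (y [^] (j * int m)) + len f"
    using len_mult_le[of "f \<otimes> y [^] (j * int m)" "inv f"] len_mult_le[of f "y [^] (j * int m)"] y f by simp
  moreover have nat_eq: "nat \<bar>k * int m\<bar> = nat \<bar>k\<bar> * m" for k
    by (simp add: abs_mult nat_mult_distrib)
  have "m \<ge> 1" by (simp add: m_def)
  have "1 \<le> nat \<bar>i\<bar> * m"
    using lt \<open>m \<ge> 1\<close> by simp
  then have "len (y [^] (i * int m)) = c + nat \<bar>i\<bar> * m * q"
    using y len_y by (simp only: len_int_power nat_eq)
  moreover have "len (y [^] (j * int m)) \<le> c + nat \<bar>j\<bar> * m * q"
  proof (cases "j = 0")
    case False
    then have "1 \<le> nat \<bar>j\<bar> * m"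
      using \<open>m \<ge> 1\<close> by simp
    then show ?thesis
      using y len_y by (simp only: len_int_power nat_eq)
  qed simp
  ultimately have "nat \<bar>i\<bar> * m * q \<le> 2 * len f + nat \<bar>j\<bar> * m * q" by linarith
  moreover have "(nat \<bar>j\<bar> + 1) * (m * q) \<le> nat \<bar>i\<bar> * (m * q)"
    using lt by (intro mult_le_mono1) linarith
  moreover have "m * 1 \<le> m * q"
    using q by (intro mult_le_mono2)
  ultimately show False by (simp add: m_def algebra_simps)
qed

text \<open>The exponents in a common power of \<open>y\<close> and its conjugate agree up to sign, hence \<open>f \<otimes> f\<close> commutes
  with a power of \<open>y\<close>.\<close>

lemma commensurable_conj:
  assumes y: "y \<in> carrier G" "y \<noteq> \<one>" and f: "f \<in> carrier G" "f \<noteq> \<one>"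
    and com: "commensurable y (f \<otimes> y \<otimes> inv f)"
  shows "commensurable y f"
proof -
  from com obtain i j :: int where ij: "i \<noteq> 0" "j \<noteq> 0" and eq: "y [^] i = f \<otimes> y [^] j \<otimes> inv f"
    unfolding commensurable_def using conj_int_pow y f by metis
  have "y [^] j = inv f \<otimes> y [^] i \<otimes> inv (inv f)"
    using y f by (simp add: eq m_assoc) (simp flip: m_assoc)
  then have "\<bar>j\<bar> \<le> \<bar>i\<bar>"
    using y f by (intro conj_power_exponents[of y "inv f"]) auto
  moreover have "\<bar>i\<bar> \<le> \<bar>j\<bar>"
    using y f eq by (intro conj_power_exponents[of y f]) auto
  ultimately have "j = i \<or> j = - i" by linarith
  then have f2: "f \<otimes> (f \<otimes> y [^] i \<otimes> inv f) \<otimes> inv f = y [^] i"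
  proof
    assume "j = i" with eq show ?thesis by simp
  next
    assume "j = - i"
    then have "inv (y [^] i) = inv (f \<otimes> inv (y [^] i) \<otimes> inv f)"
      using eq y by (simp add: int_pow_neg)
    then have "inv (y [^] i) = f \<otimes> y [^] i \<otimes> inv f"
      using y f by (simp add: inv_mult_group m_assoc)
    moreover have "y [^] i = f \<otimes> inv (y [^] i) \<otimes> inv f"
      using eq y \<open>j = - i\<close> by (simp add: int_pow_neg)
    ultimately show ?thesis by simp
  qed
  have "(f \<otimes> f) \<otimes> y [^] i = f \<otimes> (f \<otimes> y [^] i \<otimes> inv f) \<otimes> inv f \<otimes> (f \<otimes> f)"
    using y f by (simp add: m_assoc) (simp flip: m_assoc)
  also have "\<dots> = y [^] i \<otimes> (f \<otimes> f)"
    by (simp only: f2)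
  finally have "(f \<otimes> f) \<otimes> y [^] i = y [^] i \<otimes> (f \<otimes> f)" .
  moreover have "f \<otimes> f \<noteq> \<one>"
    using len_square[OF f] by auto
  ultimately have "commensurable (f \<otimes> f) (y [^] i)"
    using y f ij int_power_ne_one[OF y] by (intro commute_imp_commensurable) auto
  then obtain k l :: int where kl: "k \<noteq> 0" "l \<noteq> 0" "(f \<otimes> f) [^] k = (y [^] i) [^] l"
    unfolding commensurable_def by blast
  have "f \<otimes> f = f [^] (2 :: int)"
    using f by (simp add: int_pow_def2 numeral_2_eq_2)
  then have "y [^] (i * l) = f [^] (2 * k)"
    using kl y f by (simp add: int_pow_pow)
  with kl ij show ?thesis
    unfolding commensurable_def by (metis mult_eq_0_iff zero_neq_numeral)
qed

end

section \<open>Ascending HNN extensions\<close>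

context length_group
begin

lemma commensurable_conj_shift:
  assumes "x \<in> carrier G" "y \<in> carrier G" "f \<in> carrier G" "commensurable (inv f \<otimes> x \<otimes> f) y"
  shows "commensurable x (f \<otimes> y \<otimes> inv f)"
proof -
  from assms(4) obtain i j :: int where ij: "i \<noteq> 0" "j \<noteq> 0" "(inv f \<otimes> x \<otimes> f) [^] i = y [^] j"
    unfolding commensurable_def by blast
  then have "inv f \<otimes> x [^] i \<otimes> f = y [^] j"
    using conj_int_pow[of x "inv f" i] assms by simp
  then have "(f \<otimes> y \<otimes> inv f) [^] j = f \<otimes> (inv f \<otimes> x [^] i \<otimes> f) \<otimes> inv f"
    using assms by (simp add: conj_int_pow)
  also have "\<dots> = x [^] i"
    using assms by (simp add: m_assoc) (simp flip: m_assoc)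
  finally show ?thesis
    using ij unfolding commensurable_def by metis
qed

lemma commensurable_hom:
  assumes h: "h \<in> hom G G" "inj_on h (carrier G)" and "x \<in> carrier G" "y \<in> carrier G"
    and "commensurable (h x) (h y)"
  shows "commensurable x y"
proof -
  interpret h: group_hom G G h
    using h by unfold_locales
  from assms(5) obtain i j :: int where ij: "i \<noteq> 0" "j \<noteq> 0" "h x [^] i = h y [^] j"
    unfolding commensurable_def by blast
  then have "h (x [^] i) = h (y [^] j)"
    using assms by (simp add: h.hom_int_pow)
  then have "x [^] i = y [^] j"
    using assms by (auto dest: inj_onD)
  with ij show ?thesis unfolding commensurable_def by blast
qed

end

text \<open>Each of the finitely many obstructions excludes at most one candidate. This is how
  \<open>y1\<close> and \<open>y2\<close> are chosen.\<close>

lemma infinite_avoids_finite: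
  assumes "infinite Y" "finite E"
    and "\<And>e y y'. e \<in> E \<Longrightarrow> y \<in> Y \<Longrightarrow> y' \<in> Y \<Longrightarrow> P e y \<Longrightarrow> P e y' \<Longrightarrow> y = y'"
  obtains y where "y \<in> Y" "\<And>e. e \<in> E \<Longrightarrow> \<not> P e y"
proof -
  have "finite {y \<in> Y. P e y}" if "e \<in> E" for e
  proof (cases "\<exists>y\<in>Y. P e y")
    case True
    then obtain y where "y \<in> Y" "P e y" by blast
    then have "{y \<in> Y. P e y} \<subseteq> {y}" using assms(3)[OF that] by blast
    then show ?thesis by (rule finite_subset) simp
  next
    case False
    then have eq: "{y \<in> Y. P e y} = {}" by blast
    show ?thesis unfolding eq by simp
  qed
  then have "finite (\<Union>e\<in>E. {y \<in> Y. P e y})"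
    using assms(2) by blast
  then have "\<not> Y \<subseteq> (\<Union>e\<in>E. {y \<in> Y. P e y})"
    using assms(1) finite_subset by blast
  then show thesis using that by blast
qed

lemma words_over_map: "map (map_prod f id) w \<in> words_over X \<longleftrightarrow> (\<forall>l\<in>set w. f (fst l) \<in> X)"
  by (force simp: words_over_def)

lemma finite_short_words: "finite I \<Longrightarrow> finite {w \<in> words_over I. length w \<le> N}"
proof -
  assume "finite I"
  then have "finite {w. set w \<subseteq> I \<times> (UNIV :: bool set) \<and> length w \<le> N}"
    by (intro finite_lists_length_le) auto
  then show ?thesis
    by (rule rev_finite_subset) (auto simp: words_over_def)
qed

text \<open>The extension enters only through \<open>E\<close>, \<iota> and \<open>t\<close>,
  because two instances occur: \<phi> with \<open>t\<close>, and the inverse of \<phi> with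
  \<open>t^-1\<close>. \<open>Y\<close> is a reservoir of pairwise incommensurable candidates for
  \<open>y1\<close> and \<open>y2\<close>.\<close>

locale ascending_hnn = F: length_group F len + E: group E
  for F :: "('a, 'b) monoid_scheme" and len and E :: "('c, 'd) monoid_scheme" +
  fixes \<phi> :: "'a \<Rightarrow> 'a" and \<iota> :: "'a \<Rightarrow> 'c" and t :: 'c and x :: "nat \<Rightarrow> 'a" and r :: nat and Y :: "'a set"
  assumes \<phi>_hom: "\<phi> \<in> hom F F" and \<phi>_inj: "inj_on \<phi> (carrier F)"
    and \<iota>_hom: "\<iota> \<in> hom F E" and \<iota>_inj: "inj_on \<iota> (carrier F)"
    and t_closed [simp]: "t \<in> carrier E"
    and \<iota>_t: "f \<in> carrier F \<Longrightarrow> \<iota> f \<otimes>\<^bsub>E\<^esub> t = t \<otimes>\<^bsub>E\<^esub> \<iota> (\<phi> f)"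
    and t_power: "t [^]\<^bsub>E\<^esub> (k :: nat) \<in> \<iota> ` carrier F \<Longrightarrow> k = 0"
    and generate_E: "generate E (insert t (\<iota> ` carrier F)) = carrier E"
    and x: "x \<in> {..<r} \<rightarrow> carrier F" and generate_F: "generate F (x ` {..<r}) = carrier F"
    and free: "w \<in> words_over {..<r} \<Longrightarrow> freely_reduced w \<Longrightarrow> w \<noteq> [] \<Longrightarrow> subst_value F x w \<noteq> \<one>\<^bsub>F\<^esub>"
    and Y: "infinite Y" "Y \<subseteq> carrier F - {\<one>\<^bsub>F\<^esub>}"
    and Y_indep: "y \<in> Y \<Longrightarrow> y' \<in> Y \<Longrightarrow> F.commensurable y y' \<Longrightarrow> y = y'"
begin

sublocale \<iota>: group_hom F E \<iota>
  using \<iota>_hom by unfold_locales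

sublocale \<phi>: group_hom F F \<phi>
  using \<phi>_hom by unfold_locales

lemma x_closed [simp]: "i < r \<Longrightarrow> x i \<in> carrier F"
  using x by auto

lemma pow_hom: "\<phi> ^^ k \<in> hom F F" and pow_inj: "inj_on (\<phi> ^^ k) (carrier F)"
proof (induction k)
  case 0
  { case 1 show ?case by (simp add: hom_def) }
  { case 2 show ?case by simp }
next
  case (Suc k)
  { case 1 show ?case
      unfolding funpow.simps by (rule hom_compose[OF Suc(1) \<phi>_hom]) }
  { case 2
    have "(\<phi> ^^ k) ` carrier F \<subseteq> carrier F"
      using Suc(1) by (auto simp: hom_def)
    then show ?case
      unfolding funpow.simps by (intro comp_inj_on[OF Suc(2) inj_on_subset[OF \<phi>_inj]]) }
qed

sublocale pow: group_hom F F "\<phi> ^^ k" for k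
  using pow_hom by unfold_locales

lemma pow_commensurable:
  "a \<in> carrier F \<Longrightarrow> b \<in> carrier F \<Longrightarrow> F.commensurable ((\<phi> ^^ k) a) ((\<phi> ^^ k) b) \<Longrightarrow> F.commensurable a b"
  by (rule F.commensurable_hom[OF pow_hom pow_inj])

lemma pow_ne_one: "a \<in> carrier F \<Longrightarrow> a \<noteq> \<one>\<^bsub>F\<^esub> \<Longrightarrow> (\<phi> ^^ k) a \<noteq> \<one>\<^bsub>F\<^esub>"
  using inj_onD[OF pow_inj, of k a "\<one>\<^bsub>F\<^esub>"] by auto

text \<open>As \<phi> need not be onto, elements of F can be moved to the left past
  \<open>t^-1\<close>, but in general not past \<open>t\<close>. A high power of \<open>t^-1\<close>
  in front of a word keeps the running exponent of \<open>t\<close> non-positive.\<close>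

abbreviation "T k \<equiv> inv\<^bsub>E\<^esub> t [^]\<^bsub>E\<^esub> (k :: nat)"

lemma T_closed [simp]: "T k \<in> carrier E"
  by simp

lemma T_\<iota>: "f \<in> carrier F \<Longrightarrow> T k \<otimes>\<^bsub>E\<^esub> \<iota> f = \<iota> ((\<phi> ^^ k) f) \<otimes>\<^bsub>E\<^esub> T k"
proof (induction k arbitrary: f)
  case (Suc k)
  have "inv\<^bsub>E\<^esub> t \<otimes>\<^bsub>E\<^esub> (\<iota> f \<otimes>\<^bsub>E\<^esub> t) \<otimes>\<^bsub>E\<^esub> inv\<^bsub>E\<^esub> t = \<iota> (\<phi> f) \<otimes>\<^bsub>E\<^esub> inv\<^bsub>E\<^esub> t"
    using Suc.prems by (simp add: \<iota>_t flip: E.m_assoc)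
  then have "inv\<^bsub>E\<^esub> t \<otimes>\<^bsub>E\<^esub> \<iota> f = \<iota> (\<phi> f) \<otimes>\<^bsub>E\<^esub> inv\<^bsub>E\<^esub> t"
    using Suc.prems by (simp add: E.m_assoc)
  then have "T (Suc k) \<otimes>\<^bsub>E\<^esub> \<iota> f = (T k \<otimes>\<^bsub>E\<^esub> \<iota> (\<phi> f)) \<otimes>\<^bsub>E\<^esub> inv\<^bsub>E\<^esub> t"
    using Suc.prems by (simp add: E.m_assoc)
  also have "\<dots> = \<iota> ((\<phi> ^^ Suc k) f) \<otimes>\<^bsub>E\<^esub> T (Suc k)"
    using Suc.IH[of "\<phi> f"] Suc.prems by (simp add: E.m_assoc funpow_swap1)
  finally show ?case .
qed simp

text \<open>If \<open>k\<close> and \<open>l\<close> differed, a non-zero power of \<open>t\<close>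
  would lie in the image of F.\<close>

lemma T_cancel:
  assumes g: "g \<in> carrier F" and eq: "T k = \<iota> g \<otimes>\<^bsub>E\<^esub> T l"
  shows "g = \<one>\<^bsub>F\<^esub>"
proof -
  have T_inv: "T k = inv\<^bsub>E\<^esub> (t [^]\<^bsub>E\<^esub> k)" for k
    by (simp add: E.nat_pow_inv)
  have "k = l"
  proof (cases k l rule: le_cases)
    case le
    then have "t [^]\<^bsub>E\<^esub> l = t [^]\<^bsub>E\<^esub> k \<otimes>\<^bsub>E\<^esub> t [^]\<^bsub>E\<^esub> (l - k)"
      by (simp add: E.nat_pow_mult)
    moreover have "\<iota> g = inv\<^bsub>E\<^esub> (t [^]\<^bsub>E\<^esub> k) \<otimes>\<^bsub>E\<^esub> t [^]\<^bsub>E\<^esub> l"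
      using eq g unfolding T_inv by (simp add: E.inv_solve_right)
    ultimately have "\<iota> g = t [^]\<^bsub>E\<^esub> (l - k)"
      by (simp flip: E.m_assoc)
    then have "l - k = 0" using g by (intro t_power) force
    with le show ?thesis by simp
  next
    case ge
    then have "t [^]\<^bsub>E\<^esub> k = t [^]\<^bsub>E\<^esub> l \<otimes>\<^bsub>E\<^esub> t [^]\<^bsub>E\<^esub> (k - l)"
      by (simp add: E.nat_pow_mult)
    moreover have "inv\<^bsub>E\<^esub> \<iota> g = inv\<^bsub>E\<^esub> (t [^]\<^bsub>E\<^esub> l) \<otimes>\<^bsub>E\<^esub> t [^]\<^bsub>E\<^esub> k"
    proof -
      have "\<iota> g = inv\<^bsub>E\<^esub> (t [^]\<^bsub>E\<^esub> k) \<otimes>\<^bsub>E\<^esub> t [^]\<^bsub>E\<^esub> l"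
        using eq g unfolding T_inv by (simp add: E.inv_solve_right)
      then show ?thesis by (simp add: E.inv_mult_group)
    qed
    ultimately have "\<iota> (inv\<^bsub>F\<^esub> g) = t [^]\<^bsub>E\<^esub> (k - l)"
      using g by (simp flip: E.m_assoc)
    then have "k - l = 0" using g by (intro t_power) (metis F.inv_closed imageI)
    with ge show ?thesis by simp
  qed
  with eq have "\<iota> g \<otimes>\<^bsub>E\<^esub> T l = \<one>\<^bsub>E\<^esub> \<otimes>\<^bsub>E\<^esub> T l"
    by simp
  then have "\<iota> g = \<iota> \<one>\<^bsub>F\<^esub>"
    using g by (subst (asm) E.right_cancel) auto
  with g show ?thesis by (intro inj_onD[OF \<iota>_inj]) auto
qed

end

text \<open>The excluded conjugates are those met where two consecutive letters \<open>z\<close> or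
  \<open>z^-1\<close> meet. Up to inverses and a power of \<phi>, the power before this place has
  base \<phi> \<open>y2\<close> or \<open>y1\<close>, the one after it \<open>y1\<close> or \<phi>
  \<open>y2\<close>, and \<open>f\<close> is the value of the word in the \<open>x i\<close> in
  between. Opposite exponents give equal bases; there \<open>f\<close> is non-trivial because the
  word is reduced.\<close>

locale ascending_generators = ascending_hnn F len E \<phi> \<iota> t x r Y
  for F :: "('a, 'b) monoid_scheme" and len and E :: "('c, 'd) monoid_scheme" and \<phi> \<iota> t x r Y +
  fixes D N :: nat and y1 y2 :: 'a
  assumes y1: "y1 \<in> carrier F" "y1 \<noteq> \<one>\<^bsub>F\<^esub>" and y2: "y2 \<in> carrier F" "y2 \<noteq> \<one>\<^bsub>F\<^esub>"
    and y12: "\<not> F.commensurable y1 y2"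
    and y1_conj: "f \<in> carrier F \<Longrightarrow> f \<noteq> \<one>\<^bsub>F\<^esub> \<Longrightarrow> len f \<le> D \<Longrightarrow>
      \<not> F.commensurable y1 (f \<otimes>\<^bsub>F\<^esub> y1 \<otimes>\<^bsub>F\<^esub> inv\<^bsub>F\<^esub> f)"
    and y2_conj: "f \<in> carrier F \<Longrightarrow> f \<noteq> \<one>\<^bsub>F\<^esub> \<Longrightarrow> len f \<le> D \<Longrightarrow>
      \<not> F.commensurable (\<phi> y2) (f \<otimes>\<^bsub>F\<^esub> \<phi> y2 \<otimes>\<^bsub>F\<^esub> inv\<^bsub>F\<^esub> f)"
    and y12_conj: "f \<in> carrier F \<Longrightarrow> len f \<le> D \<Longrightarrow>
      \<not> F.commensurable (\<phi> y2) (f \<otimes>\<^bsub>F\<^esub> y1 \<otimes>\<^bsub>F\<^esub> inv\<^bsub>F\<^esub> f)"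
    and D: "v \<in> words_over {..<r} \<Longrightarrow> length v \<le> N \<Longrightarrow> len (subst_value F x v) \<le> D"
begin

definition nxt :: "bool \<Rightarrow> nat \<Rightarrow> nat"
  where "nxt e k = (if e then k - 1 else Suc k)"

text \<open>\<open>Y1\<close> and \<open>Y2\<close> are the bases of the two powers that appear when
  \<open>T k\<close> moves past \<open>z\<close>, or past its inverse
  \<open>t^-1 y2^-m y1^-m\<close>. In the inverse the bases come in the opposite order and one more
  \<open>t^-1\<close> is crossed, hence \<open>Suc k\<close>.\<close>

definition Y1 :: "bool \<Rightarrow> nat \<Rightarrow> 'a"
  where "Y1 e k = (if e then (\<phi> ^^ k) y1 else inv\<^bsub>F\<^esub> (\<phi> ^^ Suc k) y2)"

definition Y2 :: "bool \<Rightarrow> nat \<Rightarrow> 'a"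
  where "Y2 e k = (if e then (\<phi> ^^ k) y2 else inv\<^bsub>F\<^esub> (\<phi> ^^ Suc k) y1)"

lemma Y12_closed [simp]: "Y1 e k \<in> carrier F" "Y2 e k \<in> carrier F"
  using y1 y2 pow.hom_closed[of _ k] pow.hom_closed[of _ "Suc k"] unfolding Y1_def Y2_def by auto

lemma Y12_ne_one: "Y1 e k \<noteq> \<one>\<^bsub>F\<^esub>" "Y2 e k \<noteq> \<one>\<^bsub>F\<^esub>"
  using y1 y2 pow_ne_one[of _ k] pow_ne_one[of _ "Suc k"] pow.hom_closed[of _ "Suc k"]
  unfolding Y1_def Y2_def by (auto simp del: funpow.simps)

lemma Y1_Y2: "\<not> F.commensurable (Y1 e k) (Y2 e k)"
proof (cases e)
  case True
  then show ?thesis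
    using y12 pow_commensurable[of y1 y2 k] y1 y2 by (auto simp: Y1_def Y2_def)
next
  case False
  have "\<not> F.commensurable ((\<phi> ^^ Suc k) y2) ((\<phi> ^^ Suc k) y1)"
    using y12 pow_commensurable[of y2 y1 "Suc k"] y1 y2 F.commensurable_sym by blast
  with False show ?thesis
    using y1 y2 pow.hom_closed[of _ "Suc k"]
    by (simp add: Y1_def Y2_def F.commensurable_inv_left F.commensurable_inv_right del: funpow.simps)
qed

text \<open>Injectivity of \<phi> removes the common power \<open>\<phi> ^^ nxt e k\<close>,
  inverses do not affect commensurability, and conjugation by \<open>f\<close> can be shifted to the
  other side. The four sign patterns are then the conditions of the locale.\<close>

lemma junction:
  assumes f: "f \<in> carrier F" "len f \<le> D" "e \<noteq> e' \<Longrightarrow> f \<noteq> \<one>\<^bsub>F\<^esub>" and k: "e \<Longrightarrow> k \<ge> 1"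
  shows "\<not> F.commensurable (inv\<^bsub>F\<^esub> (\<phi> ^^ nxt e k) f \<otimes>\<^bsub>F\<^esub> Y2 e k \<otimes>\<^bsub>F\<^esub> (\<phi> ^^ nxt e k) f) (Y1 e' (nxt e k))"
proof
  define l where "l = nxt e k"
  define a where "a = (if e then \<phi> y2 else y1)"
  define b where "b = (if e' then y1 else \<phi> y2)"
  let ?c = "(\<phi> ^^ l) f"
  have ab: "a \<in> carrier F" "b \<in> carrier F"
    using y1 y2 by (auto simp: a_def b_def)
  have Y2: "Y2 e k = (if e then (\<phi> ^^ l) a else inv\<^bsub>F\<^esub> (\<phi> ^^ l) a)"
    using k by (cases k) (auto simp: Y2_def a_def l_def nxt_def funpow_swap1)
  have Y1: "Y1 e' l = (if e' then (\<phi> ^^ l) b else inv\<^bsub>F\<^esub> (\<phi> ^^ l) b)"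
    by (auto simp: Y1_def b_def funpow_swap1)
  have inv_conj: "inv\<^bsub>F\<^esub> ?c \<otimes>\<^bsub>F\<^esub> inv\<^bsub>F\<^esub> (\<phi> ^^ l) a \<otimes>\<^bsub>F\<^esub> ?c = inv\<^bsub>F\<^esub> (inv\<^bsub>F\<^esub> ?c \<otimes>\<^bsub>F\<^esub> (\<phi> ^^ l) a \<otimes>\<^bsub>F\<^esub> ?c)"
    using ab f by (simp add: F.inv_mult_group F.m_assoc)
  assume "F.commensurable (inv\<^bsub>F\<^esub> (\<phi> ^^ nxt e k) f \<otimes>\<^bsub>F\<^esub> Y2 e k \<otimes>\<^bsub>F\<^esub> (\<phi> ^^ nxt e k) f) (Y1 e' (nxt e k))"
  then have "F.commensurable (inv\<^bsub>F\<^esub> ?c \<otimes>\<^bsub>F\<^esub> (\<phi> ^^ l) a \<otimes>\<^bsub>F\<^esub> ?c) ((\<phi> ^^ l) b)"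
    using ab f unfolding l_def[symmetric] Y1 Y2
    by (cases e; cases e') (simp_all add: inv_conj F.commensurable_inv_left F.commensurable_inv_right)
  then have "F.commensurable ((\<phi> ^^ l) (inv\<^bsub>F\<^esub> f \<otimes>\<^bsub>F\<^esub> a \<otimes>\<^bsub>F\<^esub> f)) ((\<phi> ^^ l) b)"
    using ab f by simp
  then have com: "F.commensurable (inv\<^bsub>F\<^esub> f \<otimes>\<^bsub>F\<^esub> a \<otimes>\<^bsub>F\<^esub> f) b"
    by (rule pow_commensurable[rotated 2]) (use ab f in auto)
  then have com': "F.commensurable a (f \<otimes>\<^bsub>F\<^esub> b \<otimes>\<^bsub>F\<^esub> inv\<^bsub>F\<^esub> f)"
    by (rule F.commensurable_conj_shift[rotated 3]) (use ab f in auto)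
  show False
  proof (cases e; cases e')
    assume "e" "e'"
    with com' show False using y12_conj[of f] f by (simp add: a_def b_def)
  next
    assume "e" "\<not> e'"
    with com' show False using y2_conj[of f] f by (simp add: a_def b_def)
  next
    assume "\<not> e" "e'"
    with com' show False using y1_conj[of f] f by (simp add: a_def b_def)
  next
    assume "\<not> e" "\<not> e'"
    with com have "F.commensurable (\<phi> y2) (inv\<^bsub>F\<^esub> f \<otimes>\<^bsub>F\<^esub> y1 \<otimes>\<^bsub>F\<^esub> f)"
      by (auto simp: a_def b_def dest: F.commensurable_sym)
    then show False using y12_conj[of "inv\<^bsub>F\<^esub> f"] f by simp
  qed
qed

definition z :: "nat \<Rightarrow> 'c"
  where "z m = \<iota> (y1 [^]\<^bsub>F\<^esub> m \<otimes>\<^bsub>F\<^esub> y2 [^]\<^bsub>F\<^esub> m) \<otimes>\<^bsub>E\<^esub> t"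

lemma z_closed [simp]: "z m \<in> carrier E"
  using y1 y2 by (simp add: z_def)

lemma T_z:
  assumes "e \<Longrightarrow> k \<ge> 1"
  shows "T k \<otimes>\<^bsub>E\<^esub> (if e then z m else inv\<^bsub>E\<^esub> z m) =
    \<iota> (Y1 e k [^]\<^bsub>F\<^esub> m \<otimes>\<^bsub>F\<^esub> Y2 e k [^]\<^bsub>F\<^esub> m) \<otimes>\<^bsub>E\<^esub> T (nxt e k)"
proof -
  let ?u = "y1 [^]\<^bsub>F\<^esub> m \<otimes>\<^bsub>F\<^esub> y2 [^]\<^bsub>F\<^esub> m"
  have u: "?u \<in> carrier F" using y1 y2 by simp
  have pow_u: "(\<phi> ^^ l) ?u = (\<phi> ^^ l) y1 [^]\<^bsub>F\<^esub> m \<otimes>\<^bsub>F\<^esub> (\<phi> ^^ l) y2 [^]\<^bsub>F\<^esub> m" for l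
    using y1 y2 by (simp add: pow.hom_nat_pow)
  show ?thesis
  proof (cases e)
    case True
    with assms obtain l where l: "k = Suc l" by (cases k) auto
    have "T k \<otimes>\<^bsub>E\<^esub> z m = (T k \<otimes>\<^bsub>E\<^esub> \<iota> ?u) \<otimes>\<^bsub>E\<^esub> t"
      using u by (simp add: z_def E.m_assoc)
    also have "\<dots> = \<iota> ((\<phi> ^^ k) ?u) \<otimes>\<^bsub>E\<^esub> (T k \<otimes>\<^bsub>E\<^esub> t)"
      using T_\<iota>[OF u, of k] u by (simp add: E.m_assoc)
    also have "T k \<otimes>\<^bsub>E\<^esub> t = T l"
      by (simp add: l E.m_assoc)
    finally have "T k \<otimes>\<^bsub>E\<^esub> z m = \<iota> ((\<phi> ^^ k) ?u) \<otimes>\<^bsub>E\<^esub> T l" .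
    moreover have "nxt e k = l"
      using True by (simp add: nxt_def l)
    ultimately show ?thesis
      using True by (simp only: pow_u Y1_def Y2_def if_True)
  next
    case False
    have "T k \<otimes>\<^bsub>E\<^esub> inv\<^bsub>E\<^esub> z m = T (Suc k) \<otimes>\<^bsub>E\<^esub> \<iota> (inv\<^bsub>F\<^esub> ?u)"
      using u by (simp add: z_def E.inv_mult_group E.m_assoc)
    also have "\<dots> = \<iota> ((\<phi> ^^ Suc k) (inv\<^bsub>F\<^esub> ?u)) \<otimes>\<^bsub>E\<^esub> T (Suc k)"
      using T_\<iota>[of "inv\<^bsub>F\<^esub> ?u" "Suc k"] u by blast
    also have "(\<phi> ^^ Suc k) (inv\<^bsub>F\<^esub> ?u) = inv\<^bsub>F\<^esub> (\<phi> ^^ Suc k) ?u"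
      using u by (rule pow.hom_inv)
    also have "\<dots> = Y1 e k [^]\<^bsub>F\<^esub> m \<otimes>\<^bsub>F\<^esub> Y2 e k [^]\<^bsub>F\<^esub> m"
      unfolding pow_u using False y1 y2 pow.hom_closed[of _ "Suc k"]
      by (simp add: Y1_def Y2_def F.inv_mult_group F.nat_pow_inv del: funpow.simps)
    finally show ?thesis
      using False by (simp add: nxt_def)
  qed
qed

abbreviation "I \<equiv> {..<r} <+> (UNIV :: unit set)"

definition gens :: "nat \<Rightarrow> nat + unit \<Rightarrow> 'c"
  where "gens m = case_sum (\<lambda>i. \<iota> (x i)) (\<lambda>_. z m)"

lemma gens_closed: "gens m \<in> I \<rightarrow> carrier E"
  by (auto simp: gens_def)

lemma gens_Inl:
  assumes "v \<in> words_over {..<r}"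
  shows "subst_value E (gens m) (map (map_prod Inl id) v) = \<iota> (subst_value F x v)"
  unfolding subst_value_map
  using hom_subst_value[OF F.is_group E.is_group \<iota>_hom x assms] by (simp add: gens_def)

abbreviation "junctions \<equiv>
  successively (\<lambda>(Y, c) (Z, _). \<not> F.commensurable (inv\<^bsub>F\<^esub> c \<otimes>\<^bsub>F\<^esub> Y \<otimes>\<^bsub>F\<^esub> c) Z)"

text \<open>Each letter \<open>z\<close> or \<open>z^-1\<close> yields two powers, and the word in
  the \<open>x i\<close> behind it becomes the constant factor of the second. The exponent in
  \<open>T\<close> drops by at most one per letter, so \<open>length w < k\<close> keeps it positive
  whenever a \<open>z\<close> has to be crossed. One list \<open>L\<close> serves all
  \<open>m\<close>, as \<open>big_powers\<close> requires.\<close>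

lemma normal_form:
  assumes "freely_reduced ((Inr (), e) # w)" "w \<in> words_over I" "length w \<le> N" "length w < k"
  shows "\<exists>L l. L \<noteq> [] \<and> hd L = (Y1 e k, \<one>\<^bsub>F\<^esub>) \<and>
    (\<forall>(Y, c)\<in>set L. Y \<in> carrier F \<and> Y \<noteq> \<one>\<^bsub>F\<^esub> \<and> c \<in> carrier F) \<and> junctions L \<and>
    (\<forall>m. T k \<otimes>\<^bsub>E\<^esub> subst_value E (gens m) ((Inr (), e) # w) = \<iota> (F.power_product L m) \<otimes>\<^bsub>E\<^esub> T l)"
  using assms
proof (induction "length w" arbitrary: w e k rule: less_induct)
  case less
  have step: "T k \<otimes>\<^bsub>E\<^esub> subst_value E (gens m) ((Inr (), e) # w) =
      \<iota> (Y1 e k [^]\<^bsub>F\<^esub> m \<otimes>\<^bsub>F\<^esub> Y2 e k [^]\<^bsub>F\<^esub> m) \<otimes>\<^bsub>E\<^esub> (T (nxt e k) \<otimes>\<^bsub>E\<^esub> subst_value E (gens m) w)" for m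
  proof -
    have w: "subst_value E (gens m) w \<in> carrier E"
      using E.subst_value_closed[OF gens_closed less.prems(2)] .
    have "T k \<otimes>\<^bsub>E\<^esub> subst_value E (gens m) ((Inr (), e) # w)
        = (T k \<otimes>\<^bsub>E\<^esub> (if e then z m else inv\<^bsub>E\<^esub> z m)) \<otimes>\<^bsub>E\<^esub> subst_value E (gens m) w"
      using w by (simp add: gens_def E.m_assoc)
    also have "\<dots> = (\<iota> (Y1 e k [^]\<^bsub>F\<^esub> m \<otimes>\<^bsub>F\<^esub> Y2 e k [^]\<^bsub>F\<^esub> m) \<otimes>\<^bsub>E\<^esub> T (nxt e k)) \<otimes>\<^bsub>E\<^esub> subst_value E (gens m) w"
      using less.prems(4) by (subst T_z) auto
    finally show ?thesis using w by (simp add: E.m_assoc)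
  qed
  show ?case
  proof (cases w rule: sum_word_cases)
    case (1 v)
    let ?f = "subst_value F x v"
    have v: "v \<in> words_over {..<r}"
      using less.prems(2) unfolding 1 words_over_map by (auto simp: words_over_def)
    then have f: "?f \<in> carrier F"
      by (rule F.subst_value_closed[OF x])
    let ?L = "[(Y1 e k, \<one>\<^bsub>F\<^esub>), (Y2 e k, (\<phi> ^^ nxt e k) ?f)]"
    have "T k \<otimes>\<^bsub>E\<^esub> subst_value E (gens m) ((Inr (), e) # w) = \<iota> (F.power_product ?L m) \<otimes>\<^bsub>E\<^esub> T (nxt e k)" for m
      unfolding step using f v by (simp add: 1 gens_Inl T_\<iota> E.m_assoc F.m_assoc)
    then show ?thesis
      using f Y1_Y2 Y12_ne_one by (intro exI[of _ ?L] exI[of _ "nxt e k"]) simp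
  next
    case (2 v \<tau> w')
    obtain e' where w_eq: "w = map (map_prod Inl id) v @ (Inr (), e') # w'"
      using 2 by (cases \<tau>) simp
    let ?f = "subst_value F x v"
    have v: "v \<in> words_over {..<r}" and w': "w' \<in> words_over I"
      using less.prems(2) unfolding w_eq words_over_append words_over_map by (auto simp: words_over_def)
    then have f: "?f \<in> carrier F"
      using F.subst_value_closed[OF x] by blast
    have red: "freely_reduced ((Inr (), e') # w')"
      using less.prems(1) by (simp add: w_eq freely_reduced_append freely_reduced_Cons[of "(Inr (), e)"])
    have "length w' < length w" "length w' \<le> N" "length w' < nxt e k" and lenv: "length v \<le> N"
      using less.prems(3,4) by (auto simp: w_eq nxt_def)
    from less.hyps[OF this(1) red w' this(2,3)] obtain L l where L: "L \<noteq> []" "hd L = (Y1 e' (nxt e k), \<one>\<^bsub>F\<^esub>)"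
      "\<forall>(Y, c)\<in>set L. Y \<in> carrier F \<and> Y \<noteq> \<one>\<^bsub>F\<^esub> \<and> c \<in> carrier F" "junctions L"
      and val: "\<And>m. T (nxt e k) \<otimes>\<^bsub>E\<^esub> subst_value E (gens m) ((Inr (), e') # w') = \<iota> (F.power_product L m) \<otimes>\<^bsub>E\<^esub> T l"
      by blast
    let ?c = "(\<phi> ^^ nxt e k) ?f"
    let ?L = "(Y1 e k, \<one>\<^bsub>F\<^esub>) # (Y2 e k, ?c) # L"
    have "\<not> F.commensurable (inv\<^bsub>F\<^esub> ?c \<otimes>\<^bsub>F\<^esub> Y2 e k \<otimes>\<^bsub>F\<^esub> ?c) (Y1 e' (nxt e k))"
    proof (rule junction[OF f D[OF v lenv]])
      assume "e \<noteq> e'"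
      then have "v \<noteq> []"
        using less.prems(1) by (auto simp: w_eq inv_letter_def)
      moreover have "freely_reduced v"
        using less.prems(1) by (simp add: w_eq freely_reduced_Cons freely_reduced_append freely_reduced_map)
      ultimately show "?f \<noteq> \<one>\<^bsub>F\<^esub>"
        using free v by blast
    qed (use less.prems(4) in simp)
    then have "junctions ?L"
      using L Y1_Y2[of e k] by (cases L) auto
    moreover have pp: "F.power_product L m \<in> carrier F" for m
      using L(3) by (induction L) auto
    have "T k \<otimes>\<^bsub>E\<^esub> subst_value E (gens m) ((Inr (), e) # w) = \<iota> (F.power_product ?L m) \<otimes>\<^bsub>E\<^esub> T l" for m
    proof -
      have w'': "subst_value E (gens m) ((Inr (), e') # w') \<in> carrier E"
        using w' by (intro E.subst_value_closed[OF gens_closed]) auto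
      have "subst_value E (gens m) w = \<iota> ?f \<otimes>\<^bsub>E\<^esub> subst_value E (gens m) ((Inr (), e') # w')"
        unfolding w_eq gens_Inl[OF v, of m, symmetric]
        using less.prems(2) by (intro E.subst_value_append[OF gens_closed]) (simp_all add: w_eq)
      then have "T (nxt e k) \<otimes>\<^bsub>E\<^esub> subst_value E (gens m) w =
          (T (nxt e k) \<otimes>\<^bsub>E\<^esub> \<iota> ?f) \<otimes>\<^bsub>E\<^esub> subst_value E (gens m) ((Inr (), e') # w')"
        using f w'' by (simp add: E.m_assoc del: subst_value_Cons)
      also have "\<dots> = \<iota> ?c \<otimes>\<^bsub>E\<^esub> (\<iota> (F.power_product L m) \<otimes>\<^bsub>E\<^esub> T l)"
        using f w'' val[of m] by (simp add: T_\<iota> E.m_assoc del: subst_value_Cons)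
      finally show ?thesis
        unfolding step using f pp by (simp add: E.m_assoc F.m_assoc)
    qed
    ultimately show ?thesis
      using f L Y12_ne_one by (intro exI[of _ ?L] exI[of _ l]) auto
  qed
qed

text \<open>A word without \<open>z\<close> is non-trivial by freeness of the \<open>x i\<close>.
  Otherwise, after multiplication by \<open>T (Suc N)\<close>, triviality would make a power product
  inverse to an element \<open>?g\<close> that is independent of \<open>m\<close>, contradicting the
  growth of its length.\<close>

lemma word_nontrivial:
  assumes w: "w \<in> words_over I" "freely_reduced w" "w \<noteq> []" "length w \<le> N"
  obtains M where "\<And>m. m \<ge> M \<Longrightarrow> subst_value E (gens m) w \<noteq> \<one>\<^bsub>E\<^esub>"
proof (cases w rule: sum_word_cases)
  case (1 v)
  have v: "v \<in> words_over {..<r}" "freely_reduced v" "v \<noteq> []"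
    using w unfolding 1 words_over_map by (auto simp: words_over_def freely_reduced_map)
  then have "subst_value F x v \<noteq> \<one>\<^bsub>F\<^esub>" "subst_value F x v \<in> carrier F"
    using free F.subst_value_closed[OF x] by auto
  then have "\<iota> (subst_value F x v) \<noteq> \<one>\<^bsub>E\<^esub>"
    using inj_onD[OF \<iota>_inj, of "subst_value F x v" "\<one>\<^bsub>F\<^esub>"] by auto
  then show thesis
    using that v by (simp add: 1 gens_Inl)
next
  case (2 v \<tau> w')
  obtain e where w_eq: "w = map (map_prod Inl id) v @ (Inr (), e) # w'"
    using 2 by (cases \<tau>) simp
  let ?f = "subst_value F x v" and ?k = "Suc N"
  have v: "v \<in> words_over {..<r}" and w': "w' \<in> words_over I"
    using w unfolding w_eq words_over_append words_over_map by (auto simp: words_over_def)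
  then have f: "?f \<in> carrier F"
    using F.subst_value_closed[OF x] by blast
  have "freely_reduced ((Inr (), e) # w')" "length w' \<le> N" "length w' < ?k"
    using w by (auto simp: w_eq freely_reduced_append)
  from normal_form[OF this(1) w' this(2,3)] obtain L l where L: "L \<noteq> []"
      "\<forall>(Y, c)\<in>set L. Y \<in> carrier F \<and> Y \<noteq> \<one>\<^bsub>F\<^esub> \<and> c \<in> carrier F" "junctions L"
      and val: "\<And>m. T ?k \<otimes>\<^bsub>E\<^esub> subst_value E (gens m) ((Inr (), e) # w') = \<iota> (F.power_product L m) \<otimes>\<^bsub>E\<^esub> T l"
    by blast
  have pp: "F.power_product L m \<in> carrier F" for m
    using L(2) by (induction L) auto
  let ?g = "(\<phi> ^^ ?k) ?f"
  have g: "?g \<in> carrier F" using f by (rule pow.hom_closed)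
  obtain M where M: "\<And>m. m \<ge> M \<Longrightarrow> len (F.power_product L m) > len ?g"
    by (rule F.big_powers[of L "len ?g"]) (use L in auto)
  have "subst_value E (gens m) w \<noteq> \<one>\<^bsub>E\<^esub>" if "m \<ge> M" for m
  proof
    assume one: "subst_value E (gens m) w = \<one>\<^bsub>E\<^esub>"
    have w'': "subst_value E (gens m) ((Inr (), e) # w') \<in> carrier E"
      using w' by (intro E.subst_value_closed[OF gens_closed]) auto
    have "subst_value E (gens m) w = \<iota> ?f \<otimes>\<^bsub>E\<^esub> subst_value E (gens m) ((Inr (), e) # w')"
      unfolding w_eq gens_Inl[OF v, of m, symmetric]
      using w(1) by (intro E.subst_value_append[OF gens_closed]) (simp_all add: w_eq)
    then have "T ?k \<otimes>\<^bsub>E\<^esub> subst_value E (gens m) w =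
        (T ?k \<otimes>\<^bsub>E\<^esub> \<iota> ?f) \<otimes>\<^bsub>E\<^esub> subst_value E (gens m) ((Inr (), e) # w')"
      using f w'' by (simp only: E.m_assoc T_closed \<iota>.hom_closed)
    also have "T ?k \<otimes>\<^bsub>E\<^esub> \<iota> ?f = \<iota> ?g \<otimes>\<^bsub>E\<^esub> T ?k"
      using f by (rule T_\<iota>)
    also have "\<iota> ?g \<otimes>\<^bsub>E\<^esub> T ?k \<otimes>\<^bsub>E\<^esub> subst_value E (gens m) ((Inr (), e) # w') =
        \<iota> (?g \<otimes>\<^bsub>F\<^esub> F.power_product L m) \<otimes>\<^bsub>E\<^esub> T l"
      using g w'' val[of m] pp[of m] by (simp only: E.m_assoc T_closed \<iota>.hom_closed \<iota>.hom_mult)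
    finally have eq: "T ?k = \<iota> (?g \<otimes>\<^bsub>F\<^esub> F.power_product L m) \<otimes>\<^bsub>E\<^esub> T l"
      unfolding one E.r_one[OF T_closed] .
    have "?g \<otimes>\<^bsub>F\<^esub> F.power_product L m = \<one>\<^bsub>F\<^esub>"
      by (rule T_cancel[OF _ eq]) (intro F.m_closed g pp)
    then have "?g = inv\<^bsub>F\<^esub> F.power_product L m"
      using g pp by (metis F.inv_equality F.inv_inv F.inv_closed)
    then have "len ?g = len (F.power_product L m)"
      using pp by simp
    with M[OF that] show False by simp
  qed
  then show thesis by (rule that)
qed

lemma generate_gens: "generate E (gens m ` I) = carrier E"
proof
  let ?H = "generate E (gens m ` I)"
  show "?H \<subseteq> carrier E"
    by (rule E.generate_incl) (use gens_closed in blast)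
  have H: "subgroup ?H E"
    by (rule E.generate_is_subgroup) (use gens_closed in blast)
  interpret H: subgroup ?H E by (rule H)
  have "\<iota> (x i) \<in> ?H" if "i < r" for i
  proof -
    have "gens m (Inl i) \<in> ?H" using that by (intro generate.incl imageI) auto
    then show ?thesis by (simp add: gens_def)
  qed
  then have "\<iota> ` x ` {..<r} \<subseteq> ?H" by auto
  then have "generate E (\<iota> ` x ` {..<r}) \<subseteq> ?H"
    by (rule E.generate_subgroup_incl[OF _ H])
  moreover have "generate E (\<iota> ` x ` {..<r}) = \<iota> ` carrier F"
    using \<iota>.generate_img[of "x ` {..<r}"] x generate_F by (auto simp: image_subset_iff)
  ultimately have \<iota>H: "\<iota> ` carrier F \<subseteq> ?H" by simp
  let ?u = "y1 [^]\<^bsub>F\<^esub> m \<otimes>\<^bsub>F\<^esub> y2 [^]\<^bsub>F\<^esub> m"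
  have u: "?u \<in> carrier F" using y1 y2 by simp
  have "gens m (Inr ()) \<in> ?H" by (intro generate.incl imageI) auto
  then have "inv\<^bsub>E\<^esub> \<iota> ?u \<otimes>\<^bsub>E\<^esub> z m \<in> ?H"
    using \<iota>H u by (intro H.m_closed H.m_inv_closed) (auto simp: gens_def)
  moreover have "inv\<^bsub>E\<^esub> \<iota> ?u \<otimes>\<^bsub>E\<^esub> z m = t"
    using u by (simp add: z_def flip: E.m_assoc)
  ultimately have "insert t (\<iota> ` carrier F) \<subseteq> ?H"
    using \<iota>H by simp
  then show "carrier E \<subseteq> ?H"
    unfolding generate_E[symmetric] by (rule E.generate_subgroup_incl[OF _ H])
qed

lemma good_generators:
  "\<exists>m. \<forall>w\<in>words_over I. freely_reduced w \<longrightarrow> w \<noteq> [] \<longrightarrow> length w \<le> N \<longrightarrow>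
    subst_value E (gens m) w \<noteq> \<one>\<^bsub>E\<^esub>"
proof -
  let ?W = "{w \<in> words_over I. length w \<le> N} \<inter> {w. freely_reduced w \<and> w \<noteq> []}"
  have fin: "finite ?W"
    using finite_short_words[of I N] by simp
  have "\<forall>w\<in>?W. \<exists>M. \<forall>m\<ge>M. subst_value E (gens m) w \<noteq> \<one>\<^bsub>E\<^esub>"
    using word_nontrivial by blast
  from bchoice[OF this] obtain M
    where M: "\<forall>w\<in>?W. \<forall>m\<ge>M w. subst_value E (gens m) w \<noteq> \<one>\<^bsub>E\<^esub>" by blast
  have "M w \<le> Max (insert 0 (M ` ?W))" if "w \<in> ?W" for w
    using that fin by (intro Max_ge) auto
  then show ?thesis
    using M by (intro exI[of _ "Max (insert 0 (M ` ?W))"] ballI impI) simp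
qed

end

theorem (in ascending_hnn) girth_infinite: "girth E = \<infinity>"
proof (rule girth_eq_infinityI)
  fix N
  have "finite (len ` subst_value F x ` {v \<in> words_over {..<r}. length v \<le> N})"
    by (intro finite_imageI finite_short_words) simp
  then obtain D where D: "\<And>v. v \<in> words_over {..<r} \<Longrightarrow> length v \<le> N \<Longrightarrow> len (subst_value F x v) \<le> D"
    using finite_nat_set_iff_bounded_le by auto
  let ?B = "{f \<in> carrier F. len f \<le> D}"
  have com_eq: "y = y'"
    if "y \<in> Y" "y' \<in> Y" "F.commensurable y g" "F.commensurable y' g" "g \<in> carrier F" for y y' g
    by (intro Y_indep that F.commensurable_trans[OF that(3) F.commensurable_sym[OF that(4)]])
      (use that Y in auto)
  have com_eq': "y = y'"
    if "y \<in> Y" "y' \<in> Y" "F.commensurable (\<phi> y) g" "F.commensurable (\<phi> y') g" "g \<in> carrier F" for y y' g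
  proof -
    have "F.commensurable (\<phi> y) (\<phi> y')"
      by (rule F.commensurable_trans[OF that(3) F.commensurable_sym[OF that(4)]]) (use that Y in auto)
    then have "F.commensurable y y'"
      by (rule F.commensurable_hom[OF \<phi>_hom \<phi>_inj, rotated 2]) (use that Y in auto)
    then show ?thesis by (rule Y_indep[OF that(1,2)])
  qed
  have \<phi>_ne: "\<phi> y \<noteq> \<one>\<^bsub>F\<^esub>" if "y \<in> Y" for y
  proof -
    have "(\<phi> ^^ 1) y \<noteq> \<one>\<^bsub>F\<^esub>" by (rule pow_ne_one) (use that Y in auto)
    then show ?thesis by simp
  qed
  \<comment> \<open>An element commensurable with its conjugate by a non-trivial \<open>f\<close> is
    commensurable with \<open>f\<close>, and at most one member of \<open>Y\<close> is.\<close>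
  obtain y1 where y1: "y1 \<in> Y" and y1_conj: "\<And>f. f \<in> ?B - {\<one>\<^bsub>F\<^esub>} \<Longrightarrow>
      \<not> F.commensurable y1 (f \<otimes>\<^bsub>F\<^esub> y1 \<otimes>\<^bsub>F\<^esub> inv\<^bsub>F\<^esub> f)"
  proof (rule infinite_avoids_finite[OF Y(1), where E = "?B - {\<one>\<^bsub>F\<^esub>}"
        and P = "\<lambda>f y. F.commensurable y (f \<otimes>\<^bsub>F\<^esub> y \<otimes>\<^bsub>F\<^esub> inv\<^bsub>F\<^esub> f)"])
    show "finite (?B - {\<one>\<^bsub>F\<^esub>})" using F.finite_ball by simp
    fix f y y' assume f: "f \<in> ?B - {\<one>\<^bsub>F\<^esub>}" and y: "y \<in> Y" "y' \<in> Y"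
      and com: "F.commensurable y (f \<otimes>\<^bsub>F\<^esub> y \<otimes>\<^bsub>F\<^esub> inv\<^bsub>F\<^esub> f)" "F.commensurable y' (f \<otimes>\<^bsub>F\<^esub> y' \<otimes>\<^bsub>F\<^esub> inv\<^bsub>F\<^esub> f)"
    have "F.commensurable y f"
      by (rule F.commensurable_conj[OF _ _ _ _ com(1)]) (use Y y f in auto)
    moreover have "F.commensurable y' f"
      by (rule F.commensurable_conj[OF _ _ _ _ com(2)]) (use Y y f in auto)
    ultimately show "y = y'"
      by (rule com_eq[OF y]) (use f in simp)
  qed (rule that)
  have y1': "y1 \<in> carrier F" "y1 \<noteq> \<one>\<^bsub>F\<^esub>" using y1 Y by auto
  \<comment> \<open>The tags 0, 1, 2 mark the conditions on \<open>y2\<close> once \<open>y1\<close>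
    is fixed: against \<open>y1\<close>, against conjugates of \<open>y1\<close>, and against its
    own conjugates. For each pair \<open>(n, f)\<close> at most one member of \<open>Y\<close>
    fails.\<close>
  define P where "P = (\<lambda>(n :: nat, f) y. (n = 0 \<and> F.commensurable y y1) \<or>
    (n = 1 \<and> F.commensurable (\<phi> y) (f \<otimes>\<^bsub>F\<^esub> y1 \<otimes>\<^bsub>F\<^esub> inv\<^bsub>F\<^esub> f)) \<or>
    (n = 2 \<and> f \<noteq> \<one>\<^bsub>F\<^esub> \<and> F.commensurable (\<phi> y) (f \<otimes>\<^bsub>F\<^esub> \<phi> y \<otimes>\<^bsub>F\<^esub> inv\<^bsub>F\<^esub> f)))"
  obtain y2 where y2: "y2 \<in> Y" and P: "\<And>p. p \<in> {..2} \<times> ?B \<Longrightarrow> \<not> P p y2"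
  proof (rule infinite_avoids_finite[OF Y(1), of "{..2} \<times> ?B" P])
    show "finite ({..2 :: nat} \<times> ?B)" using F.finite_ball by simp
    fix p y y' assume p: "p \<in> {..2} \<times> ?B" and y: "y \<in> Y" "y' \<in> Y" "P p y" "P p y'"
    obtain n f where nf: "p = (n, f)" by (cases p)
    have f: "f \<in> carrier F" using p nf by auto
    consider "n = 0" | "n = 1" | "n = 2" using p nf by force
    then show "y = y'"
    proof cases
      case 1
      with y nf y1' show ?thesis by (intro com_eq[of y y' y1]) (auto simp: P_def)
    next
      case 2
      with y nf y1' f show ?thesis
        by (intro com_eq'[of y y' "f \<otimes>\<^bsub>F\<^esub> y1 \<otimes>\<^bsub>F\<^esub> inv\<^bsub>F\<^esub> f"]) (auto simp: P_def)
    next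
      case 3
      then have f1: "f \<noteq> \<one>\<^bsub>F\<^esub>" and com: "F.commensurable (\<phi> y) (f \<otimes>\<^bsub>F\<^esub> \<phi> y \<otimes>\<^bsub>F\<^esub> inv\<^bsub>F\<^esub> f)"
        "F.commensurable (\<phi> y') (f \<otimes>\<^bsub>F\<^esub> \<phi> y' \<otimes>\<^bsub>F\<^esub> inv\<^bsub>F\<^esub> f)"
        using y nf by (auto simp: P_def)
      have "F.commensurable (\<phi> y) f"
        by (rule F.commensurable_conj[OF _ _ f f1 com(1)]) (use y Y \<phi>_ne in auto)
      moreover have "F.commensurable (\<phi> y') f"
        by (rule F.commensurable_conj[OF _ _ f f1 com(2)]) (use y Y \<phi>_ne in auto)
      ultimately show ?thesis
        by (rule com_eq'[OF y(1,2) _ _ f])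
    qed
  qed (rule that)
  interpret ascending_generators F len E \<phi> \<iota> t x r Y D N y1 y2
  proof
    show "y1 \<in> carrier F" "y1 \<noteq> \<one>\<^bsub>F\<^esub>" by fact+
    show "y2 \<in> carrier F" "y2 \<noteq> \<one>\<^bsub>F\<^esub>" using y2 Y by auto
    show "\<not> F.commensurable y1 y2"
      using P[of "(0, \<one>\<^bsub>F\<^esub>)"] F.commensurable_sym by (auto simp: P_def)
    show "\<not> F.commensurable y1 (f \<otimes>\<^bsub>F\<^esub> y1 \<otimes>\<^bsub>F\<^esub> inv\<^bsub>F\<^esub> f)"
      if "f \<in> carrier F" "f \<noteq> \<one>\<^bsub>F\<^esub>" "len f \<le> D" for f
      using y1_conj[of f] that by simp
    show "\<not> F.commensurable (\<phi> y2) (f \<otimes>\<^bsub>F\<^esub> \<phi> y2 \<otimes>\<^bsub>F\<^esub> inv\<^bsub>F\<^esub> f)"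
      if "f \<in> carrier F" "f \<noteq> \<one>\<^bsub>F\<^esub>" "len f \<le> D" for f
      using P[of "(2, f)"] that by (simp add: P_def)
    show "\<not> F.commensurable (\<phi> y2) (f \<otimes>\<^bsub>F\<^esub> y1 \<otimes>\<^bsub>F\<^esub> inv\<^bsub>F\<^esub> f)"
      if "f \<in> carrier F" "len f \<le> D" for f
      using P[of "(1, f)"] that by (simp add: P_def)
  qed (rule D)
  obtain m where "\<forall>w\<in>words_over I. freely_reduced w \<longrightarrow> w \<noteq> [] \<longrightarrow> length w \<le> N \<longrightarrow>
    subst_value E (gens m) w \<noteq> \<one>\<^bsub>E\<^esub>"
    using good_generators by blast
  then show "\<exists>(I :: (nat + unit) set) f. finite I \<and> f \<in> I \<rightarrow> carrier E \<and> generate E (f ` I) = carrier E \<and>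
    (\<forall>w\<in>words_over I. freely_reduced w \<longrightarrow> w \<noteq> [] \<longrightarrow> length w \<le> N \<longrightarrow> subst_value E f w \<noteq> \<one>\<^bsub>E\<^esub>)"
    using gens_closed[of m] generate_gens[of m] by (intro exI[of _ I] exI[of _ "gens m"]) simp
qed

section \<open>Free groups\<close>

fun lcp :: "'a list \<Rightarrow> 'a list \<Rightarrow> nat" where
  "lcp (a # u) (b # v) = (if a = b then Suc (lcp u v) else 0)"
| "lcp _ _ = 0"

lemma lcp_ultrametric: "min (lcp u v) (lcp v w) \<le> lcp u w"
proof (induction u v arbitrary: w rule: lcp.induct)
  case (1 a u b v)
  then show ?case by (cases w) auto
qed auto

lemma nth_lcp: "i < lcp u v \<Longrightarrow> i < length u \<and> i < length v \<and> u ! i = v ! i"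
proof (induction u v arbitrary: i rule: lcp.induct)
  case (1 a u b v)
  then show ?case by (cases i) (auto split: if_splits)
qed auto

section \<open>Cancellation between reduced words\<close>

abbreviation inverse_word :: "'x word \<Rightarrow> 'x word"
  where "inverse_word w \<equiv> map inv_letter (rev w)"

lemma inverse_word_inverse_word [simp]: "inverse_word (inverse_word w) = w"
  by (simp add: rev_map comp_def)

lemma freely_reduced_inverse_word: "freely_reduced w \<Longrightarrow> freely_reduced (inverse_word w)"
proof (induction w)
  case (Cons l w)
  then show ?case
    by (cases w) (auto simp: freely_reduced_append dest: freely_reduced_ConsD)
qed simp

text \<open>Exactly the common prefix cancels: behind it the first letters differ, so the rest is
  reduced. Hence \<open>lcp\<close> is the Gromov product of the Cayley tree, and
  \<open>lcp_ultrametric\<close> is its hyperbolicity.\<close>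

lemma length_free_reduction_inverse:
  assumes "freely_reduced u" "freely_reduced v"
  shows "length (free_reduction (inverse_word u @ v)) + 2 * lcp u v = length u + length v"
  using assms
proof (induction u v rule: lcp.induct)
  case (1 a u b v)
  show ?case
  proof (cases "a = b")
    case True
    have "free_reduction (inverse_word (a # u) @ b # v) = foldr cancel_cons (inverse_word u) (cancel_cons (inv_letter a) (cancel_cons a (free_reduction v)))"
      using True by (simp add: free_reduction_def)
    also have "cancel_cons (inv_letter a) (cancel_cons a (free_reduction v)) = free_reduction v"
      using cancel_cons_inverse[of "free_reduction v" "inv_letter a"] by simp
    also have "foldr cancel_cons (inverse_word u) (free_reduction v) = free_reduction (inverse_word u @ v)"
      by (simp add: free_reduction_def)
    finally show ?thesis
      using 1 True by (auto dest: freely_reduced_ConsD)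
  next
    case False
    then have "freely_reduced (inverse_word (a # u) @ b # v)"
      using 1(2,3) freely_reduced_inverse_word[OF 1(2)] by (auto simp: freely_reduced_append)
    then show ?thesis
      using False by (simp add: free_reduction_id)
  qed
next
  case ("2_1" v)
  then show ?case by (simp add: free_reduction_id)
next
  case ("2_2" u)
  then show ?case
    using freely_reduced_inverse_word[of u] by (cases u) (simp_all add: free_reduction_id)
qed

lemma inv_free_group: "w \<in> carrier (free_group X) \<Longrightarrow> inv\<^bsub>free_group X\<^esub> w = inverse_word w"
proof -
  assume w: "w \<in> carrier (free_group X)"
  interpret group "free_group X" by (rule group_free_group)
  have "inverse_word w \<in> carrier (free_group X)"
    using w freely_reduced_inverse_word by (force simp: free_group_def words_over_def)
  with w show ?thesis
    by (intro inv_equality) (simp_all add: free_group_def free_reduction_inverse)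
qed

text \<open>A reduced word cannot cancel to its middle in its own square: the middle letter would be its
  own inverse, or the two middle letters would be inverse to each other.\<close>

lemma length_square_gt:
  assumes w: "freely_reduced w" "w \<noteq> []"
  shows "length w < length (free_reduction (w @ w))"
proof (rule ccontr)
  assume "\<not> ?thesis"
  moreover have "length (free_reduction (w @ w)) + 2 * lcp (inverse_word w) w = length w + length w"
    using length_free_reduction_inverse[OF freely_reduced_inverse_word[OF w(1)] w(1)] by simp
  ultimately have lcp: "length w \<le> 2 * lcp (inverse_word w) w" by linarith
  have mirror: "w ! i = inv_letter (w ! (length w - Suc i))" if "i < lcp (inverse_word w) w" for i
  proof -
    have "i < length w" "inverse_word w ! i = w ! i"
      using nth_lcp[OF that] by auto
    moreover from this have "inverse_word w ! i = inv_letter (w ! (length w - Suc i))"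
      by (simp add: rev_nth)
    ultimately show ?thesis by (simp only:)
  qed
  show False
  proof (cases "even (length w)")
    case True
    then obtain s where s: "length w = 2 * s" by blast
    with w(2) have "s \<noteq> 0" by (metis length_0_conv mult_0_right)
    then obtain p where p: "s = Suc p" using not0_implies_Suc by blast
    have "w ! p = inv_letter (w ! Suc p)"
      using mirror[of p] lcp s p by simp
    moreover have "w ! Suc p \<noteq> inv_letter (w ! p)"
      using w(1) s p unfolding freely_reduced_def successively_conv_nth by auto
    ultimately show False by (metis inv_letter_inv_letter)
  next
    case False
    then obtain s where s: "length w = 2 * s + 1" by (elim oddE)
    then have "w ! s = inv_letter (w ! s)"
      using mirror[of s] lcp by simp
    then show False by (metis inv_letter_neq)
  qed
qed

lemma length_group_free_group:
  assumes "finite X"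
  shows "length_group (free_group X) length"
proof -
  interpret group "free_group X" by (rule group_free_group)
  have red: "freely_reduced w" if "w \<in> carrier (free_group X)" for w
    using that by (simp add: free_group_def)
  have len: "int (length u) + int (length v) - int (length (inv\<^bsub>free_group X\<^esub> u \<otimes>\<^bsub>free_group X\<^esub> v)) = 2 * int (lcp u v)"
    if "u \<in> carrier (free_group X)" "v \<in> carrier (free_group X)" for u v
  proof -
    have "inv\<^bsub>free_group X\<^esub> u \<otimes>\<^bsub>free_group X\<^esub> v = free_reduction (inverse_word u @ v)"
      using that by (simp add: inv_free_group) (simp add: free_group_def)
    then show ?thesis
      using length_free_reduction_inverse[of u v] red that by simp
  qed
  show ?thesis
  proof
    show "length \<one>\<^bsub>free_group X\<^esub> = 0"
      by (simp add: free_group_def)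
    show "length (inv\<^bsub>free_group X\<^esub> u) = length u" if "u \<in> carrier (free_group X)" for u
      using that by (simp add: inv_free_group)
    show "min (int (length u) + int (length v) - int (length (inv\<^bsub>free_group X\<^esub> u \<otimes>\<^bsub>free_group X\<^esub> v)))
        (int (length v) + int (length w) - int (length (inv\<^bsub>free_group X\<^esub> v \<otimes>\<^bsub>free_group X\<^esub> w)))
        \<le> int (length u) + int (length w) - int (length (inv\<^bsub>free_group X\<^esub> u \<otimes>\<^bsub>free_group X\<^esub> w))"
      if "u \<in> carrier (free_group X)" "v \<in> carrier (free_group X)" "w \<in> carrier (free_group X)" for u v w
      using lcp_ultrametric[of u v w] by (simp only: len that)
    show "length w < length (w \<otimes>\<^bsub>free_group X\<^esub> w)"
      if "w \<in> carrier (free_group X)" "w \<noteq> \<one>\<^bsub>free_group X\<^esub>" for w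
      using length_square_gt[of w] that by (simp add: free_group_def)
    have "finite {w \<in> words_over X. length w \<le> k}" for k
      using finite_short_words assms .
    then show "finite {w \<in> carrier (free_group X). length w \<le> k}" for k
      by (rule rev_finite_subset) (auto simp: free_group_def)
  qed
qed

definition branch_word :: "nat \<Rightarrow> nat word"
  where "branch_word k = replicate k (0, True) @ [(1, True)]"

lemma branch_word_carrier: "n \<ge> 2 \<Longrightarrow> branch_word k \<in> carrier (free_group {..<n})"
  by (auto simp: branch_word_def free_group_def words_over_def freely_reduced_def
      successively_conv_nth nth_append inv_letter_def)

text \<open>In the abelianisation \<open>branch_word k\<close> has exponent sums \<open>k\<close>
  and 1 in the first two generators. Equal powers \<open>i\<close> and \<open>j\<close> satisfy
  \<open>i = j\<close> by the second sum and then \<open>k = l\<close> by the first.\<close>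

lemma branch_word_independent:
  assumes n: "n \<ge> 2" and "length_group.commensurable (free_group {..<n}) (branch_word k) (branch_word l)"
  shows "k = l"
proof -
  interpret F: length_group "free_group {..<n}" length
    by (rule length_group_free_group) simp
  interpret Z: group integer_group by (rule group_integer_group)
  define e where "e c = subst_value integer_group (\<lambda>i. if i = c then 1 else 0)" for c :: nat
  interpret e: group_hom "free_group {..<n}" integer_group "e c" for c
    unfolding e_def by unfold_locales (rule Z.subst_value_hom_free_group, simp)
  have e_branch: "e c (branch_word k) = (if c = 0 then int k else if c = 1 then 1 else 0)" for c k
    unfolding e_def branch_word_def
    by (subst Z.subst_value_append[of _ UNIV]) (auto simp: words_over_def Z.subst_value_powers)
  from assms(2) obtain i j :: int where ij: "i \<noteq> 0" "j \<noteq> 0"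
    "branch_word k [^]\<^bsub>free_group {..<n}\<^esub> i = branch_word l [^]\<^bsub>free_group {..<n}\<^esub> j"
    unfolding F.commensurable_def by blast
  then have "e c (branch_word k) * i = e c (branch_word l) * j" for c
    using e.hom_int_pow[OF branch_word_carrier[OF n], of c k i]
      e.hom_int_pow[OF branch_word_carrier[OF n], of c l j] by (simp add: mult.commute)
  from this[of 0] this[of 1] ij show ?thesis
    by (simp add: e_branch)
qed

theorem girth_infinite_of_ascending:
  fixes E :: "('c, 'd) monoid_scheme" and n :: nat
  defines "F \<equiv> free_group {..<n}"
  assumes n: "n \<ge> 2" and "group E"
    and \<phi>: "\<phi> \<in> hom F F" "inj_on \<phi> (carrier F)" and \<iota>: "\<iota> \<in> hom F E" "inj_on \<iota> (carrier F)"
    and t: "t \<in> carrier E" "\<And>f. f \<in> carrier F \<Longrightarrow> \<iota> f \<otimes>\<^bsub>E\<^esub> t = t \<otimes>\<^bsub>E\<^esub> \<iota> (\<phi> f)"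
      "\<And>k :: nat. t [^]\<^bsub>E\<^esub> k \<in> \<iota> ` carrier F \<Longrightarrow> k = 0"
    and gen: "generate E (insert t (\<iota> ` carrier F)) = carrier E"
  shows "girth E = \<infinity>"
proof -
  interpret F: length_group F length
    unfolding F_def by (rule length_group_free_group) simp
  interpret E: group E by fact
  have inj: "inj branch_word"
  proof (rule injI)
    fix k l assume "branch_word k = branch_word l"
    then have "length (branch_word k) = length (branch_word l)" by simp
    then show "k = l" by (simp add: branch_word_def)
  qed
  interpret ascending_hnn F length E \<phi> \<iota> t "\<lambda>i. [(i, True)]" n "range branch_word"
  proof
    show "(\<lambda>i. [(i, True)]) \<in> {..<n} \<rightarrow> carrier F"
      by (auto simp: F_def letter_in_free_group)
    show "generate F ((\<lambda>i. [(i, True)]) ` {..<n}) = carrier F"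
      unfolding F_def by (rule generate_letters)
    show "subst_value F (\<lambda>i. [(i, True)]) w \<noteq> \<one>\<^bsub>F\<^esub>"
      if "w \<in> words_over {..<n}" "freely_reduced w" "w \<noteq> []" for w
      using subst_value_letters[of w "{..<n}"] that by (simp add: F_def free_group_def)
    show "infinite (range branch_word)"
      using inj by (simp add: finite_image_iff)
    show "range branch_word \<subseteq> carrier F - {\<one>\<^bsub>F\<^esub>}"
      using branch_word_carrier[OF n] by (auto simp: F_def) (simp add: free_group_def branch_word_def)
    show "y = y'" if "y \<in> range branch_word" "y' \<in> range branch_word" "F.commensurable y y'" for y y'
      using that branch_word_independent[OF n] unfolding F_def by blast
  qed (use \<phi> \<iota> t gen in auto)
  show ?thesis by (rule girth_infinite)
qed

theorem corollary1p5:
  fixes n :: nat and F :: "nat word monoid" and A B :: "nat word set"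
    and \<phi> :: "nat word \<Rightarrow> nat word"
  defines "F \<equiv> free_group {..<n}"
  assumes "n \<ge> 2"
    and "subgroup A F"
    and "subgroup B F"
    and "\<phi> \<in> iso (F\<lparr>carrier := A\<rparr>) (F\<lparr>carrier := B\<rparr>)"
  shows "girth (hnn_extension F A \<phi>) = \<infinity>"
proof -
  interpret F: group F unfolding F_def by (rule group_free_group)
  have AB: "A \<subseteq> carrier F" "B \<subseteq> carrier F"
    using assms(3,4) subgroup.subset by blast+
  have \<phi>B: "bij_betw \<phi> A B"
    using assms(5) by (simp add: iso_def)
  have \<phi>_hom: "\<phi> \<in> hom (F\<lparr>carrier := A\<rparr>) F"
    using assms(5) AB by (auto simp: iso_def hom_def)
  interpret hnn F A \<phi>
    by (intro hnn.intro hnn_axioms.intro F.is_group assms(3) \<phi>_hom bij_betw_imp_inj_on[OF \<phi>B])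
  have cF: "countable (carrier F)" by simp
  consider "A = carrier F" | "B = carrier F" | "A \<noteq> carrier F" "B \<noteq> carrier F" by blast
  then show ?thesis
  proof cases
    case 1
    show ?thesis
    proof (rule girth_infinite_of_ascending[OF assms(2), folded F_def, of \<Gamma> \<phi> \<iota> t])
      show "\<phi> \<in> hom F F" "inj_on \<phi> (carrier F)"
        using \<phi>_hom \<phi>_inj 1 by simp_all
      show "\<iota> f \<otimes>\<^bsub>\<Gamma>\<^esub> t = t \<otimes>\<^bsub>\<Gamma>\<^esub> \<iota> (\<phi> f)" if "f \<in> carrier F" for f
        using \<iota>_t that 1 by blast
    qed (use E.is_group \<iota>_hom \<iota>_inj[OF cF] t_power_notin[OF cF] generate_hnn in auto)
  next
    case 2
    \<comment> \<open>With \<phi> onto F, the relation read backwards is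
      \<open>f t^-1 = t^-1 \<psi>(f)\<close> for every \<open>f\<close> in F, so \<Gamma> is
      ascending for \<psi> with stable letter \<open>t^-1\<close>.\<close>
    let ?\<psi> = "inv_into A \<phi>"
    have \<psi>: "?\<psi> f \<in> A" "\<phi> (?\<psi> f) = f" if "f \<in> carrier F" for f
      using that 2 \<phi>B by (auto simp: bij_betw_def inv_into_into f_inv_into_f)
    interpret FA: group "F\<lparr>carrier := A\<rparr>"
      using subgroup.subgroup_is_group[OF assms(3) F.is_group] .
    have "?\<psi> \<in> iso (F\<lparr>carrier := B\<rparr>) (F\<lparr>carrier := A\<rparr>)"
      using FA.iso_set_sym[OF assms(5)] by simp
    then have \<psi>_hom: "?\<psi> \<in> hom F F" and \<psi>_inj: "inj_on ?\<psi> (carrier F)"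
      using 2 AB by (auto simp: iso_def hom_def bij_betw_def)
    show ?thesis
    proof (rule girth_infinite_of_ascending[OF assms(2), folded F_def, of \<Gamma> ?\<psi> \<iota> "inv\<^bsub>\<Gamma>\<^esub> t"])
      show "\<iota> f \<otimes>\<^bsub>\<Gamma>\<^esub> inv\<^bsub>\<Gamma>\<^esub> t = inv\<^bsub>\<Gamma>\<^esub> t \<otimes>\<^bsub>\<Gamma>\<^esub> \<iota> (?\<psi> f)" if f: "f \<in> carrier F" for f
      proof -
        have "inv\<^bsub>\<Gamma>\<^esub> t \<otimes>\<^bsub>\<Gamma>\<^esub> (\<iota> (?\<psi> f) \<otimes>\<^bsub>\<Gamma>\<^esub> t) = \<iota> f"
          using \<iota>_t[OF \<psi>(1)[OF f]] \<psi>(2)[OF f] f by (simp flip: E.m_assoc)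
        then show ?thesis
          using f \<psi>(1)[OF f] by (metis A_closed E.inv_closed E.inv_solve_right E.m_assoc E.m_closed \<iota>_closed t_closed)
      qed
      show "k = 0" if "inv\<^bsub>\<Gamma>\<^esub> t [^]\<^bsub>\<Gamma>\<^esub> k \<in> \<iota> ` carrier F" for k :: nat
      proof -
        from that obtain f where f: "f \<in> carrier F" "inv\<^bsub>\<Gamma>\<^esub> (t [^]\<^bsub>\<Gamma>\<^esub> k) = \<iota> f"
          by (auto simp: E.nat_pow_inv)
        then have "t [^]\<^bsub>\<Gamma>\<^esub> k = \<iota> (inv\<^bsub>F\<^esub> f)"
          by (metis E.inv_inv E.nat_pow_closed \<iota>.hom_inv t_closed)
        with f(1) show ?thesis by (metis t_power_notin[OF cF] F.inv_closed imageI)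
      qed
      let ?H = "generate \<Gamma> (insert (inv\<^bsub>\<Gamma>\<^esub> t) (\<iota> ` carrier F))"
      have H: "subgroup ?H \<Gamma>" by (rule E.generate_is_subgroup) auto
      have "inv\<^bsub>\<Gamma>\<^esub> (inv\<^bsub>\<Gamma>\<^esub> t) \<in> ?H"
        by (intro subgroup.m_inv_closed[OF H] generate.incl) simp
      then have "insert t (\<iota> ` carrier F) \<subseteq> ?H"
        by (auto intro: generate.incl)
      then have "carrier \<Gamma> \<subseteq> ?H"
        unfolding generate_hnn[symmetric] by (rule E.generate_subgroup_incl[OF _ H])
      then show "?H = carrier \<Gamma>"
        using subgroup.subset[OF H] by blast
    qed (use E.is_group \<iota>_hom \<iota>_inj[OF cF] \<psi>_hom \<psi>_inj in auto)
  next
    case 3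
    then show ?thesis
      using girth_infinite_of_proper[OF cF, of "\<lambda>i. [(i, True)]" n] \<phi>B generate_letters[of "{..<n}"]
      by (auto simp: bij_betw_def F_def letter_in_free_group)
  qed
qed

end
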